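(* Let $M\subset\mathbb{R}^{n+1}$ be a cone over a connected open set $C\subset\mathbb{S}^n$ with nonempty smooth boundary. The isoperimetric profile $I_M$ of $M$ is bounded from above by the isoperimetric profile of the half-space, i.e. $I_M(V)\le I_n(V)$ for all $V>0$.
   Context: The cone over $C$ is $M=\{tp:t>0,\ p\in C\}$. $\mathrm{vol}$ is $(n+1)$-dimensional Hausdorff measure. For measurable $\Omega\subseteq M$, $\mathcal{P}(\Omega)$ is the perimeter relative to $M$: $\mathcal{P}(\Omega)=\sup\{\int_\Omega\mathrm{div}\,Y\,d\mathcal{H}^{n+1}:|Y|\le1\}$ over smooth vector fields $Y$ with compact support in $M$. The isoperimetric profile is $I_M(V)=\inf\{\mathcal{P}(\Omega):\Omega\subseteq M,\ \mathrm{vol}(\Omega)=V\}$, $V>0$. The isoperimetric profile of the half-space of $\mathbb{R}^{n+1}$ is $I_n(V)=(\mathbf{c}_n/2)^{1/(n+1)}(n+1)^{n/(n+1)}V^{n/(n+1)}$, where $\mathbf{c}_n=\mathcal{H}^n(\mathbb{S}^n)$. *)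

theory Defs
  imports "HOL-Analysis.Analysis"
begin

section \<open>Hausdorff measure\<close>

text \<open>
  The normalisation makes the \<open>k\<close>-dimensional Hausdorff measure agree with Lebesgue measure
  on \<open>k\<close>-dimensional Euclidean space. Boundedness is required because \<^const>\<open>diameter\<close> is a
  junk value on unbounded sets; the case distinction matters only for \<open>k = 0\<close>, where
  \<open>0 ^ 0 = 1\<close> is right for points but not for the empty set.
\<close>

definition hausdorff_gauge :: "nat \<Rightarrow> 'a::metric_space set \<Rightarrow> ennreal" where
  "hausdorff_gauge k E =
     (if E = {} then 0 else ennreal (unit_ball_vol (real k) * (diameter E / 2) ^ k))"

definition hausdorff_pre :: "nat \<Rightarrow> real \<Rightarrow> 'a::metric_space set \<Rightarrow> ennreal" where
  "hausdorff_pre k \<delta> A =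
     (INF E \<in> {E :: nat \<Rightarrow> 'a set. A \<subseteq> (\<Union>i. E i) \<and> (\<forall>i. bounded (E i) \<and> diameter (E i) \<le> \<delta>)}.
        \<Sum>i. hausdorff_gauge k (E i))"

definition hausdorff_outer :: "nat \<Rightarrow> 'a::metric_space set \<Rightarrow> ennreal" where
  "hausdorff_outer k A = (SUP \<delta> \<in> {0<..}. hausdorff_pre k \<delta> A)"

text \<open>The measurable sets are those satisfying Caratheodory's criterion for the outer measure.\<close>

definition hausdorff_measure :: "nat \<Rightarrow> 'a::metric_space measure" where
  "hausdorff_measure k =
     measure_of UNIV (lambda_system UNIV UNIV (hausdorff_outer k)) (hausdorff_outer k)"

text \<open>
  \<^const>\<open>measure_of\<close> would return the zero measure if its argument were not countably additive;
  the following facts rule this out.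
\<close>

lemma hausdorff_pre_mono: "A \<subseteq> B \<Longrightarrow> hausdorff_pre k \<delta> A \<le> hausdorff_pre k \<delta> B"
  unfolding hausdorff_pre_def by (rule INF_superset_mono) auto

lemma hausdorff_pre_countably_subadditive:
  fixes A :: "nat \<Rightarrow> 'a::metric_space set"
  shows "hausdorff_pre k \<delta> (\<Union>i. A i) \<le> (\<Sum>i. hausdorff_pre k \<delta> (A i))"
proof (rule ennreal_le_epsilon)
  fix e :: real
  assume fin: "(\<Sum>i. hausdorff_pre k \<delta> (A i)) < top" and e: "0 < e"
  have "\<exists>E. A i \<subseteq> (\<Union>j. E j) \<and> (\<forall>j. bounded (E j) \<and> diameter (E j) \<le> \<delta>) \<and>
      (\<Sum>j. hausdorff_gauge k (E j)) < hausdorff_pre k \<delta> (A i) + ennreal (e * (1/2) ^ Suc i)" for i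
  proof -
    have "hausdorff_pre k \<delta> (A i) \<noteq> top"
      using fin by (metis ennreal_suminf_lessD less_top)
    then have "hausdorff_pre k \<delta> (A i) < hausdorff_pre k \<delta> (A i) + ennreal (e * (1/2) ^ Suc i)"
      using e ennreal_add_left_cancel_less[of "hausdorff_pre k \<delta> (A i)" 0
          "ennreal (e * (1/2) ^ Suc i)"]
      by simp
    then have "(INF E \<in> {E. A i \<subseteq> (\<Union>j. E j) \<and> (\<forall>j. bounded (E j) \<and> diameter (E j) \<le> \<delta>)}.
        \<Sum>j. hausdorff_gauge k (E j)) < hausdorff_pre k \<delta> (A i) + ennreal (e * (1/2) ^ Suc i)"
      by (simp only: hausdorff_pre_def)
    then show ?thesis
      unfolding INF_less_iff by blast
  qed
  then have "\<forall>i. \<exists>E. A i \<subseteq> (\<Union>j. E j) \<and> (\<forall>j. bounded (E j) \<and> diameter (E j) \<le> \<delta>) \<and>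
      (\<Sum>j. hausdorff_gauge k (E j)) < hausdorff_pre k \<delta> (A i) + ennreal (e * (1/2) ^ Suc i)"
    by blast
  from choice[OF this] obtain E where cov: "\<And>i. A i \<subseteq> (\<Union>j. E i j)"
    and bd: "\<And>i j. bounded (E i j) \<and> diameter (E i j) \<le> \<delta>"
    and lt: "\<And>i. (\<Sum>j. hausdorff_gauge k (E i j))
                 < hausdorff_pre k \<delta> (A i) + ennreal (e * (1/2) ^ Suc i)"
    by blast
  define F where "F = (\<lambda>n. case prod_decode n of (i, j) \<Rightarrow> E i j)"
  have F: "F (prod_encode (i, j)) = E i j" for i j
    by (simp add: F_def)
  have "(\<Union>i. A i) \<subseteq> (\<Union>n. F n)"
  proof
    fix x assume "x \<in> (\<Union>i. A i)"
    then obtain i where "x \<in> A i" by auto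
    then obtain j where "x \<in> E i j" using cov[of i] by auto
    then have "x \<in> F (prod_encode (i, j))" by (simp only: F)
    then show "x \<in> (\<Union>n. F n)" by (rule UN_I[OF UNIV_I])
  qed
  moreover have "bounded (F n) \<and> diameter (F n) \<le> \<delta>" for n
    using bd by (auto simp: F_def split: prod.split)
  ultimately have "hausdorff_pre k \<delta> (\<Union>i. A i) \<le> (\<Sum>n. hausdorff_gauge k (F n))"
    unfolding hausdorff_pre_def by (intro INF_lower) auto
  also have "\<dots> = (\<Sum>i j. hausdorff_gauge k (E i j))"
    using suminf_ennreal_2dimen[of "\<lambda>i. \<Sum>j. hausdorff_gauge k (E i j)"
        "\<lambda>(i, j). hausdorff_gauge k (E i j)"]
    by (simp add: F_def case_prod_unfold)
  also have "\<dots> \<le> (\<Sum>i. hausdorff_pre k \<delta> (A i) + ennreal (e * (1/2) ^ Suc i))"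
    by (intro suminf_le less_imp_le lt) auto
  also have "\<dots> = (\<Sum>i. hausdorff_pre k \<delta> (A i)) + (\<Sum>i. ennreal (e * (1/2) ^ Suc i))"
    by (simp add: suminf_add)
  also have "(\<Sum>i. ennreal (e * (1/2) ^ Suc i)) = ennreal e"
    using sums_mult[OF power_half_series, of e] e by (intro suminf_ennreal_eq) simp_all
  finally show "hausdorff_pre k \<delta> (\<Union>i. A i) \<le> (\<Sum>i. hausdorff_pre k \<delta> (A i)) + ennreal e" .
qed

lemma outer_measure_space_hausdorff:
  "outer_measure_space UNIV (hausdorff_outer k :: 'a::metric_space set \<Rightarrow> ennreal)"
  unfolding outer_measure_space_def
proof (intro conjI)
  have "hausdorff_pre k \<delta> ({}::'a set) = 0" if "0 < \<delta>" for \<delta>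
  proof -
    have "hausdorff_pre k \<delta> ({}::'a set) \<le> (\<Sum>i::nat. hausdorff_gauge k ({}::'a set))"
      unfolding hausdorff_pre_def using that by (intro INF_lower) auto
    then show ?thesis
      by (simp add: hausdorff_gauge_def)
  qed
  then show "positive UNIV (hausdorff_outer k :: 'a set \<Rightarrow> ennreal)"
    by (auto simp: positive_def hausdorff_outer_def)
  show "increasing UNIV (hausdorff_outer k :: 'a set \<Rightarrow> ennreal)"
    unfolding increasing_def hausdorff_outer_def
    by (auto intro!: SUP_mono' hausdorff_pre_mono)
  show "countably_subadditive UNIV (hausdorff_outer k :: 'a set \<Rightarrow> ennreal)"
    unfolding countably_subadditive_def
  proof (intro allI impI)
    fix A :: "nat \<Rightarrow> 'a set"
    show "hausdorff_outer k (\<Union>i. A i) \<le> (\<Sum>i. hausdorff_outer k (A i))"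
      unfolding hausdorff_outer_def[of k "\<Union>i. A i"]
    proof (rule SUP_least)
      fix \<delta> :: real assume "\<delta> \<in> {0<..}"
      then have "(\<Sum>i. hausdorff_pre k \<delta> (A i)) \<le> (\<Sum>i. hausdorff_outer k (A i))"
        unfolding hausdorff_outer_def by (intro suminf_le SUP_upper) auto
      with hausdorff_pre_countably_subadditive
      show "hausdorff_pre k \<delta> (\<Union>i. A i) \<le> (\<Sum>i. hausdorff_outer k (A i))"
        by (rule order_trans)
    qed
  qed
qed

lemma measure_space_hausdorff:
  "measure_space UNIV (lambda_system UNIV UNIV (hausdorff_outer k))
     (hausdorff_outer k :: 'a::metric_space set \<Rightarrow> ennreal)"
proof -
  interpret sigma_algebra "UNIV :: 'a set" "UNIV :: 'a set set"
    using sigma_algebra_Pow[of "UNIV :: 'a set"] by simp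
  show ?thesis
    by (rule caratheodory_lemma[OF outer_measure_space_hausdorff])
qed

lemma sets_hausdorff_measure:
  "sets (hausdorff_measure k) = lambda_system UNIV UNIV (hausdorff_outer k)"
  unfolding hausdorff_measure_def using measure_space_hausdorff
  by (intro sigma_algebra.sets_measure_of_eq) (auto simp: measure_space_def)

lemma emeasure_hausdorff_measure:
  "A \<in> sets (hausdorff_measure k) \<Longrightarrow> emeasure (hausdorff_measure k) A = hausdorff_outer k A"
  unfolding sets_hausdorff_measure unfolding hausdorff_measure_def
  using measure_space_hausdorff[of k]
  by (intro emeasure_measure_of_sigma) (auto simp: measure_space_def)


section \<open>Smooth functions and divergence\<close>

text \<open>Meaningful for open \<open>S\<close>; the case \<open>k\<close> says that all iterated directional derivatives
  up to order \<open>k\<close> exist and are continuous.\<close>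

fun times_differentiable_on ::
  "nat \<Rightarrow> ('a::real_normed_vector \<Rightarrow> 'b::real_normed_vector) \<Rightarrow> 'a set \<Rightarrow> bool" where
  "times_differentiable_on 0 f S \<longleftrightarrow> continuous_on S f"
| "times_differentiable_on (Suc k) f S \<longleftrightarrow>
     (\<forall>x\<in>S. f differentiable (at x)) \<and>
     (\<forall>v. times_differentiable_on k (\<lambda>x. frechet_derivative f (at x) v) S)"

definition smooth_on :: "('a::real_normed_vector \<Rightarrow> 'b::real_normed_vector) \<Rightarrow> 'a set \<Rightarrow> bool" where
  "smooth_on f S \<longleftrightarrow> (\<forall>k. times_differentiable_on k f S)"

definition divergence :: "('a::euclidean_space \<Rightarrow> 'a) \<Rightarrow> 'a \<Rightarrow> real" where
  "divergence Y x = (\<Sum>b\<in>Basis. frechet_derivative Y (at x) b \<bullet> b)"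


section \<open>Cones over spherical domains\<close>

abbreviation unit_sphere :: "'a::euclidean_space set" where
  "unit_sphere \<equiv> sphere 0 1"

definition cone_over :: "'a::euclidean_space set \<Rightarrow> 'a set" where
  "cone_over C = {t *\<^sub>R p | t p. 0 < t \<and> p \<in> C}"

text \<open>The boundary is taken inside the unit sphere.\<close>

definition sphere_boundary :: "'a::euclidean_space set \<Rightarrow> 'a set" where
  "sphere_boundary C = top_of_set unit_sphere frontier_of C"

text \<open>
  Near each boundary point, \<open>C\<close> is the sublevel set of a smooth function whose restriction to the
  sphere is regular on its zero set. The tangent space of the sphere at \<open>x\<close> is the orthogonal
  complement of \<open>x\<close>. By regularity, the zero set of \<open>f\<close> in \<open>U \<inter> unit_sphere\<close> is exactly the
  part of the boundary of \<open>C\<close> in \<open>U\<close>.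
\<close>

definition smooth_boundary :: "'a::euclidean_space set \<Rightarrow> bool" where
  "smooth_boundary C \<longleftrightarrow>
     (\<forall>p \<in> sphere_boundary C. \<exists>U (f :: 'a \<Rightarrow> real).
        open U \<and> p \<in> U \<and> smooth_on f U \<and>
        C \<inter> U = {x \<in> unit_sphere \<inter> U. f x < 0} \<and>
        (\<forall>x \<in> unit_sphere \<inter> U. f x = 0 \<longrightarrow>
           (\<exists>v. v \<bullet> x = 0 \<and> frechet_derivative f (at x) v \<noteq> 0)))"


section \<open>Relative perimeter and isoperimetric profile\<close>

text \<open>In \<open>(n+1)\<close>-dimensional space, \<open>DIM('a) = n + 1\<close>.\<close>

abbreviation vol_measure :: "'a::euclidean_space measure" where
  "vol_measure \<equiv> hausdorff_measure DIM('a)"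

definition admissible_fields :: "'a::euclidean_space set \<Rightarrow> ('a \<Rightarrow> 'a) set" where
  "admissible_fields M =
     {Y. smooth_on Y M \<and> compact (closure {x. Y x \<noteq> 0}) \<and> closure {x. Y x \<noteq> 0} \<subseteq> M \<and>
         (\<forall>x. norm (Y x) \<le> 1)}"

definition relative_perimeter :: "'a::euclidean_space set \<Rightarrow> 'a set \<Rightarrow> ereal" where
  "relative_perimeter M \<Omega> =
     (SUP Y \<in> admissible_fields M. ereal (LINT x:\<Omega>|vol_measure. divergence Y x))"

definition isoperimetric_profile :: "'a::euclidean_space set \<Rightarrow> real \<Rightarrow> ereal" where
  "isoperimetric_profile M V =
     (INF \<Omega> \<in> {\<Omega>. \<Omega> \<subseteq> M \<and> \<Omega> \<in> sets vol_measure \<and> emeasure vol_measure \<Omega> = ennreal V}.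
        relative_perimeter M \<Omega>)"

text \<open>The constant \<open>c\<close> stands for the \<open>n\<close>-dimensional Hausdorff measure of the unit sphere in \<open>(n+1)\<close>-space.\<close>

definition half_space_profile :: "real \<Rightarrow> nat \<Rightarrow> real \<Rightarrow> real" where
  "half_space_profile c n V =
     (c / 2) powr (1 / (real n + 1)) * (real n + 1) powr (real n / (real n + 1))
       * V powr (real n / (real n + 1))"

end

theory Submission
  imports Defs
begin

text \<open>
  Let \<open>N = n + 1\<close>, let \<open>p\<close> be a boundary point of \<open>C\<close> and let \<open>u r\<close> be the volume of the part
  of the ball \<open>B(p, r)\<close> inside the cone \<open>M\<close>. Blowing up at \<open>p\<close> turns \<open>M\<close> into a half-space, so
  \<open>u r / r ^ N\<close> tends to \<open>\<omega> / 2\<close> as \<open>r\<close> tends to \<open>0\<close>, where \<open>\<omega>\<close> is the volume of the unit ball.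
  The perimeter of \<open>M \<inter> B(q, R)\<close> relative to \<open>M\<close> is at most the lower right derivative at \<open>R\<close>
  of the volume of \<open>M \<inter> B(q, r)\<close> as a function of \<open>r\<close>. As \<open>u powr (1 / N)\<close> is nearly linear near
  \<open>0\<close> with slope \<open>a = (\<omega> / 2) powr (1 / N)\<close>, it has at some small radius a lower right
  derivative close to \<open>a\<close>; dilating that ball from the vertex so that the volume becomes \<open>V\<close>
  gives perimeter close to \<open>N * a * V powr (n / N)\<close>.

  This is the half-space profile once the \<open>n\<close>-dimensional Hausdorff measure of the sphere is known
  to be at least \<open>N * \<omega>\<close>. Like the identification of \<open>N\<close>-dimensional Hausdorff measure with
  Lebesgue measure, that bound rests on an isodiametric estimate: \<open>X\<close> has at most the volume of
  \<open>(X - X) / 2\<close>, by the Prekopa-Leindler inequality.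
\<close>

section \<open>Hausdorff measure as a metric outer measure\<close>

text \<open>The growth of \<open>u\<close> at \<open>0\<close> says nothing about its derivative at
  a prescribed radius. The perimeter bound is therefore stated with difference quotients along some
  arbitrarily small increments: a monotone function that rises by less than
  \<open>m * (s - r)\<close> from \<open>r\<close> to \<open>s\<close> has such quotients at most
  \<open>m\<close> at some point, so no derivative has to exist. Taking the root
  \<open>u powr (1 / N)\<close> beforehand makes the slope invariant under dilation: if
  \<open>z ^ N\<close> is the volume and \<open>z\<close> has slope \<open>m\<close>, the dilated
  ball of volume \<open>V\<close> has perimeter at most \<open>N * m * V powr (n / N)\<close>,
  whatever the radius was. The half-space profile increases with the constant \<open>c\<close>, so
  it is a lower bound for the area of the sphere that matters. The area is reached through volumes:
  pieces of the sphere are thickened radially, and an inequality for sets in \<open>N\<close>-space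
  yields one in dimension \<open>n\<close>. The Prekopa-Leindler form suits this purpose because it
  is multiplicative and passes through Fubini's theorem one coordinate at a time.\<close>

lemma hausdorff_pre_antimono:
  assumes "\<delta> \<le> \<epsilon>"
  shows "hausdorff_pre k \<epsilon> A \<le> hausdorff_pre k \<delta> A"
  unfolding hausdorff_pre_def
  by (rule INF_superset_mono) (use assms order_trans in blast)+

lemma hausdorff_outer_mono: "A \<subseteq> B \<Longrightarrow> hausdorff_outer k A \<le> hausdorff_outer k B"
  unfolding hausdorff_outer_def by (intro SUP_mono' hausdorff_pre_mono)

lemma hausdorff_outer_empty [simp]: "hausdorff_outer k ({} :: 'a::metric_space set) = 0"
  using outer_measure_space_hausdorff[where 'a='a, of k]
  by (simp add: outer_measure_space_def positive_def)

lemma hausdorff_outer_UN_le: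
  fixes A :: "nat \<Rightarrow> 'a::metric_space set"
  shows "hausdorff_outer k (\<Union>i. A i) \<le> (\<Sum>i. hausdorff_outer k (A i))"
  unfolding hausdorff_outer_def[of k "\<Union>i. A i"]
proof (rule SUP_least)
  fix \<delta> :: real assume "\<delta> \<in> {0<..}"
  then have "(\<Sum>i. hausdorff_pre k \<delta> (A i)) \<le> (\<Sum>i. hausdorff_outer k (A i))"
    unfolding hausdorff_outer_def by (intro suminf_le SUP_upper) auto
  with hausdorff_pre_countably_subadditive
  show "hausdorff_pre k \<delta> (\<Union>i. A i) \<le> (\<Sum>i. hausdorff_outer k (A i))"
    by (rule order_trans)
qed

lemma hausdorff_outer_Un_le:
  "hausdorff_outer k (A \<union> B) \<le> hausdorff_outer k A + hausdorff_outer k B"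
proof -
  have "hausdorff_outer k (\<Union>i. (if i = 0 then A else if i = (1::nat) then B else {}))
      \<le> (\<Sum>i. hausdorff_outer k (if i = 0 then A else if i = (1::nat) then B else {}))"
    by (rule hausdorff_outer_UN_le)
  also have "\<dots> = (\<Sum>i\<in>{0,1}. hausdorff_outer k (if i = 0 then A else if i = (1::nat) then B else {}))"
    by (rule suminf_finite) auto
  also have "(\<Union>i. (if i = 0 then A else if i = (1::nat) then B else {})) = A \<union> B"
    by (auto split: if_splits)
  finally show ?thesis by simp
qed

lemma hausdorff_outer_eq_SUP_nat:
  "hausdorff_outer k A = (SUP n. hausdorff_pre k (1 / real (Suc n)) A)"
proof (rule antisym)
  show "hausdorff_outer k A \<le> (SUP n. hausdorff_pre k (1 / real (Suc n)) A)"
    unfolding hausdorff_outer_def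
  proof (rule SUP_least)
    fix \<delta> :: real assume "\<delta> \<in> {0<..}"
    then obtain n where "1 / real (Suc n) < \<delta>"
      using nat_approx_posE by auto
    then have "hausdorff_pre k \<delta> A \<le> hausdorff_pre k (1 / real (Suc n)) A"
      by (intro hausdorff_pre_antimono) simp
    then show "hausdorff_pre k \<delta> A \<le> (SUP n. hausdorff_pre k (1 / real (Suc n)) A)"
      by (rule order_trans) (rule SUP_upper, simp)
  qed
  show "(SUP n. hausdorff_pre k (1 / real (Suc n)) A) \<le> hausdorff_outer k A"
    unfolding hausdorff_outer_def by (intro SUP_least SUP_upper) simp
qed

lemma incseq_hausdorff_pre: "incseq (\<lambda>n. hausdorff_pre k (1 / real (Suc n)) A)"
  by (intro incseq_SucI hausdorff_pre_antimono) (simp add: field_simps)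

section \<open>Caratheodory's criterion and Borel sets\<close>

text \<open>No set of diameter at most \<open>\<delta>\<close> meets both \<open>A\<close> and
  \<open>B\<close>. Discarding from a cover the pieces that miss \<open>A\<close>, respectively
  \<open>B\<close>, gives two covers in which no piece is counted twice.\<close>

lemma hausdorff_pre_separated:
  fixes A B :: "'a::metric_space set"
  assumes sep: "\<And>x y. x \<in> A \<Longrightarrow> y \<in> B \<Longrightarrow> \<delta> < dist x y" and "0 \<le> \<delta>"
  shows "hausdorff_pre k \<delta> A + hausdorff_pre k \<delta> B \<le> hausdorff_pre k \<delta> (A \<union> B)"
  unfolding hausdorff_pre_def[of k \<delta> "A \<union> B"]
proof (rule INF_greatest, clarify)
  fix E :: "nat \<Rightarrow> 'a set"
  assume cov: "A \<union> B \<subseteq> (\<Union>i. E i)" and E: "\<forall>i. bounded (E i) \<and> diameter (E i) \<le> \<delta>"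
  define F where "F X i = (if E i \<inter> X = {} then {} else E i)" for X i
  have F: "hausdorff_pre k \<delta> X \<le> (\<Sum>i. hausdorff_gauge k (F X i))" if "X \<subseteq> (\<Union>i. E i)" for X
    unfolding hausdorff_pre_def
  proof (rule INF_lower, clarify, intro conjI)
    show "X \<subseteq> (\<Union>i. F X i)" using that by (fastforce simp: F_def)
    show "\<forall>i. bounded (F X i) \<and> diameter (F X i) \<le> \<delta>"
      using E \<open>0 \<le> \<delta>\<close> by (auto simp: F_def)
  qed
  have "hausdorff_gauge k (F A i) + hausdorff_gauge k (F B i) \<le> hausdorff_gauge k (E i)" for i
  proof (cases "E i \<inter> A = {} \<or> E i \<inter> B = {}")
    case True
    then show ?thesis by (auto simp: F_def hausdorff_gauge_def)
  next
    case False
    then obtain x y where "x \<in> E i" "x \<in> A" "y \<in> E i" "y \<in> B" by auto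
    then have "\<delta> < dist x y" "dist x y \<le> diameter (E i)"
      using sep E by (auto intro: diameter_bounded_bound)
    with E show ?thesis by (meson leD order_trans)
  qed
  then have "(\<Sum>i. hausdorff_gauge k (F A i)) + (\<Sum>i. hausdorff_gauge k (F B i))
      \<le> (\<Sum>i. hausdorff_gauge k (E i))"
    by (subst suminf_add) (auto intro!: suminf_le)
  moreover have "hausdorff_pre k \<delta> A + hausdorff_pre k \<delta> B \<le>
      (\<Sum>i. hausdorff_gauge k (F A i)) + (\<Sum>i. hausdorff_gauge k (F B i))"
    using cov by (intro add_mono F) auto
  ultimately show "hausdorff_pre k \<delta> A + hausdorff_pre k \<delta> B \<le> (\<Sum>i. hausdorff_gauge k (E i))"
    by (rule order_trans[rotated])
qed

lemma hausdorff_outer_separated: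
  fixes A B :: "'a::metric_space set"
  assumes sep: "\<And>x y. x \<in> A \<Longrightarrow> y \<in> B \<Longrightarrow> d \<le> dist x y" and "0 < d"
  shows "hausdorff_outer k A + hausdorff_outer k B \<le> hausdorff_outer k (A \<union> B)"
proof -
  obtain m where m: "1 / real (Suc m) < d"
    using nat_approx_posE[OF \<open>0 < d\<close>] by auto
  have "hausdorff_outer k A + hausdorff_outer k B =
      (SUP n. hausdorff_pre k (1 / real (Suc n)) A + hausdorff_pre k (1 / real (Suc n)) B)"
    unfolding hausdorff_outer_eq_SUP_nat
    by (rule ennreal_SUP_add[symmetric]) (rule incseq_hausdorff_pre)+
  also have "\<dots> \<le> hausdorff_outer k (A \<union> B)"
  proof (rule SUP_least)
    fix n
    let ?\<epsilon> = "1 / real (Suc (max m n))"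
    have le: "?\<epsilon> \<le> 1 / real (Suc n)" "?\<epsilon> \<le> 1 / real (Suc m)"
      by (auto intro!: divide_left_mono)
    have "hausdorff_pre k (1 / real (Suc n)) A + hausdorff_pre k (1 / real (Suc n)) B
        \<le> hausdorff_pre k ?\<epsilon> A + hausdorff_pre k ?\<epsilon> B"
      using le by (intro add_mono hausdorff_pre_antimono)
    also have "\<dots> \<le> hausdorff_pre k ?\<epsilon> (A \<union> B)"
    proof (rule hausdorff_pre_separated)
      fix x y assume "x \<in> A" "y \<in> B"
      then show "?\<epsilon> < dist x y" using sep[of x y] m le(2) by linarith
    qed simp
    also have "\<dots> \<le> hausdorff_outer k (A \<union> B)"
      unfolding hausdorff_outer_def by (rule SUP_upper) auto
    finally show "hausdorff_pre k (1 / real (Suc n)) A + hausdorff_pre k (1 / real (Suc n)) B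
        \<le> hausdorff_outer k (A \<union> B)" .
  qed
  finally show ?thesis .
qed

lemma hausdorff_outer_separated_infdist:
  fixes A B F :: "'a::metric_space set"
  assumes A: "\<And>x. x \<in> A \<Longrightarrow> a \<le> infdist x F" and B: "\<And>y. y \<in> B \<Longrightarrow> infdist y F \<le> b"
    and "b < a"
  shows "hausdorff_outer k A + hausdorff_outer k B \<le> hausdorff_outer k (A \<union> B)"
proof (rule hausdorff_outer_separated)
  fix x y assume "x \<in> A" "y \<in> B"
  then show "a - b \<le> dist x y"
    using A[of x] B[of y] infdist_triangle[of x F y] by linarith
qed (use assms in simp)

text \<open>Caratheodory's criterion for metric outer measures. The part of \<open>X\<close> off
  \<open>F\<close> is exhausted by sets at positive distance from \<open>F\<close>; the shells left
  over have summable outer measure, because shells of equal parity are separated from each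
  other.\<close>

lemma closed_in_sets_hausdorff_measure:
  fixes F :: "'a::metric_space set"
  assumes "closed F"
  shows "F \<in> sets (hausdorff_measure k)"
\<comment> \<open>\<open>infdist\<close> to the empty set is \<open>0\<close>, so measuring
  distances to \<open>F\<close> makes sense for nonempty \<open>F\<close> only.\<close>
proof (cases "F = {}")
  case False
  let ?H = "hausdorff_outer k :: 'a set \<Rightarrow> ennreal"
  have main: "?H (X \<inter> F) + ?H (X - F) \<le> ?H X" for X
  proof (cases "?H X = top")
    case fin: False
    define d where "d x = infdist x F" for x
    define P where "P n = {x \<in> X. 1 / real (Suc n) \<le> d x}" for n
    \<comment> \<open>Neighbouring shells touch, but shells whose indices differ by at least
      \<open>2\<close> have positive distance. Even and odd indices are therefore summed separately,
      each sum being at most \<open>?H X\<close>.\<close>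
    define R where "R j = {x \<in> X. 1 / real (Suc (Suc j)) \<le> d x \<and> d x \<le> 1 / real (Suc j)}" for j
    have parity: "(\<Sum>j<m. ?H (R (2 * j + c))) \<le> ?H X" for c m
    proof -
      have "(\<Sum>j<m. ?H (R (2 * j + c))) \<le> ?H (\<Union>j<m. R (2 * j + c))"
      proof (induction m)
        case (Suc m)
        have "?H (\<Union>j<m. R (2 * j + c)) + ?H (R (2 * m + c))
            \<le> ?H ((\<Union>j<m. R (2 * j + c)) \<union> R (2 * m + c))"
        \<comment> \<open>For \<open>m = 0\<close> the union is empty; treating it apart also avoids
          the division by zero in \<open>1 / real (2 * m + c)\<close> when
          \<open>c = 0\<close>.\<close>
        proof (cases "m = 0")
          case False
          show ?thesis
          proof (rule hausdorff_outer_separated_infdist)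
            fix x assume "x \<in> (\<Union>j<m. R (2 * j + c))"
            then obtain j where "j < m" "1 / real (Suc (Suc (2 * j + c))) \<le> d x"
              by (auto simp: R_def)
            moreover have "1 / real (2 * m + c) \<le> 1 / real (Suc (Suc (2 * j + c)))"
              using \<open>j < m\<close> by (intro divide_left_mono) auto
            ultimately show "1 / real (2 * m + c) \<le> infdist x F"
              by (simp add: d_def)
          next
            fix y assume "y \<in> R (2 * m + c)"
            then show "infdist y F \<le> 1 / real (Suc (2 * m + c))"
              by (simp add: R_def d_def)
          qed (use False in \<open>auto simp: field_simps\<close>)
        qed simp
        then show ?case
          using Suc by (simp add: lessThan_Suc Un_commute add.commute)
            (meson add_left_mono order_trans)
      qed simp
      also have "\<dots> \<le> ?H X"
        by (rule hausdorff_outer_mono) (auto simp: R_def)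
      finally show ?thesis .
    qed
    have "(\<Sum>j<n. ?H (R j)) \<le> ?H X + ?H X" for n
    proof -
      have split: "(\<Sum>j<2 * m. f j) = (\<Sum>j<m. f (2 * j)) + (\<Sum>j<m. f (2 * j + 1))"
        for m and f :: "nat \<Rightarrow> ennreal"
        by (induction m) (auto simp: algebra_simps)
      have "(\<Sum>j<n. ?H (R j)) \<le> (\<Sum>j<2 * n. ?H (R j))"
        by (rule sum_mono2) auto
      also have "\<dots> \<le> ?H X + ?H X"
        unfolding split using parity[of 0 n] parity[of 1 n] by (intro add_mono) simp_all
      finally show ?thesis .
    qed
    then have S: "(\<Sum>j. ?H (R j)) \<le> ?H X + ?H X"
      by (intro suminf_le_const) auto
    have Sfin: "(\<Sum>j. ?H (R j)) \<noteq> top"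
      using S fin by (auto simp: top_unique)
    \<comment> \<open>The tail of the shell series is not estimated. Partial sums are kept on the
      left, and the finite total is cancelled after passing to the supremum over
      \<open>n\<close>.\<close>
    have step: "(?H (X \<inter> F) + ?H (X - F)) + (\<Sum>j<n. ?H (R j)) \<le> ?H X + (\<Sum>j. ?H (R j))" for n
    proof -
      have sub: "X - F \<subseteq> P n \<union> (\<Union>j. R (j + n))"
      proof
        fix x assume x: "x \<in> X - F"
        then have "d x > 0"
          using assms False by (auto simp: d_def infdist_pos_not_in_closed)
        show "x \<in> P n \<union> (\<Union>j. R (j + n))"
        proof (cases "1 / real (Suc n) \<le> d x")
          case False
          define Q where "Q i \<longleftrightarrow> 1 / real (Suc i) \<le> d x" for i
          obtain i where i: "Q i"
            using nat_approx_posE[OF \<open>d x > 0\<close>] by (auto simp: Q_def intro: less_imp_le)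
          define l where "l = (LEAST i. Q i)"
          have l: "Q l" "\<And>i. i < l \<Longrightarrow> \<not> Q i"
            unfolding l_def using i by (auto intro: LeastI dest: not_less_Least)
          have "n < l"
          proof (rule ccontr)
            assume "\<not> n < l"
            then have "1 / real (Suc n) \<le> 1 / real (Suc l)" by (intro divide_left_mono) auto
            with l(1) False show False by (simp add: Q_def)
          qed
          then obtain j where j: "l = Suc (j + n)"
            by (metis add.commute less_imp_Suc_add)
          have "x \<in> R (j + n)"
            using l(1) l(2)[of "j + n"] x by (auto simp: R_def Q_def j)
          then show ?thesis by auto
        qed (use x in \<open>auto simp: P_def\<close>)
      qed
      have "?H (X - F) \<le> ?H (P n) + ?H (\<Union>j. R (j + n))"
        using hausdorff_outer_mono[OF sub] hausdorff_outer_Un_le order_trans by blast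
      also have "\<dots> \<le> ?H (P n) + (\<Sum>j. ?H (R (j + n)))"
        by (intro add_left_mono hausdorff_outer_UN_le)
      finally have 1: "?H (X - F) \<le> ?H (P n) + (\<Sum>j. ?H (R (j + n)))" .
      have "?H (P n) + ?H (X \<inter> F) \<le> ?H (P n \<union> (X \<inter> F))"
        by (rule hausdorff_outer_separated_infdist[where a = "1 / real (Suc n)" and b = 0 and F = F])
          (auto simp: P_def d_def)
      also have "\<dots> \<le> ?H X"
        by (rule hausdorff_outer_mono) (auto simp: P_def)
      finally have 2: "?H (P n) + ?H (X \<inter> F) \<le> ?H X" .
      have 3: "(\<Sum>j. ?H (R j)) = (\<Sum>j. ?H (R (j + n))) + (\<Sum>j<n. ?H (R j))"
        by (rule suminf_offset) auto
      have "(?H (X \<inter> F) + ?H (X - F)) + (\<Sum>j<n. ?H (R j))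
          \<le> (?H (X \<inter> F) + (?H (P n) + (\<Sum>j. ?H (R (j + n))))) + (\<Sum>j<n. ?H (R j))"
        using 1 by (intro add_mono) auto
      also have "\<dots> = (?H (P n) + ?H (X \<inter> F)) + (\<Sum>j. ?H (R j))"
        unfolding 3 by (simp add: ac_simps)
      also have "\<dots> \<le> ?H X + (\<Sum>j. ?H (R j))"
        using 2 by (intro add_mono) auto
      finally show ?thesis .
    qed
    have "(?H (X \<inter> F) + ?H (X - F)) + (\<Sum>j. ?H (R j)) \<le> ?H X + (\<Sum>j. ?H (R j))"
    proof -
      have "(?H (X \<inter> F) + ?H (X - F)) + (\<Sum>j. ?H (R j))
          = (SUP n. (?H (X \<inter> F) + ?H (X - F)) + (\<Sum>j<n. ?H (R j)))"
        by (simp add: suminf_eq_SUP ennreal_SUP_add_right)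
      also have "\<dots> \<le> ?H X + (\<Sum>j. ?H (R j))"
        by (intro SUP_least step)
      finally show ?thesis .
    qed
    then show ?thesis
      using Sfin by (simp add: add.commute[of _ "\<Sum>j. ?H (R j)"] ennreal_add_left_cancel_le)
  qed simp
  have "?H (F \<inter> X) + ?H ((UNIV - F) \<inter> X) = ?H X" for X
  proof (rule antisym)
    show "?H (F \<inter> X) + ?H ((UNIV - F) \<inter> X) \<le> ?H X"
      using main[of X] by (simp add: Int_commute Diff_eq)
    have "X = (F \<inter> X) \<union> ((UNIV - F) \<inter> X)" by auto
    then show "?H X \<le> ?H (F \<inter> X) + ?H ((UNIV - F) \<inter> X)"
      using hausdorff_outer_Un_le[of k "F \<inter> X" "(UNIV - F) \<inter> X"] by simp
  qed
  then show ?thesis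
    by (simp add: sets_hausdorff_measure lambda_system_def)
qed simp

lemma space_hausdorff_measure [simp]: "space (hausdorff_measure k) = UNIV"
  by (simp add: hausdorff_measure_def space_measure_of_conv)

lemma sets_borel_subset_hausdorff:
  "sets (borel :: 'a::metric_space measure) \<subseteq> sets (hausdorff_measure k)"
proof -
  have "sigma_sets (space (hausdorff_measure k)) (Collect closed) \<subseteq> sets (hausdorff_measure k :: 'a measure)"
    by (rule sets.sigma_sets_subset) (auto simp: closed_in_sets_hausdorff_measure)
  then show ?thesis by (simp add: borel_eq_closed)
qed

text \<open>Applied to an isometry and its inverse, this gives invariance of Lebesgue measure once
  that measure is known to agree with Hausdorff measure.\<close>

lemma hausdorff_outer_nonexpansive_image:
  fixes f :: "'a::metric_space \<Rightarrow> 'b::metric_space"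
  assumes f: "\<And>x y. dist (f x) (f y) \<le> dist x y"
  shows "hausdorff_outer k (f ` A) \<le> hausdorff_outer k A"
  unfolding hausdorff_outer_def
proof (rule SUP_mono)
  fix \<delta> :: real assume \<delta>: "\<delta> \<in> {0<..}"
  have "hausdorff_pre k \<delta> (f ` A) \<le> hausdorff_pre k \<delta> A"
    unfolding hausdorff_pre_def[of k \<delta> A]
  proof (rule INF_greatest, clarify)
    fix E :: "nat \<Rightarrow> 'a set"
    assume cov: "A \<subseteq> (\<Union>i. E i)" and E: "\<forall>i. bounded (E i) \<and> diameter (E i) \<le> \<delta>"
    have d: "diameter (f ` E i) \<le> diameter (E i)" for i
    proof (cases "E i = {}")
      case False
      have "dist (f x) (f y) \<le> diameter (E i)" if "x \<in> E i" "y \<in> E i" for x y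
        using that E f diameter_bounded_bound by (metis order_trans)
      with False show ?thesis
        unfolding diameter_def[of "f ` E i"] by (auto intro!: cSUP_least)
    qed simp
    have b: "bounded (f ` E i)" for i
    proof -
      from E have "bounded (E i)" by simp
      then obtain x e where "\<forall>y\<in>E i. dist x y \<le> e" unfolding bounded_def by blast
      with f have "\<forall>z\<in>f ` E i. dist (f x) z \<le> e" by (auto intro: order_trans)
      then show ?thesis by (auto simp: bounded_def)
    qed
    have "hausdorff_pre k \<delta> (f ` A) \<le> (\<Sum>i. hausdorff_gauge k (f ` E i))"
      unfolding hausdorff_pre_def
    proof (rule INF_lower, clarify, intro conjI allI)
      show "f ` A \<subseteq> (\<Union>i. f ` E i)" using cov by blast
      show "diameter (f ` E i) \<le> \<delta>" for i using d[of i] E order_trans by blast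
    qed (rule b)
    also have "\<dots> \<le> (\<Sum>i. hausdorff_gauge k (E i))"
    proof (intro suminf_le)
      fix i show "hausdorff_gauge k (f ` E i) \<le> hausdorff_gauge k (E i)"
        unfolding hausdorff_gauge_def using d[of i] b[of i]
        by (auto intro!: ennreal_leI mult_left_mono power_mono simp: diameter_ge_0)
    qed auto
    finally show "hausdorff_pre k \<delta> (f ` A) \<le> (\<Sum>i. hausdorff_gauge k (E i))" .
  qed
  with \<delta> show "\<exists>\<epsilon>\<in>{0<..}. hausdorff_pre k \<delta> (f ` A) \<le> hausdorff_pre k \<epsilon> A" by auto
qed

section \<open>The isodiametric inequality\<close>

text \<open>For compact sets, take midpoints of one set with the minimum of the other, and of the
  other with the maximum of the first: these two half-size copies share at most one point. The
  general case follows by inner approximation. \<open>C\<close> is a Borel superset because the set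
  of midpoints of two Borel sets need not be Borel.\<close>

lemma real_midpoint_sum_bound:
  fixes A B C :: "real set"
  assumes A: "A \<in> sets borel" "A \<noteq> {}" and B: "B \<in> sets borel" "B \<noteq> {}" and C: "C \<in> sets borel"
    and mid: "\<And>x y. x \<in> A \<Longrightarrow> y \<in> B \<Longrightarrow> (x + y) / 2 \<in> C"
  shows "emeasure lborel A + emeasure lborel B \<le> 2 * emeasure lborel C"
proof -
  have K: "emeasure lborel K + emeasure lborel L \<le> 2 * emeasure lborel C"
    if K: "compact K" "K \<subseteq> A" "K \<noteq> {}" and L: "compact L" "L \<subseteq> B" "L \<noteq> {}" for K L
  proof -
    obtain s where s: "s \<in> K" "\<And>x. x \<in> K \<Longrightarrow> x \<le> s"
      using compact_attains_sup[OF K(1,3)] by blast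
    obtain t where t: "t \<in> L" "\<And>x. x \<in> L \<Longrightarrow> t \<le> x"
      using compact_attains_inf[OF L(1,3)] by blast
    let ?f = "\<lambda>x. (x + t) / 2" and ?g = "\<lambda>x. (s + x) / 2"
    have c: "compact (?f ` K)" "compact (?g ` L)"
      using K L by (auto intro!: compact_continuous_image continuous_intros)
    have half: "emeasure lborel ((\<lambda>x. (x + a) / 2) ` S) = ennreal (1/2) * emeasure lborel S"
      if "compact S" for S and a :: real
    proof -
      have "emeasure lebesgue ((\<lambda>x. (1/2) *\<^sub>R x + a / 2) ` S) = ennreal (\<bar>1/2\<bar> ^ DIM(real)) * emeasure lebesgue S"
        by (rule emeasure_lebesgue_affine)
      moreover have "(\<lambda>x. (1/2) *\<^sub>R x + a / 2) ` S = (\<lambda>x. (x + a) / 2) ` S"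
        by (intro image_cong) (auto simp: field_simps)
      moreover have "compact ((\<lambda>x. (x + a) / 2) ` S)"
        using that by (auto intro!: compact_continuous_image continuous_intros)
      ultimately show ?thesis
        using that by (simp add: borel_compact)
    qed
    have two: "2 * ennreal (1/2) = 1"
      using ennreal_mult[of 2 "1/2"] by simp
    have "emeasure lborel K + emeasure lborel L = 2 * (ennreal (1/2) * emeasure lborel K + ennreal (1/2) * emeasure lborel L)"
      by (simp only: distrib_left mult.assoc[symmetric] two mult_1)
    also have "ennreal (1/2) * emeasure lborel K + ennreal (1/2) * emeasure lborel L
        = emeasure lborel (?f ` K) + emeasure lborel (?g ` L)"
      using half[OF K(1), of t] half[OF L(1), of s] by (simp add: add.commute)
    also have "\<dots> = emeasure lborel (?f ` K - {(s + t) / 2}) + emeasure lborel (?g ` L)"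
      using c by (subst emeasure_Diff_null_set) (auto simp: borel_compact)
    also have "\<dots> = emeasure lborel ((?f ` K - {(s + t) / 2}) \<union> ?g ` L)"
    proof (rule plus_emeasure)
      show "(?f ` K - {(s + t) / 2}) \<inter> ?g ` L = {}"
      proof (rule ccontr)
        assume "(?f ` K - {(s + t) / 2}) \<inter> ?g ` L \<noteq> {}"
        then obtain z where z: "z \<in> ?f ` K" "z \<noteq> (s + t) / 2" "z \<in> ?g ` L" by blast
        then obtain x y where "x \<in> K" "z = (x + t) / 2" "y \<in> L" "z = (s + y) / 2" by blast
        with z(2) s(2)[of x] t(2)[of y] show False by simp
      qed
    qed (use c in \<open>auto simp: borel_compact\<close>)
    also have "\<dots> \<le> emeasure lborel C"
    proof (intro emeasure_mono)
      show "?f ` K - {(s + t) / 2} \<union> ?g ` L \<subseteq> C" using mid K L s(1) t(1) by blast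
    qed (use C in simp)
    finally show ?thesis
      by (simp add: mult_left_mono)
  qed
  have inner: "\<exists>K. compact K \<and> K \<subseteq> S \<and> K \<noteq> {} \<and> emeasure lborel S \<le> emeasure lborel K + ennreal e"
    if S: "S \<in> sets borel" "S \<noteq> {}" "bounded S" and "0 < e" for S :: "real set" and e
  proof -
    obtain p where p: "p \<in> S" using S by auto
    obtain T where T: "closed T" "T \<subseteq> S" "emeasure lebesgue (S - T) < ennreal e"
    proof (rule sets_lebesgue_inner_closed)
      show "S \<in> sets lebesgue" using S by simp
    qed (use \<open>0 < e\<close> in auto)
    have "compact T"
      using T S bounded_subset compact_eq_bounded_closed by blast
    have "emeasure lborel S = emeasure lborel (T \<union> (S - T))"
      using T by (intro arg_cong[where f = "emeasure lborel"]) auto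
    also have "\<dots> \<le> emeasure lborel T + emeasure lborel (S - T)"
      using S \<open>compact T\<close> by (intro emeasure_subadditive) (auto simp: borel_compact)
    also have "\<dots> \<le> emeasure lborel (insert p T) + ennreal e"
      using S T \<open>compact T\<close> by (intro add_mono emeasure_mono) (auto simp: borel_compact)
    finally show ?thesis
      using p T \<open>compact T\<close> by (intro exI[of _ "insert p T"]) auto
  qed
  have bdd: "emeasure lborel S + emeasure lborel T \<le> 2 * emeasure lborel C"
    if S: "S \<in> sets borel" "S \<noteq> {}" "bounded S" "S \<subseteq> A"
      and T: "T \<in> sets borel" "T \<noteq> {}" "bounded T" "T \<subseteq> B" for S T
  proof (rule ennreal_le_epsilon)
    fix e :: real assume "0 < e"
    obtain K where 1: "compact K" "K \<subseteq> S" "K \<noteq> {}" "emeasure lborel S \<le> emeasure lborel K + ennreal (e/2)"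
      using inner[OF S(1-3), of "e/2"] \<open>0 < e\<close> by auto
    obtain L where 2: "compact L" "L \<subseteq> T" "L \<noteq> {}" "emeasure lborel T \<le> emeasure lborel L + ennreal (e/2)"
      using inner[OF T(1-3), of "e/2"] \<open>0 < e\<close> by auto
    have "emeasure lborel S + emeasure lborel T
        \<le> (emeasure lborel K + emeasure lborel L) + (ennreal (e/2) + ennreal (e/2))"
      using add_mono[OF 1(4) 2(4)] by (simp add: ac_simps)
    also have "ennreal (e/2) + ennreal (e/2) = ennreal e"
      using \<open>0 < e\<close> by (simp flip: ennreal_plus)
    also have "emeasure lborel K + emeasure lborel L \<le> 2 * emeasure lborel C"
      using 1 2 S T by (intro K) auto
    finally show "emeasure lborel S + emeasure lborel T \<le> 2 * emeasure lborel C + ennreal e"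
      by (simp add: add_right_mono)
  qed
  obtain a b where ab: "a \<in> A" "b \<in> B" using A B by auto
  \<comment> \<open>The point \<open>p\<close> keeps every truncation nonempty, as the bounded case
    requires.\<close>
  define U where "U p S n = insert p (S \<inter> {- real n..real n})" for p :: real and S n
  have U: "incseq (U p S)" "\<And>n. U p S n \<in> sets borel" "(\<Union>n. U p S n) = S" "\<And>n. bounded (U p S n)"
    "\<And>n. U p S n \<noteq> {}" "\<And>n. U p S n \<subseteq> S"
    if "p \<in> S" "S \<in> sets borel" for p S
  proof -
    show "(\<Union>n. U p S n) = S"
    proof (rule antisym)
      show "S \<subseteq> (\<Union>n. U p S n)"
      proof
        fix x assume "x \<in> S"
        obtain n where "\<bar>x\<bar> \<le> real n" using real_arch_simple by blast
        with \<open>x \<in> S\<close> show "x \<in> (\<Union>n. U p S n)"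
          by (intro UN_I[of n]) (auto simp: U_def abs_le_iff)
      qed
    qed (use that in \<open>auto simp: U_def\<close>)
    show "bounded (U p S n)" for n
      using bounded_Int[of S "{- real n..real n}"] by (simp add: U_def)
  qed (use that in \<open>auto simp: U_def incseq_def\<close>)
  have inc: "incseq (\<lambda>n. emeasure lborel (U p S n))" if "p \<in> S" "S \<in> sets borel" for p S
    using U(2)[OF that] by (intro incseq_SucI emeasure_mono incseq_SucD[OF U(1)[OF that]]) simp
  have lim: "emeasure lborel S = (SUP n. emeasure lborel (U p S n))" if "p \<in> S" "S \<in> sets borel" for p S
  proof -
    have "range (U p S) \<subseteq> sets lborel" using U(2)[OF that] by auto
    from SUP_emeasure_incseq[OF this U(1)[OF that]] show ?thesis by (simp only: U(3)[OF that])
  qed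
  have "emeasure lborel A + emeasure lborel B
      = (SUP n. emeasure lborel (U a A n) + emeasure lborel (U b B n))"
    unfolding lim[OF ab(1) A(1)] lim[OF ab(2) B(1)]
    by (intro ennreal_SUP_add[symmetric] inc) (use ab A B in auto)
  also have "\<dots> \<le> 2 * emeasure lborel C"
    using U[OF ab(1) A(1)] U[OF ab(2) B(1)] by (intro SUP_least bdd)
  finally show ?thesis .
qed

section \<open>The Prekopa-Leindler inequality in one dimension\<close>

text \<open>The levels stay in \<open>{0<..<1}\<close> because the midpoint bound will be applied
  level by level to functions with supremum \<open>1\<close>, whose superlevel sets are nonempty
  exactly as long as this is guaranteed by \<open>t < 1\<close>.\<close>

lemma nn_integral_min_1_layer_cake:
  fixes f :: "real \<Rightarrow> ennreal"
  assumes [measurable]: "f \<in> borel_measurable borel"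
  shows "(\<integral>\<^sup>+x. min 1 (f x) \<partial>lborel)
    = (\<integral>\<^sup>+t. indicator {0<..<1} t * emeasure lborel {x. ennreal t \<le> f x} \<partial>lborel)"
proof -
  have "min 1 (f x) = (\<integral>\<^sup>+t. indicator {0<..<1} t * indicator {t. ennreal t \<le> f x} t \<partial>lborel)" for x
  proof -
    have "(\<integral>\<^sup>+t. indicator {0<..<1} t * indicator {t. ennreal t \<le> f x} t \<partial>lborel)
        = (\<integral>\<^sup>+t. indicator ({0<..<1} \<inter> {t. ennreal t \<le> f x}) t \<partial>lborel)"
      by (intro nn_integral_cong) (auto split: split_indicator)
    also have "\<dots> = emeasure lborel ({0<..<1} \<inter> {t. ennreal t \<le> f x})"
      by (rule nn_integral_indicator) simp
    also have "\<dots> = min 1 (f x)"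
    proof (cases "1 \<le> f x")
      case True
      have "{0<..<1} \<inter> {t. ennreal t \<le> f x} = {0<..<1}"
        using True by (auto intro: order_trans[OF _ True] simp: ennreal_le_1)
      with True show ?thesis by (simp add: min_absorb1)
    next
      case False
      then obtain r where r: "f x = ennreal r" "0 \<le> r" "r < 1"
        by (cases "f x") (auto simp: ennreal_1[symmetric] simp del: ennreal_1)
      then have "{0<..<1} \<inter> {t. ennreal t \<le> f x} = {0<..r}"
        by auto
      with r show ?thesis by (simp add: min_def ennreal_le_1)
    qed
    finally show ?thesis ..
  qed
  then have "(\<integral>\<^sup>+x. min 1 (f x) \<partial>lborel) =
      (\<integral>\<^sup>+x. \<integral>\<^sup>+t. indicator {0<..<1} t * indicator {t. ennreal t \<le> f x} t \<partial>lborel \<partial>lborel)"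
    by simp
  also have "\<dots> = (\<integral>\<^sup>+t. \<integral>\<^sup>+x. indicator {0<..<1} t * indicator {t. ennreal t \<le> f x} t \<partial>lborel \<partial>lborel)"
    by (rule lborel_pair.Fubini') (unfold indicator_def mem_Collect_eq, measurable)
  also have "\<dots> = (\<integral>\<^sup>+t. indicator {0<..<1} t * (\<integral>\<^sup>+x. indicator {x. ennreal t \<le> f x} x \<partial>lborel) \<partial>lborel)"
  proof (intro nn_integral_cong)
    fix t :: real
    have "(\<integral>\<^sup>+x. indicator {0<..<1} t * indicator {t. ennreal t \<le> f x} t \<partial>lborel)
        = indicator {0<..<1} t * (\<integral>\<^sup>+x. indicator {t. ennreal t \<le> f x} t \<partial>lborel)"
      by (rule nn_integral_cmult) (unfold indicator_def mem_Collect_eq, measurable)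
    then show "(\<integral>\<^sup>+x. indicator {0<..<1} t * indicator {t. ennreal t \<le> f x} t \<partial>lborel)
        = indicator {0<..<1} t * (\<integral>\<^sup>+x. indicator {x. ennreal t \<le> f x} x \<partial>lborel)"
      by (simp add: indicator_def)
  qed
  also have "\<dots> = (\<integral>\<^sup>+t. indicator {0<..<1} t * emeasure lborel {x. ennreal t \<le> f x} \<partial>lborel)"
    by (intro nn_integral_cong, subst nn_integral_indicator) auto
  finally show ?thesis .
qed

lemma ennreal_mult_le_power2:
  fixes F G H :: ennreal
  assumes "F + G \<le> 2 * H"
  shows "F * G \<le> H\<^sup>2"
proof (cases "H = top")
  case False
  then obtain h where h: "H = ennreal h" "0 \<le> h" by (cases H) auto
  have "2 * H < top" using False by (simp add: ennreal_mult_less_top less_top)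
  then have "F + G < top" using assms le_less_trans by blast
  then obtain f g where fg: "F = ennreal f" "0 \<le> f" "G = ennreal g" "0 \<le> g"
    by (cases F; cases G) auto
  have "f + g \<le> 2 * h"
    using assms h fg by (simp flip: ennreal_plus ennreal_numeral ennreal_mult)
  moreover have "4 * (f * g) \<le> (f + g)\<^sup>2"
    using zero_le_power2[of "f - g"] by (simp add: power2_eq_square algebra_simps)
  ultimately have "4 * (f * g) \<le> (2 * h)\<^sup>2"
    using fg power_mono[of "f + g" "2 * h" 2] by linarith
  then show ?thesis
    using h fg by (simp add: ennreal_power flip: ennreal_mult)
qed (simp add: power2_eq_square ennreal_top_mult)

text \<open>Midpoints of the superlevel sets of \<open>f\<close> and \<open>g\<close> at level
  \<open>t\<close> lie in that of \<open>h\<close>. Integrating the midpoint bound over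
  \<open>t\<close> controls the arithmetic mean of the two integrals, which dominates the geometric
  mean. Supremum \<open>1\<close> makes both superlevel sets nonempty; with one of them empty the
  midpoint bound can fail.\<close>

lemma prekopa_leindler_real_sup1:
  fixes f g h :: "real \<Rightarrow> ennreal"
  assumes [measurable]: "f \<in> borel_measurable borel" "g \<in> borel_measurable borel" "h \<in> borel_measurable borel"
    and le: "\<And>x y. f x * g y \<le> (h ((x + y) / 2))\<^sup>2"
    and f: "\<And>x. f x \<le> 1" "\<And>t. t < 1 \<Longrightarrow> \<exists>x. ennreal t \<le> f x"
    and g: "\<And>x. g x \<le> 1" "\<And>t. t < 1 \<Longrightarrow> \<exists>x. ennreal t \<le> g x"
  shows "(\<integral>\<^sup>+x. f x \<partial>lborel) * (\<integral>\<^sup>+x. g x \<partial>lborel) \<le> (\<integral>\<^sup>+x. h x \<partial>lborel)\<^sup>2"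
proof (rule ennreal_mult_le_power2)
  have level: "emeasure lborel {x. ennreal t \<le> f x} + emeasure lborel {x. ennreal t \<le> g x}
      \<le> 2 * emeasure lborel {x. ennreal t \<le> h x}" if t: "0 < t" "t < 1" for t
  proof (rule real_midpoint_sum_bound)
    fix x y assume xy: "x \<in> {x. ennreal t \<le> f x}" "y \<in> {x. ennreal t \<le> g x}"
    show "(x + y) / 2 \<in> {x. ennreal t \<le> h x}"
    proof (rule ccontr)
      assume "(x + y) / 2 \<notin> {x. ennreal t \<le> h x}"
      then have lt: "h ((x + y) / 2) < ennreal t" by simp
      then obtain r where r: "h ((x + y) / 2) = ennreal r" "0 \<le> r" "r < t"
        by (cases "h ((x + y) / 2)") (use t in \<open>auto simp: ennreal_less_iff\<close>)
      have "ennreal (t * t) \<le> f x * g y"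
        using xy t by (auto simp: ennreal_mult intro!: mult_mono)
      also have "\<dots> \<le> ennreal (r\<^sup>2)"
        using le[of x y] r by (simp add: ennreal_power)
      finally have "t\<^sup>2 \<le> r\<^sup>2"
        by (simp add: power2_eq_square)
      then show False using r t power_strict_mono[of r t 2] by auto
    qed
  qed (use f(2)[OF t(2)] g(2)[OF t(2)] in auto)
  have "(\<integral>\<^sup>+x. f x \<partial>lborel) + (\<integral>\<^sup>+x. g x \<partial>lborel)
      = (\<integral>\<^sup>+x. min 1 (f x) \<partial>lborel) + (\<integral>\<^sup>+x. min 1 (g x) \<partial>lborel)"
    using f(1) g(1) by (simp add: min_absorb2)
  also have "\<dots> = (\<integral>\<^sup>+t. indicator {0<..<1} t * emeasure lborel {x. ennreal t \<le> f x} +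
      indicator {0<..<1} t * emeasure lborel {x. ennreal t \<le> g x} \<partial>lborel)"
    unfolding nn_integral_min_1_layer_cake[OF assms(1)] nn_integral_min_1_layer_cake[OF assms(2)]
    by (rule nn_integral_add[symmetric]) measurable
  also have "\<dots> \<le> (\<integral>\<^sup>+t. 2 * (indicator {0<..<1} t * emeasure lborel {x. ennreal t \<le> h x}) \<partial>lborel)"
    by (intro nn_integral_mono) (auto split: split_indicator intro: level)
  also have "\<dots> = 2 * (\<integral>\<^sup>+x. min 1 (h x) \<partial>lborel)"
    unfolding nn_integral_min_1_layer_cake[OF assms(3)] by (rule nn_integral_cmult) measurable
  also have "\<dots> \<le> 2 * (\<integral>\<^sup>+x. h x \<partial>lborel)"
    by (intro mult_left_mono nn_integral_mono) auto
  finally show "(\<integral>\<^sup>+x. f x \<partial>lborel) + (\<integral>\<^sup>+x. g x \<partial>lborel) \<le> 2 * (\<integral>\<^sup>+x. h x \<partial>lborel)" .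
qed

lemma prekopa_leindler_real_bounded:
  fixes f g h :: "real \<Rightarrow> ennreal"
  assumes [measurable]: "f \<in> borel_measurable borel" "g \<in> borel_measurable borel" "h \<in> borel_measurable borel"
    and le: "\<And>x y. f x * g y \<le> (h ((x + y) / 2))\<^sup>2"
    and bdd: "(SUP x. f x) < top" "(SUP x. g x) < top"
  shows "(\<integral>\<^sup>+x. f x \<partial>lborel) * (\<integral>\<^sup>+x. g x \<partial>lborel) \<le> (\<integral>\<^sup>+x. h x \<partial>lborel)\<^sup>2"
proof (cases "(SUP x. f x) = 0 \<or> (SUP x. g x) = 0")
  case True
  moreover have "u x = 0" if "(SUP x. u x) = 0" for u :: "real \<Rightarrow> ennreal" and x
    using that SUP_upper[of x UNIV u] by simp
  ultimately have "(\<forall>x. f x = 0) \<or> (\<forall>x. g x = 0)" by blast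
  then show ?thesis by auto
next
  case False
  obtain a where a: "(SUP x. f x) = ennreal a" "0 < a"
    using bdd(1) False by (cases "SUP x. f x") (auto simp: less_le)
  obtain b where b: "(SUP x. g x) = ennreal b" "0 < b"
    using bdd(2) False by (cases "SUP x. g x") (auto simp: less_le)
  \<comment> \<open>The geometric mean is the scale for \<open>h\<close> that preserves the
    hypothesis when \<open>f\<close> is divided by \<open>a\<close> and \<open>g\<close> by
    \<open>b\<close>.\<close>
  define c where "c = sqrt (a * b)"
  have c: "0 < c" "c * c = a * b" using a b by (auto simp: c_def)
  have inv: "ennreal (1 / r) * ennreal r = 1" if "0 < r" for r
    using that by (simp flip: ennreal_mult)
  have norm: "ennreal (1 / r) * u x \<le> 1" "t < 1 \<Longrightarrow> \<exists>x. ennreal t \<le> ennreal (1 / r) * u x"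
    if r: "(SUP x. u x) = ennreal r" "0 < r" for u :: "real \<Rightarrow> ennreal" and r x t
  proof -
    have "u x \<le> ennreal r" unfolding r(1)[symmetric] by (rule SUP_upper) simp
    then have "ennreal (1 / r) * u x \<le> ennreal (1 / r) * ennreal r" by (rule mult_left_mono) simp
    then show "ennreal (1 / r) * u x \<le> 1" by (simp only: inv[OF r(2)])
    assume "t < 1"
    then have "ennreal (t * r) < (SUP x. u x)"
      unfolding r(1) using r(2) by (intro ennreal_lessI) auto
    then obtain x where "ennreal (t * r) < u x" unfolding less_SUP_iff by auto
    then have "ennreal (1 / r) * ennreal (t * r) \<le> ennreal (1 / r) * u x" by (intro mult_left_mono) auto
    moreover have "ennreal (1 / r) * ennreal (t * r) = ennreal t"
      using r(2) by (simp add: ennreal_mult'[symmetric])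
    ultimately show "\<exists>x. ennreal t \<le> ennreal (1 / r) * u x" by auto
  qed
  have inv_ab: "ennreal (1 / a) * ennreal (1 / b) = (ennreal (1 / c))\<^sup>2"
    using a b c by (simp add: power2_eq_square flip: ennreal_mult)
  have "(\<integral>\<^sup>+x. ennreal (1 / a) * f x \<partial>lborel) * (\<integral>\<^sup>+x. ennreal (1 / b) * g x \<partial>lborel)
      \<le> (\<integral>\<^sup>+x. ennreal (1 / c) * h x \<partial>lborel)\<^sup>2"
  proof (rule prekopa_leindler_real_sup1)
    fix x y
    have "(ennreal (1 / a) * ennreal (1 / b)) * (f x * g y) \<le> (ennreal (1 / c))\<^sup>2 * (h ((x + y) / 2))\<^sup>2"
      unfolding inv_ab by (intro mult_left_mono le) simp
    then show "ennreal (1 / a) * f x * (ennreal (1 / b) * g y) \<le> (ennreal (1 / c) * h ((x + y) / 2))\<^sup>2"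
      by (simp add: power_mult_distrib ac_simps)
  qed (use norm[OF a] norm[OF b] in auto)
  then have "(ennreal (1 / a) * ennreal (1 / b)) * ((\<integral>\<^sup>+x. f x \<partial>lborel) * (\<integral>\<^sup>+x. g x \<partial>lborel))
      \<le> (ennreal (1 / c))\<^sup>2 * (\<integral>\<^sup>+x. h x \<partial>lborel)\<^sup>2"
    by (subst (asm) (1 2 3) nn_integral_cmult) (simp_all add: power_mult_distrib ac_simps)
  then have "(ennreal c)\<^sup>2 * ((ennreal (1 / c))\<^sup>2 * ((\<integral>\<^sup>+x. f x \<partial>lborel) * (\<integral>\<^sup>+x. g x \<partial>lborel)))
      \<le> (ennreal c)\<^sup>2 * ((ennreal (1 / c))\<^sup>2 * (\<integral>\<^sup>+x. h x \<partial>lborel)\<^sup>2)"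
    unfolding inv_ab by (rule mult_left_mono) simp
  moreover have "(ennreal c)\<^sup>2 * ((ennreal (1 / c))\<^sup>2 * x) = x" for x
    using inv[OF c(1)] by (metis mult.assoc mult.commute mult_1 power_mult_distrib power_one)
  ultimately show ?thesis by (simp only:)
qed

lemma nn_integral_min_of_nat:
  assumes [measurable]: "f \<in> borel_measurable M"
  shows "(\<integral>\<^sup>+x. f x \<partial>M) = (SUP n::nat. \<integral>\<^sup>+x. min (f x) (of_nat n) \<partial>M)"
proof -
  have "f x = (SUP n::nat. min (f x) (of_nat n))" for x
    by (subst inf_min[symmetric], subst inf_SUP[symmetric]) (simp add: ennreal_SUP_of_nat_eq_top)
  then have "(\<integral>\<^sup>+x. f x \<partial>M) = (\<integral>\<^sup>+x. (SUP n::nat. min (f x) (of_nat n)) \<partial>M)" by simp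
  also have "\<dots> = (SUP n::nat. \<integral>\<^sup>+x. min (f x) (of_nat n) \<partial>M)"
    by (rule nn_integral_monotone_convergence_SUP)
       (auto simp: incseq_def le_fun_def min_le_iff_disj)
  finally show ?thesis .
qed

text \<open>Truncating \<open>f\<close> and \<open>g\<close> preserves the hypothesis, and monotone
  convergence removes the truncation.\<close>

lemma prekopa_leindler_real:
  fixes f g h :: "real \<Rightarrow> ennreal"
  assumes [measurable]: "f \<in> borel_measurable borel" "g \<in> borel_measurable borel" "h \<in> borel_measurable borel"
    and le: "\<And>x y. f x * g y \<le> (h ((x + y) / 2))\<^sup>2"
  shows "(\<integral>\<^sup>+x. f x \<partial>lborel) * (\<integral>\<^sup>+x. g x \<partial>lborel) \<le> (\<integral>\<^sup>+x. h x \<partial>lborel)\<^sup>2"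
proof -
  have "(\<integral>\<^sup>+x. min (f x) (of_nat m) \<partial>lborel) * (\<integral>\<^sup>+x. min (g x) (of_nat n) \<partial>lborel)
      \<le> (\<integral>\<^sup>+x. h x \<partial>lborel)\<^sup>2" for m n :: nat
  proof (rule prekopa_leindler_real_bounded)
    show "min (f x) (of_nat m) * min (g y) (of_nat n) \<le> (h ((x + y) / 2))\<^sup>2" for x y
      by (rule order_trans[OF _ le]) (auto intro!: mult_mono)
    have "(SUP x. min (u x) (of_nat k)) \<le> (of_nat k :: ennreal)" for u :: "real \<Rightarrow> ennreal" and k :: nat
      by (intro SUP_least) auto
    then show "(SUP x. min (f x) (of_nat m)) < top" "(SUP x. min (g x) (of_nat n)) < top"
      by (metis ennreal_of_nat_neq_top less_top top_unique)+
  qed measurable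
  then show ?thesis
    unfolding nn_integral_min_of_nat[of f lborel, simplified] nn_integral_min_of_nat[of g lborel, simplified]
      SUP_mult_right_ennreal SUP_mult_left_ennreal
    by (intro SUP_least)
qed

section \<open>Tensorisation and volumes of midpoint sets\<close>

text \<open>Integrating out the coordinates in \<open>I\<close> leaves functions of the new
  coordinate that satisfy the one-dimensional hypothesis by induction. The midpoint is restricted to
  \<open>I\<close> because points of the product space are extensional functions.\<close>

lemma prekopa_leindler_PiM:
  fixes f g h :: "('i \<Rightarrow> real) \<Rightarrow> ennreal"
  assumes "finite I"
    and "f \<in> borel_measurable (PiM I (\<lambda>_. lborel))" "g \<in> borel_measurable (PiM I (\<lambda>_. lborel))"
      "h \<in> borel_measurable (PiM I (\<lambda>_. lborel))"
    and "\<And>x y. x \<in> space (PiM I (\<lambda>_. lborel)) \<Longrightarrow> y \<in> space (PiM I (\<lambda>_. lborel)) \<Longrightarrow>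
      f x * g y \<le> (h (\<lambda>i\<in>I. (x i + y i) / 2))\<^sup>2"
  shows "(\<integral>\<^sup>+x. f x \<partial>PiM I (\<lambda>_. lborel)) * (\<integral>\<^sup>+x. g x \<partial>PiM I (\<lambda>_. lborel))
    \<le> (\<integral>\<^sup>+x. h x \<partial>PiM I (\<lambda>_. lborel))\<^sup>2"
  using assms
proof (induction I arbitrary: f g h)
  case empty
  interpret product_sigma_finite "\<lambda>_::'i. lborel :: real measure" by standard
  have "(\<lambda>i\<in>{}. (x i + y i) / 2) = (\<lambda>_. undefined)" for x y :: "'i \<Rightarrow> real"
    by auto
  with empty(4)[of "\<lambda>_. undefined" "\<lambda>_. undefined"] show ?case
    by (simp add: space_PiM nn_integral_empty)
next
  case (insert i I)
  interpret product_sigma_finite "\<lambda>_::'i. lborel :: real measure" by standard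
  note [measurable] = insert.prems(1-3)
  let ?M = "PiM I (\<lambda>_. lborel :: real measure)"
  have slice [measurable]: "(\<lambda>x. u (x(i := s))) \<in> borel_measurable ?M"
    if [measurable]: "u \<in> borel_measurable (PiM (insert i I) (\<lambda>_. lborel :: real measure))"
    for u :: "_ \<Rightarrow> ennreal" and s
    by measurable
  have int [measurable]: "(\<lambda>s. \<integral>\<^sup>+x. u (x(i := s)) \<partial>?M) \<in> borel_measurable borel"
    if [measurable]: "u \<in> borel_measurable (PiM (insert i I) (\<lambda>_. lborel :: real measure))"
    for u :: "_ \<Rightarrow> ennreal"
  proof -
    interpret finite_product_sigma_finite "\<lambda>_::'i. lborel :: real measure" I
      by standard (rule insert.hyps)
    have "(\<lambda>s. \<integral>\<^sup>+x. u (x(i := s)) \<partial>?M) \<in> borel_measurable lborel"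
      by measurable
    then show ?thesis by simp
  qed
  have "(\<integral>\<^sup>+s. \<integral>\<^sup>+x. f (x(i := s)) \<partial>?M \<partial>lborel) * (\<integral>\<^sup>+s. \<integral>\<^sup>+x. g (x(i := s)) \<partial>?M \<partial>lborel)
      \<le> (\<integral>\<^sup>+s. \<integral>\<^sup>+x. h (x(i := s)) \<partial>?M \<partial>lborel)\<^sup>2"
  proof (rule prekopa_leindler_real)
    fix s t :: real
    show "(\<integral>\<^sup>+x. f (x(i := s)) \<partial>?M) * (\<integral>\<^sup>+x. g (x(i := t)) \<partial>?M)
        \<le> (\<integral>\<^sup>+x. h (x(i := (s + t) / 2)) \<partial>?M)\<^sup>2"
    proof (rule insert.IH)
      fix x y assume xy: "x \<in> space ?M" "y \<in> space ?M"
      have "(\<lambda>j\<in>insert i I. ((x(i := s)) j + (y(i := t)) j) / 2)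
          = (\<lambda>j\<in>I. (x j + y j) / 2)(i := (s + t) / 2)"
        using insert.hyps by (auto simp: fun_eq_iff)
      moreover have "x(i := s) \<in> space (PiM (insert i I) (\<lambda>_. lborel))"
        "y(i := t) \<in> space (PiM (insert i I) (\<lambda>_. lborel))"
        using xy by (auto simp: space_PiM PiE_def extensional_def)
      ultimately show "f (x(i := s)) * g (y(i := t))
          \<le> (h ((\<lambda>j\<in>I. (x j + y j) / 2)(i := (s + t) / 2)))\<^sup>2"
        using insert.prems(4)[of "x(i := s)" "y(i := t)"] by (simp only:)
    qed measurable
  qed measurable
  then show ?case
    using insert.hyps by (simp add: product_nn_integral_insert_rev)
qed

text \<open>Prekopa-Leindler for indicator functions: the multiplicative Brunn-Minkowski
  inequality.\<close>

lemma midpoint_set_measure: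
  fixes A B C :: "'a::euclidean_space set"
  assumes [measurable]: "A \<in> sets borel" "B \<in> sets borel" "C \<in> sets borel"
    and mid: "\<And>x y. x \<in> A \<Longrightarrow> y \<in> B \<Longrightarrow> (x + y) /\<^sub>R 2 \<in> C"
  shows "emeasure lborel A * emeasure lborel B \<le> (emeasure lborel C)\<^sup>2"
proof -
  let ?M = "PiM (Basis :: 'a set) (\<lambda>_. lborel :: real measure)"
  let ?T = "\<lambda>f. \<Sum>b\<in>Basis. f b *\<^sub>R b :: 'a"
  have e: "emeasure lborel S = (\<integral>\<^sup>+x. indicator S (?T x) \<partial>?M)" if [measurable]: "S \<in> sets borel" for S
  proof -
    have "emeasure lborel S = (\<integral>\<^sup>+x. indicator S x \<partial>lborel)" by simp
    also have "\<dots> = (\<integral>\<^sup>+x. indicator S (?T x) \<partial>?M)"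
      by (subst lborel_eq, subst nn_integral_distr) measurable
    finally show ?thesis .
  qed
  have "?T (\<lambda>i\<in>Basis. (x i + y i) / 2) = (?T x + ?T y) /\<^sub>R 2" for x y :: "'a \<Rightarrow> real"
    by (simp add: scaleR_sum_right sum.distrib[symmetric] algebra_simps add_divide_distrib cong: sum.cong)
  then show ?thesis
    unfolding e[OF assms(1)] e[OF assms(2)] e[OF assms(3)]
    by (intro prekopa_leindler_PiM) (auto split: split_indicator dest: mid simp: inverse_eq_divide)
qed

text \<open>The midpoint bound is applied to \<open>X\<close> and its reflection in the origin,
  which have equal volume.\<close>

lemma emeasure_le_half_difference_set:
  fixes X C :: "'a::euclidean_space set"
  assumes "compact X" and C: "C \<in> sets borel"
    and sub: "\<And>x y. x \<in> X \<Longrightarrow> y \<in> X \<Longrightarrow> (x - y) /\<^sub>R 2 \<in> C"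
  shows "emeasure lborel X \<le> emeasure lborel C"
proof -
  have "emeasure lebesgue ((\<lambda>x. (-1) *\<^sub>R x + 0) ` X) = ennreal (\<bar>-1\<bar> ^ DIM('a)) * emeasure lebesgue X"
    by (rule emeasure_lebesgue_affine)
  moreover have "compact (uminus ` X)"
    using \<open>compact X\<close> by (rule compact_negations)
  ultimately have "emeasure lborel (uminus ` X) = emeasure lborel X"
    using \<open>compact X\<close> by (simp add: borel_compact)
  moreover have "emeasure lborel X * emeasure lborel (uminus ` X) \<le> (emeasure lborel C)\<^sup>2"
    using \<open>compact X\<close> C \<open>compact (uminus ` X)\<close>
    by (intro midpoint_set_measure) (auto simp: borel_compact dest: sub)
  ultimately have *: "(emeasure lborel X)\<^sup>2 \<le> (emeasure lborel C)\<^sup>2"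
    by (simp add: power2_eq_square)
  show ?thesis
  proof (cases "emeasure lborel C")
    case (real c)
    moreover obtain x where x: "emeasure lborel X = ennreal x" "0 \<le> x"
      using emeasure_compact_finite[OF \<open>compact X\<close>] by (cases "emeasure lborel X") auto
    ultimately show ?thesis using * by (simp add: ennreal_power power2_le_iff_abs_le)
  qed simp
qed

text \<open>A set need not fit into a ball of half its diameter, but its half difference set always
  does.\<close>

theorem isodiametric_inequality:
  fixes E :: "'a::euclidean_space set"
  assumes "compact E"
  shows "emeasure lborel E \<le> ennreal (unit_ball_vol (real DIM('a)) * (diameter E / 2) ^ DIM('a))"
proof -
  have "emeasure lborel E \<le> emeasure lborel (cball (0::'a) (diameter E / 2))"
  proof (rule emeasure_le_half_difference_set[OF assms])
    fix x y assume "x \<in> E" "y \<in> E"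
    then show "(x - y) /\<^sub>R 2 \<in> cball 0 (diameter E / 2)"
      using diameter_bounded_bound[OF compact_imp_bounded[OF assms]] by (simp add: dist_norm)
  qed simp
  then show ?thesis
    using assms by (simp add: emeasure_cball diameter_ge_0 compact_imp_bounded)
qed

section \<open>Hausdorff and Lebesgue measure\<close>

text \<open>By the isodiametric inequality the gauge of a piece is at least the volume of its
  closure, so covers of any fixed mesh already suffice; mesh \<open>1\<close> is taken.\<close>

lemma emeasure_lborel_le_hausdorff_outer:
  fixes A :: "'a::euclidean_space set"
  assumes "A \<in> sets borel"
  shows "emeasure lborel A \<le> hausdorff_outer DIM('a) A"
proof -
  have "emeasure lborel A \<le> hausdorff_pre DIM('a) 1 A"
    unfolding hausdorff_pre_def
  proof (rule INF_greatest, clarify)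
    fix E :: "nat \<Rightarrow> 'a set"
    assume cov: "A \<subseteq> (\<Union>i. E i)" and E: "\<forall>i. bounded (E i) \<and> diameter (E i) \<le> 1"
    have cl: "compact (closure (E i))" for i using E by (simp add: compact_closure)
    have "emeasure lborel A \<le> emeasure lborel (\<Union>i. closure (E i))"
      by (intro emeasure_mono order_trans[OF cov UN_mono[OF order_refl closure_subset]]) auto
    also have "\<dots> \<le> (\<Sum>i. emeasure lborel (closure (E i)))"
      by (rule emeasure_subadditive_countably) auto
    also have "\<dots> \<le> (\<Sum>i. hausdorff_gauge DIM('a) (E i))"
    proof (intro suminf_le)
      fix i show "emeasure lborel (closure (E i)) \<le> hausdorff_gauge DIM('a) (E i)"
        using isodiametric_inequality[OF cl[of i]] E
        by (simp add: hausdorff_gauge_def diameter_closure)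
    qed auto
    finally show "emeasure lborel A \<le> (\<Sum>i. hausdorff_gauge DIM('a) (E i))" .
  qed
  also have "\<dots> \<le> hausdorff_outer DIM('a) A"
    unfolding hausdorff_outer_def by (rule SUP_upper) simp
  finally show ?thesis .
qed

lemma hausdorff_pre_empty [simp]: "0 \<le> \<delta> \<Longrightarrow> hausdorff_pre k \<delta> {} = 0"
proof -
  assume "0 \<le> \<delta>"
  then have "hausdorff_pre k \<delta> ({}::'a set) \<le> (\<Sum>i::nat. hausdorff_gauge k ({}::'a set))"
    unfolding hausdorff_pre_def by (intro INF_lower) auto
  then show ?thesis by (simp add: hausdorff_gauge_def)
qed

lemma hausdorff_pre_Un_le:
  assumes "0 \<le> \<delta>"
  shows "hausdorff_pre k \<delta> (A \<union> B) \<le> hausdorff_pre k \<delta> A + hausdorff_pre k \<delta> B"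
proof -
  let ?A = "\<lambda>i. if i = 0 then A else if i = (1::nat) then B else {}"
  have "hausdorff_pre k \<delta> (\<Union>i. ?A i) \<le> (\<Sum>i. hausdorff_pre k \<delta> (?A i))"
    by (rule hausdorff_pre_countably_subadditive)
  also have "\<dots> = (\<Sum>i\<in>{0,1}. hausdorff_pre k \<delta> (?A i))"
    using assms by (intro suminf_finite) auto
  also have "(\<Union>i. ?A i) = A \<union> B"
    by (auto split: if_splits)
  finally show ?thesis by simp
qed

section \<open>Vitali packings and agreement with Lebesgue measure\<close>

text \<open>Common core of the covering arguments: the \<open>B i\<close> are disjoint balls and the
  \<open>E i\<close> the same balls or their enlargements, with gauge controlled by the volume of
  \<open>B i\<close>.\<close>

lemma hausdorff_pre_le_packing:
  fixes B E :: "'i \<Rightarrow> 'a::euclidean_space set"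
  assumes "countable C" and disj: "pairwise (\<lambda>i j. disjnt (B i) (B j)) C"
    and B: "\<And>i. i \<in> C \<Longrightarrow> B i \<in> sets borel"
    and cov: "A \<subseteq> (\<Union>i\<in>C. E i)" and "0 \<le> \<delta>"
    and E: "\<And>i. i \<in> C \<Longrightarrow> bounded (E i) \<and> diameter (E i) \<le> \<delta>"
    and le: "\<And>i. i \<in> C \<Longrightarrow> hausdorff_gauge k (E i) \<le> c * emeasure lborel (B i)"
  shows "hausdorff_pre k \<delta> A \<le> c * emeasure lborel (\<Union>i\<in>C. B i)"
proof -
  let ?J = "to_nat_on C ` C"
  \<comment> \<open>The countable family becomes a sequence padded with empty sets, for which gauge
    and volume both vanish.\<close>
  define seq where "seq X n = (if n \<in> ?J then X (from_nat_into C n) else {})" for X :: "'i \<Rightarrow> 'a set" and n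
  have UN: "(\<Union>n. seq X n) = (\<Union>i\<in>C. X i)" for X
    unfolding seq_def using \<open>countable C\<close> by (auto split: if_splits) 
  have "hausdorff_pre k \<delta> A \<le> (\<Sum>n. hausdorff_gauge k (seq E n))"
    unfolding hausdorff_pre_def
  proof (rule INF_lower, clarify, intro conjI allI)
    show "A \<subseteq> (\<Union>n. seq E n)" using cov by (simp add: UN)
    show "bounded (seq E n)" "diameter (seq E n) \<le> \<delta>" for n
      using E \<open>countable C\<close> \<open>0 \<le> \<delta>\<close> by (auto simp: seq_def)
  qed
  also have "\<dots> \<le> (\<Sum>n. c * emeasure lborel (seq B n))"
  proof (intro suminf_le)
    fix n show "hausdorff_gauge k (seq E n) \<le> c * emeasure lborel (seq B n)"
    proof (cases "n \<in> ?J")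
      case True
      then have "from_nat_into C n \<in> C" using \<open>countable C\<close> by auto
      with le True show ?thesis by (simp add: seq_def)
    qed (simp add: seq_def hausdorff_gauge_def)
  qed auto
  also have "\<dots> = c * (\<Sum>n. emeasure lborel (seq B n))"
    by (rule ennreal_suminf_cmult)
  also have "(\<Sum>n. emeasure lborel (seq B n)) = emeasure lborel (\<Union>n. seq B n)"
  proof (rule suminf_emeasure)
    show "range (seq B) \<subseteq> sets lborel"
      using B \<open>countable C\<close> by (auto simp: seq_def)
    show "disjoint_family (seq B)"
      using disj \<open>countable C\<close>
      unfolding disjoint_family_on_def pairwise_def disjnt_def
      by (auto simp: seq_def) (metis disjoint_iff)
  qed
  finally show ?thesis by (simp only: UN)
qed

text \<open>The factor is the price of enlarging balls in Vitali's covering lemma. It is harmless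
  for null sets, to which the bound is applied.\<close>

lemma hausdorff_outer_le_open:
  fixes A :: "'a::euclidean_space set"
  assumes "open U" "A \<subseteq> U"
  shows "hausdorff_outer DIM('a) A \<le> 5 ^ DIM('a) * emeasure lborel U"
  unfolding hausdorff_outer_def
proof (rule SUP_least)
  fix \<delta> :: real assume "\<delta> \<in> {0<..}"
  then have \<delta>: "0 < \<delta>" by simp
  \<comment> \<open>The enlarged balls have five times the radius, hence ten times the radius as
    diameter.\<close>
  define K where "K = {(x, r). x \<in> A \<and> 0 < r \<and> r \<le> \<delta> / 10 \<and> cball x r \<subseteq> U}"
  have "A \<subseteq> (\<Union>i\<in>K. cball (fst i) (snd i))"
  proof
    fix x assume "x \<in> A"
    with assms obtain e where e: "0 < e" "cball x e \<subseteq> U" using open_contains_cball by blast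
    have "cball x (min e (\<delta> / 10)) \<subseteq> U" using e(2) by auto
    with \<open>x \<in> A\<close> e(1) \<delta> have "(x, min e (\<delta> / 10)) \<in> K" by (auto simp: K_def)
    then show "x \<in> (\<Union>i\<in>K. cball (fst i) (snd i))" using e(1) \<delta> by (intro UN_I) auto
  qed
  moreover have "0 < snd i \<and> snd i \<le> \<delta> / 10" if "i \<in> K" for i
    using that by (auto simp: K_def)
  ultimately obtain C where C: "countable C" "C \<subseteq> K"
    "pairwise (\<lambda>i j. disjnt (cball (fst i) (snd i)) (cball (fst j) (snd j))) C"
    "A \<subseteq> (\<Union>i\<in>C. cball (fst i) (5 * snd i))"
    by (rule Vitali_covering_lemma_cballs[where B = "\<delta> / 10"])
  have CK: "0 < snd i" "snd i \<le> \<delta> / 10" "cball (fst i) (snd i) \<subseteq> U" if "i \<in> C" for i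
    using subsetD[OF C(2) that] by (simp_all add: K_def case_prod_beta)
  have "hausdorff_pre DIM('a) \<delta> A \<le> 5 ^ DIM('a) * emeasure lborel (\<Union>i\<in>C. cball (fst i) (snd i))"
  proof (rule hausdorff_pre_le_packing[OF C(1,3) _ C(4)])
    fix i assume "i \<in> C"
    note i = CK[OF this]
    show "bounded (cball (fst i) (5 * snd i)) \<and> diameter (cball (fst i) (5 * snd i)) \<le> \<delta>"
      using i by simp
    have "(2 * (5 * snd i) / 2) ^ DIM('a) = 5 ^ DIM('a) * snd i ^ DIM('a)"
      by (simp add: power_mult_distrib)
    moreover have "(5::ennreal) ^ DIM('a) = ennreal (5 ^ DIM('a))"
      by (simp flip: ennreal_power)
    ultimately show "hausdorff_gauge DIM('a) (cball (fst i) (5 * snd i))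
        \<le> 5 ^ DIM('a) * emeasure lborel (cball (fst i) (snd i))"
      using i by (simp add: hausdorff_gauge_def emeasure_cball ac_simps flip: ennreal_mult)
  qed (use \<delta> in auto)
  also have "\<dots> \<le> 5 ^ DIM('a) * emeasure lborel U"
    using CK(3) assms by (intro mult_left_mono emeasure_mono) auto
  finally show "hausdorff_pre DIM('a) \<delta> A \<le> 5 ^ DIM('a) * emeasure lborel U" .
qed

lemma hausdorff_outer_negligible:
  fixes A :: "'a::euclidean_space set"
  assumes "negligible A"
  shows "hausdorff_outer DIM('a) A = 0"
proof -
  have "hausdorff_outer DIM('a) A \<le> 0 + ennreal e" if e: "0 < e" for e
  proof -
    let ?e = "e / 5 ^ DIM('a)"
    obtain U where U: "open U" "A \<subseteq> U" "emeasure lebesgue (U - A) < ennreal ?e"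
    proof (rule sets_lebesgue_outer_open)
      show "A \<in> sets lebesgue" using assms by (simp add: negligible_imp_sets)
      show "0 < ?e" using e by simp
    qed auto
    have "emeasure lborel U = emeasure lebesgue U" using U by simp
    also have "\<dots> = emeasure lebesgue (U - A)"
      using assms U by (intro emeasure_Diff_null_set[symmetric]) (auto simp: negligible_iff_null_sets)
    finally have "emeasure lborel U \<le> ennreal ?e" using U(3) by simp
    then have "5 ^ DIM('a) * emeasure lborel U \<le> 5 ^ DIM('a) * ennreal ?e"
      by (rule mult_left_mono) simp
    also have "\<dots> = ennreal e"
    proof -
      have "(5::ennreal) ^ DIM('a) = ennreal (5 ^ DIM('a))"
        by (simp flip: ennreal_power)
      then show ?thesis using e by (simp flip: ennreal_mult)
    qed
    finally show ?thesis
      using hausdorff_outer_le_open[OF U(1,2)] order_trans by auto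
  qed
  then show ?thesis
    using ennreal_le_epsilon[of 0 "hausdorff_outer DIM('a) A"] by simp
qed

text \<open>Disjoint small balls fill \<open>U\<close> up to a null set, and for a ball the gauge
  equals the volume. This removes the constant from the crude bound, which now serves only for the
  null remainder.\<close>

lemma hausdorff_outer_le_emeasure_open:
  fixes U :: "'a::euclidean_space set"
  assumes "open U"
  shows "hausdorff_outer DIM('a) U \<le> emeasure lborel U"
  unfolding hausdorff_outer_def
proof (rule SUP_least)
  fix \<delta> :: real assume "\<delta> \<in> {0<..}"
  then have \<delta>: "0 < \<delta>" by simp
  define K where "K = {(x, r). x \<in> U \<and> 0 < r \<and> r \<le> \<delta> / 2 \<and> cball x r \<subseteq> U}"
  have "0 < snd i" if "i \<in> K" for i
    using that by (auto simp: K_def)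
  moreover have "\<exists>i. i \<in> K \<and> x \<in> cball (fst i) (snd i) \<and> snd i < d" if "x \<in> U" "0 < d" for x d
  proof -
    from that assms obtain e where e: "0 < e" "cball x e \<subseteq> U" using open_contains_cball by blast
    have "cball x (min e (min (\<delta> / 2) (d / 2))) \<subseteq> U" using e(2) by auto
    with that e(1) \<delta> have "(x, min e (min (\<delta> / 2) (d / 2))) \<in> K" by (auto simp: K_def)
    then show "\<exists>i. i \<in> K \<and> x \<in> cball (fst i) (snd i) \<and> snd i < d"
      using e(1) \<delta> \<open>0 < d\<close> by (intro exI) auto
  qed
  ultimately obtain C where C: "countable C" "C \<subseteq> K"
    "pairwise (\<lambda>i j. disjnt (cball (fst i) (snd i)) (cball (fst j) (snd j))) C"
    "negligible (U - (\<Union>i\<in>C. cball (fst i) (snd i)))"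
    by (rule Vitali_covering_theorem_cballs)
  let ?V = "\<Union>i\<in>C. cball (fst i) (snd i)"
  have CK: "0 < snd i" "snd i \<le> \<delta> / 2" "cball (fst i) (snd i) \<subseteq> U" if "i \<in> C" for i
    using subsetD[OF C(2) that] by (simp_all add: K_def case_prod_beta)
  have "hausdorff_pre DIM('a) \<delta> (?V \<union> (U - ?V))
      \<le> hausdorff_pre DIM('a) \<delta> ?V + hausdorff_pre DIM('a) \<delta> (U - ?V)"
    using \<delta> by (intro hausdorff_pre_Un_le) simp
  also have "hausdorff_pre DIM('a) \<delta> (U - ?V) \<le> hausdorff_outer DIM('a) (U - ?V)"
    unfolding hausdorff_outer_def using \<delta> by (intro SUP_upper) simp
  also have "\<dots> = 0" by (rule hausdorff_outer_negligible[OF C(4)])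
  also have "hausdorff_pre DIM('a) \<delta> ?V \<le> 1 * emeasure lborel ?V"
  proof (rule hausdorff_pre_le_packing[OF C(1,3)])
    fix i assume "i \<in> C"
    note i = CK[OF this]
    show "bounded (cball (fst i) (snd i)) \<and> diameter (cball (fst i) (snd i)) \<le> \<delta>"
      using i by simp
    show "hausdorff_gauge DIM('a) (cball (fst i) (snd i)) \<le> 1 * emeasure lborel (cball (fst i) (snd i))"
      using i by (simp add: hausdorff_gauge_def emeasure_cball)
  qed (use \<delta> in auto)
  also have "\<dots> \<le> emeasure lborel U"
    unfolding mult_1 using CK(3) assms by (intro emeasure_mono) auto
  also have "?V \<union> (U - ?V) = U"
    using CK(3) by blast
  finally show "hausdorff_pre DIM('a) \<delta> U \<le> emeasure lborel U"
    by (simp add: add_right_mono)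
qed

theorem hausdorff_outer_eq_lborel:
  fixes A :: "'a::euclidean_space set"
  assumes "A \<in> sets borel"
  shows "hausdorff_outer DIM('a) A = emeasure lborel A"
proof (rule antisym)
  show "hausdorff_outer DIM('a) A \<le> emeasure lborel A"
  proof (rule ennreal_le_epsilon)
    fix e :: real assume "0 < e"
    obtain U where U: "open U" "A \<subseteq> U" "emeasure lebesgue (U - A) < ennreal e"
    proof (rule sets_lebesgue_outer_open)
      show "A \<in> sets lebesgue" using assms by simp
    qed (use \<open>0 < e\<close> in auto)
    have "hausdorff_outer DIM('a) A \<le> hausdorff_outer DIM('a) U"
      by (rule hausdorff_outer_mono) fact
    also have "\<dots> \<le> emeasure lborel U"
      by (rule hausdorff_outer_le_emeasure_open) fact
    also have "\<dots> = emeasure lborel (A \<union> (U - A))"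
      using U by (intro arg_cong[where f = "emeasure lborel"]) auto
    also have "\<dots> \<le> emeasure lborel A + emeasure lborel (U - A)"
      using assms U by (intro emeasure_subadditive) auto
    also have "\<dots> \<le> emeasure lborel A + ennreal e"
      using assms U by (intro add_left_mono) auto
    finally show "hausdorff_outer DIM('a) A \<le> emeasure lborel A + ennreal e" .
  qed
qed (rule emeasure_lborel_le_hausdorff_outer[OF assms])

corollary emeasure_vol_measure:
  fixes A :: "'a::euclidean_space set"
  assumes "A \<in> sets borel"
  shows "emeasure vol_measure A = emeasure lborel A"
  using assms sets_borel_subset_hausdorff[of "DIM('a)"]
  by (subst emeasure_hausdorff_measure) (auto simp: hausdorff_outer_eq_lborel)

text \<open>The Caratheodory sets contain the Borel sets but are not identified further. Pushing
  forward along the identity restricts to Borel sets and lets integrals of Borel functions be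
  transferred.\<close>

lemma distr_vol_measure: "distr vol_measure borel (\<lambda>x. x) = (lborel :: 'a::euclidean_space measure)"
proof (rule measure_eqI)
  fix A :: "'a set" assume A: "A \<in> sets (distr vol_measure borel (\<lambda>x. x))"
  have [measurable]: "(\<lambda>x. x) \<in> (vol_measure :: 'a measure) \<rightarrow>\<^sub>M borel"
    using sets_borel_subset_hausdorff[of "DIM('a)"] by (auto simp: measurable_def)
  show "emeasure (distr vol_measure borel (\<lambda>x. x)) A = emeasure lborel A"
    using A by (subst emeasure_distr) (auto simp: emeasure_vol_measure)
qed simp

lemma set_integral_vol_measure:
  fixes f :: "'a::euclidean_space \<Rightarrow> real"
  assumes [measurable]: "f \<in> borel_measurable borel" "A \<in> sets borel"
  shows "(LINT x:A|vol_measure. f x) = (LINT x:A|lborel. f x)"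
proof -
  have [measurable]: "(\<lambda>x. x) \<in> (vol_measure :: 'a measure) \<rightarrow>\<^sub>M borel"
    using sets_borel_subset_hausdorff[of "DIM('a)"] by (auto simp: measurable_def)
  have "(LINT x:A|lborel. f x) = (LINT x|distr vol_measure borel (\<lambda>x. x). indicator A x *\<^sub>R f x)"
    by (simp add: set_lebesgue_integral_def distr_vol_measure)
  also have "\<dots> = (LINT x:A|vol_measure. f x)"
    unfolding set_lebesgue_integral_def by (subst integral_distr) auto
  finally show ?thesis ..
qed

text \<open>Hausdorff measure depends on the metric alone, so the invariance is read off from
  it.\<close>

lemma emeasure_lborel_isometry_image:
  fixes f g :: "'a::euclidean_space \<Rightarrow> 'a"
  assumes f: "\<And>x y. dist (f x) (f y) = dist x y" and g: "\<And>x. f (g x) = x" "\<And>x. g (f x) = x"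
    and A: "A \<in> sets borel"
  shows "emeasure lborel (f ` A) = emeasure lborel A"
proof -
  have dg: "dist (g x) (g y) = dist x y" for x y
    using f[of "g x" "g y"] by (simp add: g)
  have "continuous_on UNIV g"
    unfolding continuous_on_iff using dg by auto
  then have [measurable]: "g \<in> borel_measurable borel"
    by (rule borel_measurable_continuous_onI)
  have "f ` A = g -` A \<inter> space borel"
    using g by (auto simp: image_iff) metis
  then have fA: "f ` A \<in> sets borel"
    using A by (simp only:) (rule measurable_sets[of g borel borel], auto)
  have "hausdorff_outer DIM('a) (f ` A) \<le> hausdorff_outer DIM('a) A"
    by (rule hausdorff_outer_nonexpansive_image) (simp add: f)
  moreover have "hausdorff_outer DIM('a) (g ` f ` A) \<le> hausdorff_outer DIM('a) (f ` A)"
    by (rule hausdorff_outer_nonexpansive_image) (simp add: dg)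
  moreover have "g ` f ` A = A" by (simp add: image_image g)
  ultimately show ?thesis using A fA by (simp add: hausdorff_outer_eq_lborel)
qed

section \<open>A lower bound for the area of the sphere\<close>

text \<open>Fubini with the axis coordinate split off: every slice within the height is the same
  Euclidean ball in the remaining coordinates.\<close>

lemma emeasure_cylinder_Basis:
  fixes b :: "'a::euclidean_space"
  assumes b: "b \<in> Basis" and "0 \<le> h" "0 < r"
  shows "emeasure lborel {x. \<bar>x \<bullet> b\<bar> \<le> h \<and> norm (x - (x \<bullet> b) *\<^sub>R b) \<le> r}
    = ennreal (2 * h * (unit_ball_vol (real (DIM('a) - 1)) * r ^ (DIM('a) - 1)))"
proof -
  interpret product_sigma_finite "\<lambda>_::'a. lborel :: real measure" by standard
  let ?B = "Basis - {b}"
  let ?M = "PiM ?B (\<lambda>_. lborel :: real measure)"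
  let ?T = "\<lambda>f. \<Sum>i\<in>Basis. f i *\<^sub>R i :: 'a"
  let ?Z = "{x. \<bar>x \<bullet> b\<bar> \<le> h \<and> norm (x - (x \<bullet> b) *\<^sub>R b) \<le> r}"
  let ?D = "{f. sqrt (\<Sum>i\<in>?B. (f i)\<^sup>2) \<le> r} \<inter> space ?M"
  have ins: "insert b ?B = Basis" using b by auto
  have [measurable]: "?Z \<in> sets borel"
    by measurable
  have coord: "?T f \<bullet> i = f i" if "i \<in> Basis" for f i
    using that by (simp add: inner_sum_left inner_Basis if_distrib cong: if_cong)
  have norm: "norm (?T f - f b *\<^sub>R b) = sqrt (\<Sum>i\<in>?B. (f i)\<^sup>2)" for f
  proof -
    have "?T f = f b *\<^sub>R b + (\<Sum>i\<in>?B. f i *\<^sub>R i)"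
      using b by (simp add: sum.remove)
    then have "norm (?T f - f b *\<^sub>R b) = norm (\<Sum>i\<in>?B. f i *\<^sub>R i)" by simp
    also have "(norm (\<Sum>i\<in>?B. f i *\<^sub>R i))\<^sup>2 = (\<Sum>i\<in>?B. (norm (f i *\<^sub>R i))\<^sup>2)"
      by (rule norm_sum_Pythagorean) (auto simp: pairwise_def orthogonal_def inner_Basis)
    then have "norm (\<Sum>i\<in>?B. f i *\<^sub>R i) = sqrt (\<Sum>i\<in>?B. (norm (f i *\<^sub>R i))\<^sup>2)"
      by (metis norm_ge_zero real_sqrt_unique)
    also have "(\<Sum>i\<in>?B. (norm (f i *\<^sub>R i))\<^sup>2) = (\<Sum>i\<in>?B. (f i)\<^sup>2)"
      by (intro sum.cong) auto
    finally show ?thesis .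
  qed
  have "emeasure lborel ?Z = (\<integral>\<^sup>+x. indicator ?Z x \<partial>lborel)" by simp
  also have "\<dots> = (\<integral>\<^sup>+f. indicator ?Z (?T f) \<partial>PiM Basis (\<lambda>_. lborel))"
    by (subst lborel_eq, subst nn_integral_distr) measurable
  also have "\<dots> = (\<integral>\<^sup>+f. indicator ?Z (?T f) \<partial>PiM (insert b ?B) (\<lambda>_. lborel))"
    by (simp only: ins)
  also have "\<dots> = (\<integral>\<^sup>+y. \<integral>\<^sup>+f. indicator ?Z (?T (f(b := y))) \<partial>?M \<partial>lborel)"
    by (rule product_nn_integral_insert_rev) (auto simp: ins)
  also have "\<dots> = (\<integral>\<^sup>+y. \<integral>\<^sup>+f. indicator {-h..h} y * indicator ?D f \<partial>?M \<partial>lborel)"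
  proof (intro nn_integral_cong)
    fix y f assume f: "f \<in> space ?M"
    have "sqrt (\<Sum>i\<in>?B. ((f(b := y)) i)\<^sup>2) = sqrt (\<Sum>i\<in>?B. (f i)\<^sup>2)"
      by (intro arg_cong[where f = sqrt] sum.cong) auto
    with norm[of "f(b := y)"] have "norm (?T (f(b := y)) - y *\<^sub>R b) = sqrt (\<Sum>i\<in>?B. (f i)\<^sup>2)"
      by simp
    moreover have "?T (f(b := y)) \<bullet> b = y" using coord[OF b, of "f(b := y)"] by simp
    ultimately have "?T (f(b := y)) \<in> ?Z \<longleftrightarrow> y \<in> {-h..h} \<and> f \<in> ?D"
      using f by (simp only: mem_Collect_eq Int_iff) (auto simp: abs_le_iff)
    then show "(indicator ?Z (?T (f(b := y))) :: ennreal) = indicator {-h..h} y * indicator ?D f"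
      by (simp only: indicator_def of_bool_conj)
  qed
  also have "\<dots> = (\<integral>\<^sup>+y. indicator {-h..h} y * emeasure ?M ?D \<partial>lborel)"
    by (intro nn_integral_cong, subst nn_integral_cmult) (auto simp: nn_integral_indicator)
  also have "\<dots> = (\<integral>\<^sup>+y. ennreal (unit_ball_vol (real (card ?B)) * r ^ card ?B) * indicator {-h..h} y \<partial>lborel)"
    using \<open>0 < r\<close> by (subst emeasure_cball_aux) (auto simp: mult.commute)
  also have "\<dots> = ennreal (unit_ball_vol (real (card ?B)) * r ^ card ?B) * ennreal (2 * h)"
    using \<open>0 \<le> h\<close> by (subst nn_integral_cmult_indicator) auto
  also have "\<dots> = ennreal (2 * h * (unit_ball_vol (real (card ?B)) * r ^ card ?B))"
    using assms by (simp add: mult.commute flip: ennreal_mult)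
  finally show ?thesis
    using b by simp
qed

lemma emeasure_cylinder:
  fixes p :: "'a::euclidean_space"
  assumes p: "norm p = 1" and "0 \<le> h" "0 < r"
  shows "emeasure lborel {x. \<bar>x \<bullet> p\<bar> \<le> h \<and> norm (x - (x \<bullet> p) *\<^sub>R p) \<le> r}
    = ennreal (2 * h * (unit_ball_vol (real (DIM('a) - 1)) * r ^ (DIM('a) - 1)))"
proof -
  obtain b :: 'a where b: "b \<in> Basis" using nonempty_Basis by blast
  let ?Z = "\<lambda>q::'a. {x. \<bar>x \<bullet> q\<bar> \<le> h \<and> norm (x - (x \<bullet> q) *\<^sub>R q) \<le> r}"
  show ?thesis
  proof (cases "p = b")
    case True
    with emeasure_cylinder_Basis[OF b assms(2,3)] show ?thesis by simp
  next
    case False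
    define w where "w = p - b"
    have ww: "w \<bullet> w \<noteq> 0" using False by (simp add: w_def)
    have pp: "p \<bullet> p = 1" using p by (simp add: norm_eq_1)
    have bb: "b \<bullet> b = 1" using b by (simp add: inner_Basis)
    have bw: "w \<bullet> w = - 2 * (b \<bullet> w)"
      using pp bb by (simp add: w_def inner_diff_left inner_diff_right inner_commute)
    \<comment> \<open>Reflection in the hyperplane orthogonal to \<open>p - b\<close>. Both vectors
      have length one, so it exchanges them and carries one cylinder to the other.\<close>
    define R where "R x = x - (2 * (x \<bullet> w) / (w \<bullet> w)) *\<^sub>R w" for x
    have inner: "R x \<bullet> R y = x \<bullet> y" for x y
      using ww by (simp add: R_def inner_diff_left inner_diff_right inner_commute field_simps)
    have RR: "R (R x) = x" for x
    proof -
      have "R x \<bullet> w = - (x \<bullet> w)" using ww by (simp add: R_def inner_diff_left)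
      then show ?thesis by (simp add: R_def[of "R x"]) (simp add: R_def)
    qed
    have Rb: "R b = p"
      using bw ww by (simp add: R_def w_def field_simps)
    have diff: "R x - R y = R (x - y)" for x y
      by (simp add: R_def inner_diff_left algebra_simps diff_divide_distrib)
    have norm: "norm (R x) = norm x" for x
      by (simp add: norm_eq_sqrt_inner inner)
    have scale: "c *\<^sub>R R x = R (c *\<^sub>R x)" for c x
      by (simp add: R_def algebra_simps)
    have Z: "R x \<in> ?Z p \<longleftrightarrow> x \<in> ?Z b" for x
      by (simp add: Rb[symmetric] inner scale diff norm)
    have "?Z p = R ` ?Z b"
    proof (intro set_eqI iffI)
      fix x assume "x \<in> ?Z p"
      then have "R x \<in> ?Z b" using Z[of "R x"] by (simp only: RR)
      then show "x \<in> R ` ?Z b" by (intro image_eqI[of x R "R x"]) (simp only: RR)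
    next
      fix x assume "x \<in> R ` ?Z b"
      then obtain y where "x = R y" "y \<in> ?Z b" by (rule imageE)
      then show "x \<in> ?Z p" using Z[of y] by (simp only:)
    qed
    also have "emeasure lborel \<dots> = emeasure lborel (?Z b)"
    proof (rule emeasure_lborel_isometry_image[where g = R])
      show "?Z b \<in> sets borel" by measurable
    next
      show "dist (R x) (R y) = dist x y" for x y by (simp only: dist_norm diff norm)
    qed (rule RR)+
    also have "\<dots> = ennreal (2 * h * (unit_ball_vol (real (DIM('a) - 1)) * r ^ (DIM('a) - 1)))"
      by (rule emeasure_cylinder_Basis[OF b assms(2,3)])
    finally show ?thesis .
  qed
qed

section \<open>Shells and solid cones over pieces of the sphere\<close>

text \<open>For \<open>E\<close> in the unit sphere, \<open>T = {0..1}\<close> yields the solid cone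
  over \<open>E\<close> with vertex \<open>0\<close>, and \<open>T = {1..1 + L}\<close> the shell
  just outside it.\<close>

definition radial_hull :: "real set \<Rightarrow> 'a::euclidean_space set \<Rightarrow> 'a set" where
  "radial_hull T E = (\<lambda>(t, x). t *\<^sub>R x) ` (T \<times> E)"

lemma compact_radial_hull: "compact T \<Longrightarrow> compact E \<Longrightarrow> compact (radial_hull T E)"
  unfolding radial_hull_def
  by (intro compact_continuous_image compact_Times)
     (auto simp: case_prod_beta intro!: continuous_intros)

text \<open>
  For small \<open>E\<close> the shell \<open>radial_hull {1..1 + L} E\<close> is nearly a cylinder over \<open>E\<close>, so comparing it
  with its half difference set gives a sharp isodiametric estimate for \<open>E\<close> in one dimension less.
\<close>

lemma half_difference_radial_hull:
  fixes E :: "'a::euclidean_space set"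
  assumes E: "E \<subseteq> sphere 0 1" "p \<in> E" and d: "\<And>x y. x \<in> E \<Longrightarrow> y \<in> E \<Longrightarrow> dist x y \<le> d"
    and "0 \<le> L" and u: "u \<in> radial_hull {1..1 + L} E" and v: "v \<in> radial_hull {1..1 + L} E"
  defines "z \<equiv> (u - v) /\<^sub>R 2"
  shows "\<bar>z \<bullet> p\<bar> \<le> L / 2 + (1 + L) * d\<^sup>2 / 4" "norm (z - (z \<bullet> p) *\<^sub>R p) \<le> (1 + 2 * L) * d / 2"
proof -
  obtain t x where tx: "u = t *\<^sub>R x" "1 \<le> t" "t \<le> 1 + L" "x \<in> E" using u by (auto simp: radial_hull_def)
  obtain s y where sy: "v = s *\<^sub>R y" "1 \<le> s" "s \<le> 1 + L" "y \<in> E" using v by (auto simp: radial_hull_def)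
  have n: "norm x = 1" "norm y = 1" "norm p = 1" using E tx sy by auto
  \<comment> \<open>Splitting into a nearly axial part with coefficient of order \<open>L\<close>
    and a nearly tangential part of order \<open>d\<close>.\<close>
  have z: "z = ((t - s) / 4) *\<^sub>R (x + y) + ((t + s) / 4) *\<^sub>R (x - y)"
  proof -
    have "((t - s) / 4) *\<^sub>R (x + y) + ((t + s) / 4) *\<^sub>R (x - y)
        = ((t - s) / 4 + (t + s) / 4) *\<^sub>R x + ((t - s) / 4 - (t + s) / 4) *\<^sub>R y"
      by (simp only: scaleR_add_right scaleR_diff_right scaleR_add_left scaleR_diff_left) simp
    also have "(t - s) / 4 + (t + s) / 4 = t / 2" by (simp add: field_simps)
    also have "(t - s) / 4 - (t + s) / 4 = - (s / 2)" by (simp add: field_simps)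
    finally show ?thesis by (simp add: z_def tx(1) sy(1) scaleR_diff_right inverse_eq_divide)
  qed
  have "0 \<le> d" using d[OF tx(4) sy(4)] zero_le_dist order_trans by blast
  \<comment> \<open>Chords of the sphere leave the tangent direction to second order only; this is
    why \<open>d\<close> enters the height quadratically.\<close>
  have sq: "0 \<le> 1 - q \<bullet> p" "1 - q \<bullet> p \<le> d\<^sup>2 / 2" if "q \<in> E" for q
  proof -
    have "norm q = 1" using that E by auto
    have "(dist q p)\<^sup>2 \<le> d\<^sup>2" using d[OF that E(2)] by (intro power_mono) auto
    moreover have "(dist q p)\<^sup>2 = 2 - 2 * (q \<bullet> p)"
      using \<open>norm q = 1\<close> n by (simp add: dist_norm power2_norm_eq_inner inner_diff_left inner_diff_right
          inner_commute norm_eq_1)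
    ultimately show "1 - q \<bullet> p \<le> d\<^sup>2 / 2" by simp
    show "0 \<le> 1 - q \<bullet> p" using norm_cauchy_schwarz[of q p] \<open>norm q = 1\<close> n by simp
  qed
  have ts: "\<bar>(t - s) / 4\<bar> \<le> L / 4" "\<bar>(t + s) / 4\<bar> \<le> (1 + L) / 2" using tx sy by (auto simp: abs_le_iff)
  have "\<bar>(x + y) \<bullet> p\<bar> \<le> 2"
    using Cauchy_Schwarz_ineq2[of "x + y" p] norm_triangle_ineq[of x y] n by simp
  moreover have "\<bar>(x - y) \<bullet> p\<bar> \<le> d\<^sup>2 / 2"
    using sq[OF tx(4)] sq[OF sy(4)] unfolding inner_diff_left abs_le_iff by linarith
  ultimately have "\<bar>(t - s) / 4\<bar> * \<bar>(x + y) \<bullet> p\<bar> + \<bar>(t + s) / 4\<bar> * \<bar>(x - y) \<bullet> p\<bar>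
      \<le> L / 4 * 2 + (1 + L) / 2 * (d\<^sup>2 / 2)"
    using ts \<open>0 \<le> L\<close> by (intro add_mono mult_mono) auto
  moreover have "\<bar>z \<bullet> p\<bar> \<le> \<bar>(t - s) / 4\<bar> * \<bar>(x + y) \<bullet> p\<bar> + \<bar>(t + s) / 4\<bar> * \<bar>(x - y) \<bullet> p\<bar>"
    unfolding z inner_add_left inner_scaleR_left abs_mult[symmetric] by (rule abs_triangle_ineq)
  ultimately show "\<bar>z \<bullet> p\<bar> \<le> L / 2 + (1 + L) * d\<^sup>2 / 4" by simp
  define Q where "Q w = w - (w \<bullet> p) *\<^sub>R p" for w
  have Q_norm: "norm (Q w) \<le> norm w" for w
  proof -
    have "(norm (Q w))\<^sup>2 = (norm w)\<^sup>2 - (w \<bullet> p)\<^sup>2"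
      using n(3) unfolding Q_def power2_norm_eq_inner
      by (simp add: inner_diff_left inner_diff_right norm_eq_1 inner_commute)
        (simp add: power2_eq_square)
    then have "(norm (Q w))\<^sup>2 \<le> (norm w)\<^sup>2" by simp
    then show ?thesis by (simp add: power2_le_iff_abs_le)
  qed
  have Q_add: "Q (v + w) = Q v + Q w" and Q_scale: "Q (c *\<^sub>R w) = c *\<^sub>R Q w" for v w c
    by (simp_all add: Q_def inner_add_left algebra_simps)
  have "Q p = 0" using n(3) by (simp add: Q_def norm_eq_1)
  \<comment> \<open>The sum is close to \<open>2 *\<^sub>R p\<close>, which the projection
    \<open>Q\<close> annihilates.\<close>
  have "x + y = (x - p) + (y - p) + 2 *\<^sub>R p" by (simp add: scaleR_2)
  then have "Q (x + y) = Q (x - p) + Q (y - p)"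
    by (simp only: Q_add Q_scale \<open>Q p = 0\<close> scaleR_zero_right add_0_right)
  then have "norm (Q (x + y)) \<le> norm (x - p) + norm (y - p)"
    using norm_triangle_ineq[of "Q (x - p)" "Q (y - p)"] Q_norm[of "x - p"] Q_norm[of "y - p"] by simp
  also have "\<dots> \<le> 2 * d"
    using d[OF tx(4) E(2)] d[OF sy(4) E(2)] by (simp add: dist_norm)
  finally have 1: "norm (Q (x + y)) \<le> 2 * d" .
  have 2: "norm (Q (x - y)) \<le> d"
    using Q_norm[of "x - y"] d[OF tx(4) sy(4)] by (simp add: dist_norm)
  have "norm (Q z) \<le> \<bar>(t - s) / 4\<bar> * norm (Q (x + y)) + \<bar>(t + s) / 4\<bar> * norm (Q (x - y))"
    unfolding z Q_add Q_scale by (rule norm_triangle_le) simp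
  also have "\<dots> \<le> L / 4 * (2 * d) + (1 + L) / 2 * d"
    using ts 1 2 \<open>0 \<le> L\<close> \<open>0 \<le> d\<close> by (intro add_mono mult_mono) auto
  also have "\<dots> = (1 + 2 * L) * d / 2" by (simp add: field_simps)
  finally show "norm (z - (z \<bullet> p) *\<^sub>R p) \<le> (1 + 2 * L) * d / 2" by (simp add: Q_def)
qed

text \<open>Dilating the solid cone by \<open>1 + L\<close> adds at most the shell, whose volume is
  bounded by that of a cylinder containing its half difference set. After division by
  \<open>L\<close>, for small \<open>L\<close> and \<open>(diameter E)\<^sup>2\<close> small against
  \<open>L\<close>, this compares \<open>DIM('a)\<close> times the volume of the solid cone with the
  flat isodiametric value in one dimension less.\<close>

lemma measure_radial_hull_le:
  fixes E :: "'a::euclidean_space set"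
  assumes E: "compact E" "E \<subseteq> sphere 0 1" "E \<noteq> {}" and L: "0 < L"
  defines "n \<equiv> DIM('a) - 1"
  shows "((1 + L) ^ DIM('a) - 1) * measure lebesgue (radial_hull {0..1} E)
    \<le> (L + (1 + L) * (diameter E)\<^sup>2 / 2) * (1 + 2 * L) ^ n * (unit_ball_vol (real n) * (diameter E / 2) ^ n)"
proof -
  let ?K = "radial_hull {0..1} E" and ?X = "radial_hull {1..1 + L} E"
  obtain p where p: "p \<in> E" using E by auto
  have cK: "compact ?K" and cX: "compact ?X" using E by (auto intro!: compact_radial_hull)
  \<comment> \<open>A strict upper bound \<open>D\<close> of the diameter keeps the cylinder radius
    positive even if \<open>E\<close> is a single point; \<open>D\<close> tends to the diameter at
    the end.\<close>
  define F where "F D = (L + (1 + L) * D\<^sup>2 / 2) * (1 + 2 * L) ^ n * (unit_ball_vol (real n) * (D / 2) ^ n)"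
    for D :: real
  have le: "((1 + L) ^ DIM('a) - 1) * measure lebesgue ?K \<le> F D" if D: "diameter E < D" for D
  proof -
    have "0 < D" using D diameter_ge_0[OF compact_imp_bounded[OF E(1)]] by linarith
    let ?h = "L / 2 + (1 + L) * D\<^sup>2 / 4" and ?r = "(1 + 2 * L) * D / 2"
    have h: "0 \<le> ?h" using L by simp
    have "emeasure lborel ?X \<le> emeasure lborel {x. \<bar>x \<bullet> p\<bar> \<le> ?h \<and> norm (x - (x \<bullet> p) *\<^sub>R p) \<le> ?r}"
    proof (rule emeasure_le_half_difference_set[OF cX])
      have d: "dist x y \<le> D" if "x \<in> E" "y \<in> E" for x y
        using diameter_bounded_bound[OF compact_imp_bounded[OF E(1)] that] D by linarith
      fix u v assume "u \<in> ?X" "v \<in> ?X"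
      then show "(u - v) /\<^sub>R 2 \<in> {x. \<bar>x \<bullet> p\<bar> \<le> ?h \<and> norm (x - (x \<bullet> p) *\<^sub>R p) \<le> ?r}"
        using half_difference_radial_hull[OF E(2) p d, of L u v] L by simp
    qed measurable
    also have "\<dots> = ennreal (2 * ?h * (unit_ball_vol (real n) * ?r ^ n))"
      unfolding n_def using p E(2) L \<open>0 < D\<close> h by (intro emeasure_cylinder) auto
    also have "2 * ?h * (unit_ball_vol (real n) * ?r ^ n) = F D"
    proof -
      have "?r ^ n = (1 + 2 * L) ^ n * (D / 2) ^ n"
        by (simp flip: power_mult_distrib)
      moreover have "2 * ?h = L + (1 + L) * D\<^sup>2 / 2" by simp
      ultimately show ?thesis unfolding F_def by (simp only: ac_simps)
    qed
    finally have X: "measure lebesgue ?X \<le> F D"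
      using L \<open>0 < D\<close> cX unfolding measure_def
      by (intro enn2real_leI) (simp_all add: borel_compact F_def)
    have "(1 + L) ^ DIM('a) * measure lebesgue ?K = measure lebesgue ((\<lambda>x. (1 + L) *\<^sub>R x + 0) ` ?K)"
      using L by (subst measure_lebesgue_affine) simp
    also have "\<dots> \<le> measure lebesgue (?K \<union> ?X)"
    proof (rule measure_mono_fmeasurable)
      have "compact ((\<lambda>x. (1 + L) *\<^sub>R x + 0) ` ?K)"
        using cK by (intro compact_continuous_image continuous_intros)
      then show "(\<lambda>x. (1 + L) *\<^sub>R x + 0) ` ?K \<in> sets lebesgue"
        by (simp add: borel_compact)
      show "?K \<union> ?X \<in> lmeasurable" using cK cX by (intro lmeasurable_compact compact_Un)
      show "(\<lambda>x. (1 + L) *\<^sub>R x + 0) ` ?K \<subseteq> ?K \<union> ?X"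
      proof clarsimp
        fix y assume "y \<in> ?K" "(1 + L) *\<^sub>R y \<notin> ?X"
        then obtain t x where tx: "y = t *\<^sub>R x" "0 \<le> t" "t \<le> 1" "x \<in> E" by (auto simp: radial_hull_def)
        have y: "(1 + L) *\<^sub>R y = ((1 + L) * t) *\<^sub>R x" by (simp add: tx)
        have in_hull: "((1 + L) * t) *\<^sub>R x \<in> radial_hull T E" if "(1 + L) * t \<in> T" for T
          using that tx(4) by (force simp: radial_hull_def)
        have "(1 + L) * t \<le> 1 + L" using tx L by (simp add: mult_le_cancel_left1)
        then have "(1 + L) * t \<le> 1"
          using \<open>(1 + L) *\<^sub>R y \<notin> ?X\<close> in_hull[of "{1..1 + L}"] y by fastforce
        then show "(1 + L) *\<^sub>R y \<in> ?K"
          unfolding y using tx L by (intro in_hull) simp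
      qed
    qed
    also have "\<dots> \<le> measure lebesgue ?K + measure lebesgue ?X"
      using cK cX by (intro measure_Un_le) (simp_all add: borel_compact)
    finally show ?thesis using X by (simp add: algebra_simps)
  qed
  have "((1 + L) ^ DIM('a) - 1) * measure lebesgue ?K \<le> F (diameter E)"
  proof (rule tendsto_lowerbound)
    show "(F \<longlongrightarrow> F (diameter E)) (at_right (diameter E))"
      unfolding F_def by (intro tendsto_intros) simp_all
    show "\<forall>\<^sub>F D in at_right (diameter E). ((1 + L) ^ DIM('a) - 1) * measure lebesgue ?K \<le> F D"
      using le by (auto simp: eventually_at_filter)
  qed simp
  then show ?thesis by (simp add: F_def)
qed

text \<open>Solid cones over the pieces of a cover of the sphere cover the unit ball, so the
  estimate for one piece can be summed. The mesh \<open>\<delta>\<close> makes the factor uniform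
  over the pieces.\<close>

lemma hausdorff_pre_sphere_ge:
  assumes L: "0 < L" and \<delta>: "0 < \<delta>"
  defines "n \<equiv> DIM('a::euclidean_space) - 1"
  shows "ennreal (((1 + L) ^ DIM('a) - 1) * unit_ball_vol (real DIM('a)))
    \<le> ennreal ((L + (1 + L) * \<delta>\<^sup>2 / 2) * (1 + 2 * L) ^ n) * hausdorff_pre n \<delta> (sphere (0::'a) 1)"
  (is "ennreal ?l \<le> ennreal ?c * _")
proof -
  have c: "0 < ?c" using L \<delta> by (simp add: add_pos_nonneg)
  have l: "0 \<le> ?l" using L by simp
  have "ennreal (?l / ?c) \<le> hausdorff_pre n \<delta> (sphere (0::'a) 1)"
    unfolding hausdorff_pre_def
  proof (rule INF_greatest, clarify)
    fix E :: "nat \<Rightarrow> 'a set"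
    assume cov: "sphere 0 1 \<subseteq> (\<Union>i. E i)" and E: "\<forall>i. bounded (E i) \<and> diameter (E i) \<le> \<delta>"
    \<comment> \<open>Compact subsets of the sphere that still cover it, of no larger diameter than
      the given pieces.\<close>
    define F where "F i = closure (E i) \<inter> sphere 0 1" for i
    have cF: "compact (F i)" for i unfolding F_def using E by (auto simp: compact_closure)
    have dF: "diameter (F i) \<le> diameter (E i)" for i
      using diameter_subset[of "F i" "closure (E i)"] E by (simp add: F_def diameter_closure bounded_closure)
    have le: "ennreal ((1 + L) ^ DIM('a) - 1) * emeasure lborel (radial_hull {0..1} (F i))
        \<le> ennreal ?c * hausdorff_gauge n (E i)" for i
    proof (cases "F i = {}")
      case True
      then show ?thesis by (simp add: radial_hull_def)
    next
      case False
      then have ne: "E i \<noteq> {}" by (auto simp: F_def)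
      have d0: "0 \<le> diameter (F i)" using cF compact_imp_bounded diameter_ge_0 by blast
      have "((1 + L) ^ DIM('a) - 1) * measure lebesgue (radial_hull {0..1} (F i))
          \<le> (L + (1 + L) * (diameter (F i))\<^sup>2 / 2) * (1 + 2 * L) ^ n * (unit_ball_vol (real n) * (diameter (F i) / 2) ^ n)"
        unfolding n_def using cF False L by (intro measure_radial_hull_le) (auto simp: F_def)
      also have "\<dots> \<le> ?c * (unit_ball_vol (real n) * (diameter (E i) / 2) ^ n)"
        using E dF[of i] d0 L
        by (intro mult_mono add_mono divide_right_mono power_mono) (auto intro: order_trans)
      finally have "ennreal (((1 + L) ^ DIM('a) - 1) * measure lebesgue (radial_hull {0..1} (F i)))
          \<le> ennreal (?c * (unit_ball_vol (real n) * (diameter (E i) / 2) ^ n))"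
        by (rule ennreal_leI)
      moreover have "emeasure lborel (radial_hull {0..1} (F i)) = ennreal (measure lebesgue (radial_hull {0..1} (F i)))"
        using compact_radial_hull[OF _ cF[of i], of "{0..1}"]
        by (subst emeasure_eq_ennreal_measure) (auto simp: borel_compact dest: emeasure_compact_finite)
      ultimately show ?thesis
        using ne L E by (simp add: hausdorff_gauge_def ennreal_mult diameter_ge_0)
    qed
    have "cball 0 1 \<subseteq> (\<Union>i. radial_hull {0..1} (F i))"
    proof
      fix y :: 'a assume y: "y \<in> cball 0 1"
      obtain x where x: "x \<in> sphere 0 1" "y = norm y *\<^sub>R x"
      proof (cases "y = 0")
        case True
        obtain b :: 'a where "b \<in> Basis" using nonempty_Basis by blast
        with True show ?thesis by (intro that[of b]) auto
      qed (auto intro: that[of "y /\<^sub>R norm y"])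
      then obtain i where "x \<in> E i" using cov by auto
      then have "x \<in> F i" using x closure_subset by (auto simp: F_def)
      then have "norm y *\<^sub>R x \<in> radial_hull {0..1} (F i)"
        using y by (force simp: radial_hull_def)
      then show "y \<in> (\<Union>i. radial_hull {0..1} (F i))" using x(2) by auto
    qed
    then have "emeasure lborel (cball (0::'a) 1) \<le> emeasure lborel (\<Union>i. radial_hull {0..1} (F i))"
      using cF by (intro emeasure_mono sets.countable_UN) (auto simp: borel_compact compact_radial_hull)
    also have "\<dots> \<le> (\<Sum>i. emeasure lborel (radial_hull {0..1} (F i)))"
      using cF by (intro emeasure_subadditive_countably) (auto simp: borel_compact compact_radial_hull)
    finally have "ennreal ((1 + L) ^ DIM('a) - 1) * emeasure lborel (cball (0::'a) 1)
        \<le> (\<Sum>i. ennreal ((1 + L) ^ DIM('a) - 1) * emeasure lborel (radial_hull {0..1} (F i)))"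
      by (simp add: ennreal_suminf_cmult mult_left_mono)
    also have "\<dots> \<le> (\<Sum>i. ennreal ?c * hausdorff_gauge n (E i))"
      by (intro suminf_le le) auto
    also have "\<dots> = ennreal ?c * (\<Sum>i. hausdorff_gauge n (E i))"
      by (rule ennreal_suminf_cmult)
    finally have "ennreal ?l \<le> ennreal ?c * (\<Sum>i. hausdorff_gauge n (E i))"
      using L by (simp add: emeasure_cball ennreal_mult)
    then have "ennreal ?l / ennreal ?c \<le> (\<Sum>i. hausdorff_gauge n (E i))"
      using c by (intro divide_le_posI_ennreal) (auto simp del: ennreal_eq_0_iff)
    then show "ennreal (?l / ?c) \<le> (\<Sum>i. hausdorff_gauge n (E i))"
      using c l by (simp only: divide_ennreal)
  qed
  then have "ennreal ?c * ennreal (?l / ?c) \<le> ennreal ?c * hausdorff_pre n \<delta> (sphere (0::'a) 1)"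
    by (rule mult_left_mono) simp
  moreover have "ennreal ?c * ennreal (?l / ?c) = ennreal ?l"
  proof -
    have "ennreal c * ennreal (l / c) = ennreal l" if "0 < c" "0 \<le> l" for c l :: real
      using that by (simp flip: ennreal_mult)
    then show ?thesis using c l by blast
  qed
  ultimately show ?thesis by simp
qed

section \<open>Finiteness of the area and passage to the limit\<close>

lemma power_diff_le:
  fixes a b :: real
  assumes "0 \<le> b" "b \<le> a"
  shows "a ^ k - b ^ k \<le> real k * (a - b) * a ^ (k - 1)"
proof (cases k)
  case (Suc m)
  have "(\<Sum>i<Suc m. a ^ i * b ^ (m - i)) \<le> (\<Sum>i<Suc m. a ^ m)"
  proof (rule sum_mono)
    fix i assume "i \<in> {..<Suc m}"
    then have "a ^ i * b ^ (m - i) \<le> a ^ i * a ^ (m - i)" "i + (m - i) = m"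
      using assms by (auto intro!: mult_left_mono power_mono)
    then show "a ^ i * b ^ (m - i) \<le> a ^ m" by (metis power_add)
  qed
  then have "(a - b) * (\<Sum>i<Suc m. a ^ i * b ^ (m - i)) \<le> (a - b) * (real (Suc m) * a ^ m)"
    using assms by (intro mult_left_mono) auto
  moreover have "a ^ Suc m - b ^ Suc m = (a - b) * (\<Sum>i<Suc m. a ^ i * b ^ (m - i))"
    by (rule diff_power_eq_sum)
  ultimately show ?thesis using Suc by (simp add: ac_simps)
qed simp

text \<open>Without finiteness, \<^const>\<open>measure\<close> of the sphere would be the junk value \<open>0\<close>.\<close>

lemma hausdorff_outer_sphere_finite:
  "hausdorff_outer (DIM('a) - 1) (sphere (0::'a::euclidean_space) 1) < top"
proof -
  let ?S = "sphere (0::'a) 1" and ?N = "DIM('a)" and ?n = "DIM('a) - 1"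
  let ?\<omega> = "unit_ball_vol (real ?N)" and ?\<kappa> = "unit_ball_vol (real ?n)"
  have N: "Suc ?n = ?N" using DIM_positive[where 'a='a] by linarith
  have \<omega>: "?\<omega> \<noteq> 0" using unit_ball_vol_pos[of "real ?N"] by linarith
  \<comment> \<open>Disjoint balls of radius \<open>\<rho>\<close> centred on the sphere lie in an
    annulus of width \<open>2 * \<rho>\<close>. Its volume, of order \<open>\<rho>\<close>, cancels
    the \<open>1 / \<rho>\<close> needed to turn a gauge of degree \<open>?n\<close> into a volume,
    so \<open>?b\<close> is free of \<open>\<rho>\<close>.\<close>
  let ?b = "?\<kappa> * 5 ^ ?n / ?\<omega> * (?\<omega> * (real ?N * 2 * 2 ^ ?n))"
  have bound: "hausdorff_pre ?n (10 * \<rho>) ?S \<le> ennreal ?b" if \<rho>: "0 < \<rho>" "\<rho> \<le> 1" for \<rho>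
  proof -
    have "?S \<subseteq> (\<Union>x\<in>?S. cball x \<rho>)" using \<rho> by auto
    moreover have "0 < \<rho> \<and> \<rho> \<le> 1" if "x \<in> ?S" for x using \<rho> by simp
    ultimately obtain C where C: "countable C" "C \<subseteq> ?S"
      "pairwise (\<lambda>i j. disjnt (cball i \<rho>) (cball j \<rho>)) C" "?S \<subseteq> (\<Union>i\<in>C. cball i (5 * \<rho>))"
      by (rule Vitali_covering_lemma_cballs[where a = "\<lambda>x. x" and r = "\<lambda>_. \<rho>" and B = 1])
    let ?c = "?\<kappa> * 5 ^ ?n / (?\<omega> * \<rho>)"
    have "hausdorff_pre ?n (10 * \<rho>) ?S \<le> ennreal ?c * emeasure lborel (\<Union>x\<in>C. cball x \<rho>)"
    proof (rule hausdorff_pre_le_packing[OF C(1,3) _ C(4)])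
      fix x assume "x \<in> C"
      have "\<rho> ^ ?N = \<rho> * \<rho> ^ ?n" using power_Suc[of \<rho> ?n] by (simp only: N)
      then have "?\<kappa> * (5 * \<rho>) ^ ?n = ?c * (?\<omega> * \<rho> ^ ?N)"
        using \<rho> \<omega> by (simp add: power_mult_distrib field_simps)
      then show "hausdorff_gauge ?n (cball x (5 * \<rho>)) \<le> ennreal ?c * emeasure lborel (cball x \<rho>)"
        using \<rho> by (simp add: hausdorff_gauge_def emeasure_cball flip: ennreal_mult)
    qed (use \<rho> in auto)
    also have "(\<Union>x\<in>C. cball x \<rho>) \<subseteq> cball 0 (1 + \<rho>) - ball 0 (1 - \<rho>)"
    proof
      fix y assume "y \<in> (\<Union>x\<in>C. cball x \<rho>)"
      then obtain x where x: "norm x = 1" "dist x y \<le> \<rho>" using C(2) by auto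
      then show "y \<in> cball 0 (1 + \<rho>) - ball 0 (1 - \<rho>)"
        using norm_triangle_ineq2[of x y] norm_triangle_ineq2[of y x]
        by (auto simp: dist_norm norm_minus_commute)
    qed
    then have "emeasure lborel (\<Union>x\<in>C. cball x \<rho>) \<le> emeasure lborel (cball (0::'a) (1 + \<rho>) - ball 0 (1 - \<rho>))"
      by (intro emeasure_mono) auto
    also have "\<dots> = ennreal (?\<omega> * (1 + \<rho>) ^ ?N) - ennreal (?\<omega> * (1 - \<rho>) ^ ?N)"
      using \<rho> by (subst emeasure_Diff) (auto simp: emeasure_cball emeasure_ball)
    also have "\<dots> = ennreal (?\<omega> * ((1 + \<rho>) ^ ?N - (1 - \<rho>) ^ ?N))"
      using \<rho> by (simp add: ennreal_minus right_diff_distrib)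
    also have "\<dots> \<le> ennreal (?\<omega> * (real ?N * (2 * \<rho>) * 2 ^ ?n))"
    proof (intro ennreal_leI mult_left_mono)
      have "(1 + \<rho>) ^ ?N - (1 - \<rho>) ^ ?N \<le> real ?N * ((1 + \<rho>) - (1 - \<rho>)) * (1 + \<rho>) ^ ?n"
        using \<rho> by (intro power_diff_le) auto
      also have "\<dots> \<le> real ?N * ((1 + \<rho>) - (1 - \<rho>)) * 2 ^ ?n"
        using \<rho> by (intro mult_left_mono power_mono) auto
      finally show "(1 + \<rho>) ^ ?N - (1 - \<rho>) ^ ?N \<le> real ?N * (2 * \<rho>) * 2 ^ ?n" by simp
    qed simp
    finally have "hausdorff_pre ?n (10 * \<rho>) ?S \<le> ennreal ?c * ennreal (?\<omega> * (real ?N * (2 * \<rho>) * 2 ^ ?n))"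
      by (simp add: mult_left_mono)
    also have "\<dots> = ennreal ?b"
      using \<rho> by (subst ennreal_mult[symmetric]) (auto simp: field_simps)
    finally show ?thesis .
  qed
  have "hausdorff_outer ?n ?S \<le> ennreal ?b"
    unfolding hausdorff_outer_def
  proof (rule SUP_least)
    fix \<delta> :: real assume "\<delta> \<in> {0<..}"
    then have "hausdorff_pre ?n \<delta> ?S \<le> hausdorff_pre ?n (10 * min (\<delta> / 10) 1) ?S"
      by (intro hausdorff_pre_antimono) simp
    also have "\<dots> \<le> ennreal ?b"
      using \<open>\<delta> \<in> {0<..}\<close> by (intro bound) auto
    finally show "hausdorff_pre ?n \<delta> ?S \<le> ennreal ?b" .
  qed
  then show ?thesis using ennreal_less_top le_less_trans by blast
qed

text \<open>The order of the limits matters: first \<open>\<delta>\<close> tends to \<open>0\<close>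
  with \<open>L\<close> fixed, which removes the quadratic height error; then, after Bernoulli's
  inequality and division by \<open>L\<close>, the thickness \<open>L\<close> tends to
  \<open>0\<close>.\<close>

theorem measure_sphere_ge:
  "real DIM('a) * unit_ball_vol (real DIM('a))
    \<le> measure (hausdorff_measure (DIM('a) - 1)) (sphere (0::'a::euclidean_space) 1)"
proof -
  let ?S = "sphere (0::'a) 1" and ?N = "DIM('a)" and ?n = "DIM('a) - 1"
  let ?\<omega> = "unit_ball_vol (real ?N)"
  define H where "H = measure (hausdorff_measure ?n) ?S"
  have "?S \<in> sets (hausdorff_measure ?n)" by (rule closed_in_sets_hausdorff_measure) simp
  then have "emeasure (hausdorff_measure ?n) ?S = hausdorff_outer ?n ?S"
    by (rule emeasure_hausdorff_measure)
  with hausdorff_outer_sphere_finite[where 'a='a] have H: "hausdorff_outer ?n ?S = ennreal H"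
    unfolding H_def by (metis emeasure_eq_ennreal_measure less_irrefl)
  have "0 \<le> H" by (simp add: H_def)
  have le: "((1 + L) ^ ?N - 1) * ?\<omega> \<le> (L + (1 + L) * \<delta>\<^sup>2 / 2) * (1 + 2 * L) ^ ?n * H"
    if "0 < L" "0 < \<delta>" for L \<delta>
  proof -
    let ?c = "(L + (1 + L) * \<delta>\<^sup>2 / 2) * (1 + 2 * L) ^ ?n"
    have "hausdorff_pre ?n \<delta> ?S \<le> ennreal H"
      unfolding H[symmetric] hausdorff_outer_def using that by (intro SUP_upper) simp
    then have "ennreal (((1 + L) ^ ?N - 1) * ?\<omega>) \<le> ennreal ?c * ennreal H"
      using hausdorff_pre_sphere_ge[where 'a='a, OF that] by (meson mult_left_mono order_trans zero_le)
    also have "\<dots> = ennreal (?c * H)"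
      using that \<open>0 \<le> H\<close> by (intro ennreal_mult[symmetric]) auto
    finally show ?thesis
      using that \<open>0 \<le> H\<close> by (subst (asm) ennreal_le_iff) auto
  qed
  have le2: "real ?N * ?\<omega> \<le> (1 + 2 * L) ^ ?n * H" if "0 < L" for L
  proof -
    have "((1 + L) ^ ?N - 1) * ?\<omega> \<le> (L + (1 + L) * 0\<^sup>2 / 2) * (1 + 2 * L) ^ ?n * H"
    proof (rule tendsto_lowerbound)
      show "((\<lambda>\<delta>. (L + (1 + L) * \<delta>\<^sup>2 / 2) * (1 + 2 * L) ^ ?n * H) \<longlongrightarrow>
          (L + (1 + L) * 0\<^sup>2 / 2) * (1 + 2 * L) ^ ?n * H) (at_right 0)"
        by (intro tendsto_intros) simp
      show "\<forall>\<^sub>F \<delta> in at_right 0. ((1 + L) ^ ?N - 1) * ?\<omega> \<le> (L + (1 + L) * \<delta>\<^sup>2 / 2) * (1 + 2 * L) ^ ?n * H"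
        using le[OF that] by (auto simp: eventually_at_filter)
    qed simp
    moreover have "1 + real ?N * L \<le> (1 + L) ^ ?N"
      using Bernoulli_inequality[of L ?N] that by (simp add: mult.commute)
    then have "(real ?N * L) * ?\<omega> \<le> ((1 + L) ^ ?N - 1) * ?\<omega>"
      by (intro mult_right_mono) auto
    ultimately have "(real ?N * L) * ?\<omega> \<le> (L + (1 + L) * 0\<^sup>2 / 2) * (1 + 2 * L) ^ ?n * H"
      by linarith
    then have "L * (real ?N * ?\<omega>) \<le> L * ((1 + 2 * L) ^ ?n * H)"
      by (simp add: ac_simps)
    then show ?thesis using that by simp
  qed
  have "real ?N * ?\<omega> \<le> (1 + 2 * 0) ^ ?n * H"
  proof (rule tendsto_lowerbound)
    show "((\<lambda>L. (1 + 2 * L) ^ ?n * H) \<longlongrightarrow> (1 + 2 * 0) ^ ?n * H) (at_right 0)"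
      by (intro tendsto_intros)
    show "\<forall>\<^sub>F L in at_right 0. real ?N * ?\<omega> \<le> (1 + 2 * L) ^ ?n * H"
      using le2 by (auto simp: eventually_at_filter)
  qed simp
  then show ?thesis by (simp add: H_def)
qed

section \<open>Relative perimeter of balls\<close>

lemma lborel_integral_translate:
  fixes f :: "'a::euclidean_space \<Rightarrow> real"
  assumes [measurable]: "f \<in> borel_measurable borel"
  shows "(LINT x|lborel. f (x + a)) = (LINT x|lborel. f x)"
proof -
  have "(LINT x|lborel. f x) = (LINT x|distr lborel borel ((+) a). f x)"
    by (simp only: lborel_distr_plus)
  also have "\<dots> = (LINT x|lborel. f (a + x))"
    by (rule integral_distr) auto
  finally show ?thesis by (simp add: add.commute)
qed

lemma integrable_continuous_compact_support:
  fixes f :: "'a::euclidean_space \<Rightarrow> real"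
  assumes "continuous_on UNIV f" "compact K" "\<And>x. x \<notin> K \<Longrightarrow> f x = 0"
  shows "integrable lborel f"
proof -
  have "integrable lborel (\<lambda>x. indicator K x *\<^sub>R f x)"
    using assms continuous_on_subset by (intro borel_integrable_compact) blast+
  moreover have "(\<lambda>x. indicator K x *\<^sub>R f x) = f"
    using assms(3) by (auto simp: indicator_def fun_eq_iff)
  ultimately show ?thesis by simp
qed

lemma has_derivative_difference_quotient:
  fixes f :: "'a::real_normed_vector \<Rightarrow> real"
  assumes f: "(f has_derivative D) (at x)" and t: "filterlim t (at 0) F"
  shows "((\<lambda>k. (f (x + t k *\<^sub>R v) - f x) / t k) \<longlongrightarrow> D v) F"
proof -
  have "((\<lambda>s. x + s *\<^sub>R v) has_derivative (\<lambda>s. s *\<^sub>R v)) (at (0::real))"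
    by (auto intro!: derivative_eq_intros)
  then have "((\<lambda>s. f (x + s *\<^sub>R v)) has_derivative (\<lambda>s. D (s *\<^sub>R v))) (at 0)"
    using f has_derivative_compose[of "\<lambda>s. x + s *\<^sub>R v" "\<lambda>s. s *\<^sub>R v" 0 UNIV f D] by simp
  moreover have "D (s *\<^sub>R v) = s * D v" for s
    using linear_cmul[OF has_derivative_linear[OF f]] by simp
  ultimately have "DERIV (\<lambda>s. f (x + s *\<^sub>R v)) 0 :> D v"
    by (simp add: has_field_derivative_def mult_commute_abs)
  then have "((\<lambda>h. (f (x + h *\<^sub>R v) - f x) / h) \<longlongrightarrow> D v) (at 0)"
    by (simp add: DERIV_def)
  from filterlim_compose[OF this t] show ?thesis .
qed

section \<open>Integration by parts for compactly supported fields\<close>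

text \<open>An admissible field vanishes outside a compact subset of the open set \<open>M\<close>,
  hence is continuously differentiable on the whole space. In this global form it can be translated
  without leaving its domain.\<close>

locale smooth_compact_field =
  fixes Y :: "'a::euclidean_space \<Rightarrow> 'a" and K :: "'a set"
  assumes differentiable: "\<And>x. Y differentiable (at x)"
    and continuous_deriv: "\<And>v. continuous_on UNIV (\<lambda>x. frechet_derivative Y (at x) v)"
    and compact_support: "compact K"
    and outside: "\<And>x. x \<notin> K \<Longrightarrow> Y x = 0"
    and deriv_outside: "\<And>x v. x \<notin> K \<Longrightarrow> frechet_derivative Y (at x) v = 0"
    and norm_le_1: "\<And>x. norm (Y x) \<le> 1"
begin

lemma has_derivative: "(Y has_derivative frechet_derivative Y (at x)) (at x)"
  using differentiable frechet_derivative_works by blast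

lemma component_has_derivative:
  "((\<lambda>x. Y x \<bullet> b) has_derivative (\<lambda>v. frechet_derivative Y (at x) v \<bullet> b)) (at x)"
  by (rule has_derivative_inner_left[OF has_derivative])

lemma continuous: "continuous_on UNIV Y"
  by (metis continuous_at_imp_continuous_on differentiable differentiable_imp_continuous_within)

lemma continuous_divergence: "continuous_on UNIV (divergence Y)"
  unfolding divergence_def by (intro continuous_intros continuous_deriv)

lemma divergence_outside: "x \<notin> K \<Longrightarrow> divergence Y x = 0"
  by (simp add: divergence_def deriv_outside)

lemma bounded_divergence: "\<exists>C. \<forall>x. \<bar>divergence Y x\<bar> \<le> C"
proof -
  have "bounded (divergence Y ` K)"
    using continuous_divergence compact_support
    by (intro compact_imp_bounded compact_continuous_image) (auto intro: continuous_on_subset)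
  then obtain C where C: "\<And>x. x \<in> K \<Longrightarrow> \<bar>divergence Y x\<bar> \<le> C" by (auto simp: bounded_iff)
  have "\<bar>divergence Y x\<bar> \<le> max C 0" for x
    using C[of x] divergence_outside[of x] by (cases "x \<in> K") auto
  then show ?thesis by blast
qed

text \<open>Supplies the majorant for the difference quotients of the field in the dominated
  convergence argument.\<close>

lemma component_lipschitz: "\<exists>C\<ge>0. \<forall>x t. \<bar>Y (x + t *\<^sub>R b) \<bullet> b - Y x \<bullet> b\<bar> \<le> C * \<bar>t\<bar>"
proof -
  let ?g = "\<lambda>x. frechet_derivative Y (at x) b \<bullet> b"
  have "continuous_on UNIV ?g" by (intro continuous_intros continuous_deriv)
  then have "bounded (?g ` K)"
    using compact_support
    by (intro compact_imp_bounded compact_continuous_image) (auto intro: continuous_on_subset)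
  then obtain C where C: "\<And>x. x \<in> K \<Longrightarrow> \<bar>?g x\<bar> \<le> C" by (auto simp: bounded_iff)
  have bd: "\<bar>?g x\<bar> \<le> max C 0" for x
    using C[of x] deriv_outside[of x b] by (cases "x \<in> K") auto
  have "\<bar>Y (x + t *\<^sub>R b) \<bullet> b - Y x \<bullet> b\<bar> \<le> max C 0 * \<bar>t\<bar>" for x t
  proof -
    have d: "((\<lambda>s. Y (x + s *\<^sub>R b) \<bullet> b) has_field_derivative ?g (x + s *\<^sub>R b)) (at s within UNIV)" for s
    proof -
      have "((\<lambda>s. x + s *\<^sub>R b) has_derivative (\<lambda>s. s *\<^sub>R b)) (at s)"
        by (auto intro!: derivative_eq_intros)
      from has_derivative_compose[OF this component_has_derivative[of b]]
      have "((\<lambda>s. Y (x + s *\<^sub>R b) \<bullet> b) has_derivative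
          (\<lambda>r. frechet_derivative Y (at (x + s *\<^sub>R b)) (r *\<^sub>R b) \<bullet> b)) (at s)" .
      moreover have "frechet_derivative Y (at z) (r *\<^sub>R b) = r *\<^sub>R frechet_derivative Y (at z) b" for z r
        using linear_cmul[OF has_derivative_linear[OF has_derivative]] .
      ultimately show ?thesis
        by (simp add: has_field_derivative_def mult_commute_abs)
    qed
    have "norm (Y (x + t *\<^sub>R b) \<bullet> b - Y (x + 0 *\<^sub>R b) \<bullet> b) \<le> max C 0 * norm (t - 0)"
      by (rule field_differentiable_bound[OF convex_UNIV d]) (use bd in auto)
    then show ?thesis by simp
  qed
  then show ?thesis by (intro exI[of _ "max C 0"]) auto
qed

text \<open>
  Integration by parts without a divergence theorem: difference quotients are moved from
  \<open>Y\<close> to \<open>\<eta>\<close> by translation invariance, and dominated convergence is applied on both sides.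
\<close>

lemma integral_cutoff_divergence:
  fixes \<eta> :: "'a \<Rightarrow> real"
  assumes \<eta>_lip: "\<And>x y. \<bar>\<eta> x - \<eta> y\<bar> \<le> B * dist x y" and \<eta>_bd: "\<And>x. \<bar>\<eta> x\<bar> \<le> 1" and "0 \<le> B"
    and deriv: "AE x in lborel. (\<eta> has_derivative \<eta>' x) (at x)"
    and g [measurable]: "g \<in> borel_measurable borel"
    and g_eq: "AE x in lborel. g x = - \<eta>' x (Y x)"
  shows "(LINT x|lborel. \<eta> x * divergence Y x) = (LINT x|lborel. g x)"
proof -
  define t where "t k = inverse (real (Suc k))" for k
  have t: "0 < t k" "t k \<le> 1" for k
    by (auto simp: t_def field_simps)
  have t0: "t \<longlonglongrightarrow> 0"
    unfolding t_def by (rule LIMSEQ_inverse_real_of_nat)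
  \<comment> \<open>Both signs occur because translation turns forward quotients of \<open>Y\<close>
    into backward quotients of \<open>\<eta>\<close>.\<close>
  then have t_at: "filterlim t (at 0) sequentially" "filterlim (\<lambda>k. - t k) (at 0) sequentially"
    using t(1) tendsto_minus[OF t0] by (auto simp: filterlim_at less_imp_neq[symmetric] intro!: always_eventually)
  have c\<eta>: "continuous_on UNIV \<eta>"
    unfolding continuous_on_iff
  proof (intro ballI allI impI)
    fix x :: 'a and e :: real assume "0 < e"
    have "dist (\<eta> y) (\<eta> x) < e" if "dist y x < e / (B + 1)" for y
    proof -
      have "\<bar>\<eta> y - \<eta> x\<bar> \<le> B * dist y x" by (rule \<eta>_lip)
      also have "\<dots> \<le> (B + 1) * dist y x" by (intro mult_right_mono) auto
      also have "\<dots> < e" using that \<open>0 \<le> B\<close> by (simp add: field_simps)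
      finally show ?thesis by (simp add: dist_real_def)
    qed
    then show "\<exists>d>0. \<forall>y\<in>UNIV. dist y x < d \<longrightarrow> dist (\<eta> y) (\<eta> x) < e"
      using \<open>0 < e\<close> \<open>0 \<le> B\<close> by (intro exI[of _ "e / (B + 1)"]) auto
  qed
  note [continuous_intros] = continuous_on_compose2[OF c\<eta>] continuous_on_compose2[OF continuous]
  obtain r where "0 < r" and r': "\<forall>x\<in>K. norm x \<le> r"
    using compact_imp_bounded[OF compact_support] unfolding bounded_pos by blast
  have r: "K \<subseteq> cball 0 r" using r' by auto
  \<comment> \<open>Shifts have length at most \<open>1\<close>, so all difference quotients of
    \<open>Y\<close> used below vanish outside this ball.\<close>
  let ?K1 = "cball (0::'a) (r + 1)"
  have shift_outside: "Y (x + s *\<^sub>R b) = 0" if "x \<notin> ?K1" "b \<in> Basis" "\<bar>s\<bar> \<le> 1" for x b s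
  proof (rule outside)
    have "norm x \<le> norm (x + s *\<^sub>R b) + norm (s *\<^sub>R b)" by (metis add_diff_cancel norm_triangle_ineq4)
    then have "norm (x + s *\<^sub>R b) > r" using that by simp
    then show "x + s *\<^sub>R b \<notin> K" using r by auto
  qed
  have Y_outside: "Y x = 0" if "x \<notin> ?K1" for x
    using r that by (intro outside) auto
  let ?A = "\<lambda>k x. \<Sum>b\<in>Basis. \<eta> x * ((Y (x + t k *\<^sub>R b) \<bullet> b - Y x \<bullet> b) / t k)"
  let ?B = "\<lambda>k x. \<Sum>b\<in>Basis. ((\<eta> (x - t k *\<^sub>R b) - \<eta> x) / t k) * (Y x \<bullet> b)"
  \<comment> \<open>Discrete integration by parts, exact at every step size.\<close>
  have AB: "(LINT x|lborel. ?A k x) = (LINT x|lborel. ?B k x)" for k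
  proof -
    have i1: "integrable lborel (\<lambda>x. \<eta> x * (Y (x + t k *\<^sub>R b) \<bullet> b))" if "b \<in> Basis" for b
      using shift_outside[OF _ that, of _ "t k"] t[of k]
      by (intro integrable_continuous_compact_support[of _ ?K1] continuous_intros) auto
    have i2: "integrable lborel (\<lambda>x. \<eta> x * (Y x \<bullet> b))" for b
      using Y_outside
      by (intro integrable_continuous_compact_support[of _ ?K1] continuous_intros) auto
    have i3: "integrable lborel (\<lambda>x. \<eta> (x - t k *\<^sub>R b) * (Y x \<bullet> b))" for b
      using Y_outside
      by (intro integrable_continuous_compact_support[of _ ?K1] continuous_intros) auto
    have tr: "(LINT x|lborel. \<eta> x * (Y (x + t k *\<^sub>R b) \<bullet> b))
        = (LINT x|lborel. \<eta> (x - t k *\<^sub>R b) * (Y x \<bullet> b))" for b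
      using lborel_integral_translate[OF borel_measurable_integrable[OF i3[of b], simplified], of "t k *\<^sub>R b"]
      by simp
    have "(LINT x|lborel. ?A k x)
        = (LINT x|lborel. (\<Sum>b\<in>Basis. (\<eta> x * (Y (x + t k *\<^sub>R b) \<bullet> b) - \<eta> x * (Y x \<bullet> b)) / t k))"
      by (intro Bochner_Integration.integral_cong sum.cong) (auto simp: algebra_simps)
    also have "\<dots> = (\<Sum>b\<in>Basis. ((LINT x|lborel. \<eta> x * (Y (x + t k *\<^sub>R b) \<bullet> b)) - (LINT x|lborel. \<eta> x * (Y x \<bullet> b))) / t k)"
      using i1 i2 by (simp add: Bochner_Integration.integral_sum)
    also have "\<dots> = (\<Sum>b\<in>Basis. ((LINT x|lborel. \<eta> (x - t k *\<^sub>R b) * (Y x \<bullet> b)) - (LINT x|lborel. \<eta> x * (Y x \<bullet> b))) / t k)"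
      by (simp only: tr)
    also have "\<dots> = (LINT x|lborel. (\<Sum>b\<in>Basis. (\<eta> (x - t k *\<^sub>R b) * (Y x \<bullet> b) - \<eta> x * (Y x \<bullet> b)) / t k))"
      using i3 i2 by (simp add: Bochner_Integration.integral_sum)
    also have "\<dots> = (LINT x|lborel. ?B k x)"
      by (intro Bochner_Integration.integral_cong sum.cong) (auto simp: algebra_simps)
    finally show ?thesis .
  qed
  have "\<forall>b. \<exists>C\<ge>0. \<forall>x t. \<bar>Y (x + t *\<^sub>R b) \<bullet> b - Y x \<bullet> b\<bar> \<le> C * \<bar>t\<bar>"
    using component_lipschitz by blast
  then obtain C where C: "\<And>b. 0 \<le> C b" "\<And>b x t. \<bar>Y (x + t *\<^sub>R b) \<bullet> b - Y x \<bullet> b\<bar> \<le> C b * \<bar>t\<bar>"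
    by metis
  have K1_int: "integrable lborel (\<lambda>x. c * indicator ?K1 x)" for c :: real
    using \<open>0 < r\<close> by (intro integrable_mult_right integrable_real_indicator) (auto simp: emeasure_cball)
  have limA: "(\<lambda>k. LINT x|lborel. ?A k x) \<longlonglongrightarrow> (LINT x|lborel. \<eta> x * divergence Y x)"
  proof (rule integral_dominated_convergence[where w = "\<lambda>x. (\<Sum>b\<in>Basis. C b) * indicator ?K1 x"])
    show "(\<lambda>x. \<eta> x * divergence Y x) \<in> borel_measurable lborel"
      using c\<eta> continuous_divergence
      by (simp add: borel_measurable_continuous_onI continuous_on_mult)
    show "?A k \<in> borel_measurable lborel" for k
      unfolding measurable_lborel1 measurable_lborel2
      by (intro borel_measurable_continuous_onI continuous_intros) (use t[of k] in auto)
    show "AE x in lborel. (\<lambda>k. ?A k x) \<longlonglongrightarrow> \<eta> x * divergence Y x"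
    proof (rule AE_I2)
      fix x
      show "(\<lambda>k. ?A k x) \<longlonglongrightarrow> \<eta> x * divergence Y x"
        unfolding divergence_def sum_distrib_left
        by (intro tendsto_sum tendsto_mult tendsto_const
            has_derivative_difference_quotient[OF component_has_derivative t_at(1)])
    qed
    show "AE x in lborel. norm (?A k x) \<le> (\<Sum>b\<in>Basis. C b) * indicator ?K1 x" for k
    proof (rule AE_I2)
      fix x
      have "\<bar>\<eta> x * ((Y (x + t k *\<^sub>R b) \<bullet> b - Y x \<bullet> b) / t k)\<bar> \<le> C b * indicator ?K1 x" if "b \<in> Basis" for b
      proof (cases "x \<in> ?K1")
        case True
        have "\<bar>(Y (x + t k *\<^sub>R b) \<bullet> b - Y x \<bullet> b) / t k\<bar> \<le> C b"
          using C(2)[of x "t k" b] t[of k] by (simp add: field_simps)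
        then have "\<bar>\<eta> x\<bar> * \<bar>(Y (x + t k *\<^sub>R b) \<bullet> b - Y x \<bullet> b) / t k\<bar> \<le> 1 * C b"
          using \<eta>_bd by (intro mult_mono) auto
        with True show ?thesis by (simp add: abs_mult)
      next
        case False
        with shift_outside[OF False that, of "t k"] Y_outside[OF False] t[of k] show ?thesis by simp
      qed
      then show "norm (?A k x) \<le> (\<Sum>b\<in>Basis. C b) * indicator ?K1 x"
        unfolding sum_distrib_right real_norm_def by (intro sum_abs[THEN order_trans] sum_mono)
    qed
  qed (rule K1_int)
  have limB: "(\<lambda>k. LINT x|lborel. ?B k x) \<longlonglongrightarrow> (LINT x|lborel. g x)"
  proof (rule integral_dominated_convergence[where w = "\<lambda>x. (\<Sum>b\<in>(Basis::'a set). B) * indicator ?K1 x"])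
    show "?B k \<in> borel_measurable lborel" for k
      unfolding measurable_lborel1 measurable_lborel2
      by (intro borel_measurable_continuous_onI continuous_intros) (use t[of k] in auto)
    show "AE x in lborel. (\<lambda>k. ?B k x) \<longlonglongrightarrow> g x"
      using deriv g_eq
    proof eventually_elim
      fix x assume d: "(\<eta> has_derivative \<eta>' x) (at x)" and gx: "g x = - \<eta>' x (Y x)"
      have "\<eta>' x (Y x) = (\<Sum>b\<in>Basis. \<eta>' x b * (Y x \<bullet> b))"
      proof -
        have "linear (\<eta>' x)" by (rule has_derivative_linear[OF d])
        then have "\<eta>' x (\<Sum>b\<in>Basis. (Y x \<bullet> b) *\<^sub>R b) = (\<Sum>b\<in>Basis. (Y x \<bullet> b) * \<eta>' x b)"
          by (simp add: linear_sum linear_cmul)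
        then show ?thesis by (simp add: euclidean_representation mult.commute)
      qed
      then have "g x = (\<Sum>b\<in>Basis. - \<eta>' x b * (Y x \<bullet> b))"
        by (simp add: gx sum_negf)
      moreover have "(\<lambda>k. (\<eta> (x - t k *\<^sub>R b) - \<eta> x) / t k) \<longlonglongrightarrow> - \<eta>' x b" for b
        using tendsto_minus[OF has_derivative_difference_quotient[OF d t_at(2), of b]]
        by simp
      ultimately show "(\<lambda>k. ?B k x) \<longlonglongrightarrow> g x"
        by (simp only:) (intro tendsto_sum tendsto_mult tendsto_const)
    qed
    show "AE x in lborel. norm (?B k x) \<le> (\<Sum>b\<in>(Basis::'a set). B) * indicator ?K1 x" for k
    proof (rule AE_I2)
      fix x
      have "\<bar>((\<eta> (x - t k *\<^sub>R b) - \<eta> x) / t k) * (Y x \<bullet> b)\<bar> \<le> B * indicator ?K1 x" if "b \<in> Basis" for b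
      proof (cases "x \<in> ?K1")
        case True
        have "\<bar>(\<eta> (x - t k *\<^sub>R b) - \<eta> x) / t k\<bar> \<le> B"
          using \<eta>_lip[of "x - t k *\<^sub>R b" x] t[of k] that by (simp add: dist_norm field_simps)
        moreover have "\<bar>Y x \<bullet> b\<bar> \<le> 1"
          using norm_le_1[of x] Basis_le_norm[OF that, of "Y x"] by simp
        ultimately have "\<bar>(\<eta> (x - t k *\<^sub>R b) - \<eta> x) / t k\<bar> * \<bar>Y x \<bullet> b\<bar> \<le> B * 1"
          using \<open>0 \<le> B\<close> by (intro mult_mono) auto
        with True show ?thesis by (simp add: abs_mult)
      qed (simp add: Y_outside)
      then show "norm (?B k x) \<le> (\<Sum>b\<in>(Basis::'a set). B) * indicator ?K1 x"
        unfolding sum_distrib_right real_norm_def by (intro sum_abs[THEN order_trans] sum_mono)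
    qed
  qed (use K1_int in auto)
  show ?thesis
    using LIMSEQ_unique[OF limA] limB by (simp only: AB)
qed

text \<open>The indicator of the ball is replaced by a cutoff falling linearly from \<open>1\<close>
  to \<open>0\<close> across the annulus. Its gradient has length \<open>1 / \<epsilon>\<close>
  there and \<open>Y\<close> vanishes off \<open>M\<close>, which gives the first term; the second
  pays for the replacement.\<close>

lemma integral_divergence_ball_le:
  assumes M: "M \<in> sets borel" "\<And>x. x \<notin> M \<Longrightarrow> Y x = 0" and "0 < R" "0 < \<epsilon>"
    and C: "\<And>x. \<bar>divergence Y x\<bar> \<le> C"
  shows "(LINT x:ball q R|lborel. divergence Y x)
    \<le> measure lborel (M \<inter> (ball q (R + \<epsilon>) - ball q R)) / \<epsilon> + C * measure lborel (ball q (R + \<epsilon>) - ball q R)"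
proof -
  define \<eta> where "\<eta> x = max 0 (min 1 ((R + \<epsilon> - dist x q) / \<epsilon>))" for x
  define \<eta>' where "\<eta>' x v = (if R < dist x q \<and> dist x q < R + \<epsilon> then - (sgn (x - q) \<bullet> v) / \<epsilon> else 0)" for x v
  define g where "g x = - \<eta>' x (Y x)" for x
  let ?A = "ball q (R + \<epsilon>) - ball q R"
  have \<eta>_in: "\<eta> x = 1" if "dist x q \<le> R" for x
    using that \<open>0 < \<epsilon>\<close> by (simp add: \<eta>_def min_def max_def field_simps)
  have \<eta>_out: "\<eta> x = 0" if "R + \<epsilon> \<le> dist x q" for x
    using that \<open>0 < \<epsilon>\<close> by (simp add: \<eta>_def min_def max_def field_simps)
  have \<eta>_mid: "\<eta> x = (R + \<epsilon> - norm (x - q)) / \<epsilon>" if "R \<le> dist x q" "dist x q \<le> R + \<epsilon>" for x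
    using that \<open>0 < \<epsilon>\<close> by (simp add: \<eta>_def min_def max_def field_simps dist_norm)
  have \<eta>_bd: "0 \<le> \<eta> x" "\<eta> x \<le> 1" for x by (auto simp: \<eta>_def)
  have deriv: "(\<eta> has_derivative \<eta>' x) (at x)" if x: "dist x q \<noteq> R" "dist x q \<noteq> R + \<epsilon>" for x
  proof -
    consider "dist x q < R" | "R < dist x q" "dist x q < R + \<epsilon>" | "R + \<epsilon> < dist x q"
      using x by linarith
    then show ?thesis
    proof cases
      case 1
      have "((\<lambda>_. 1) has_derivative (\<lambda>_. 0)) (at x)" by simp
      then have "(\<eta> has_derivative (\<lambda>_. 0)) (at x)"
        by (rule has_derivative_transform_within_open[of _ _ _ _ "ball q R"])
          (use 1 \<eta>_in in \<open>auto simp: dist_commute\<close>)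
      moreover have "\<eta>' x = (\<lambda>_. 0)" using 1 by (auto simp: \<eta>'_def)
      ultimately show ?thesis by simp
    next
      case 2
      then have "x - q \<noteq> 0" using \<open>0 < R\<close> by auto
      have "((\<lambda>y. y - q) has_derivative (\<lambda>v. v)) (at x)"
        by (auto intro!: derivative_eq_intros)
      from has_derivative_compose[OF this has_derivative_norm[OF \<open>x - q \<noteq> 0\<close>]]
      have "((\<lambda>y. norm (y - q)) has_derivative (\<lambda>v. sgn (x - q) \<bullet> v)) (at x)"
        by (simp only: inner_commute)
      then have "((\<lambda>y. (R + \<epsilon> - norm (y - q)) / \<epsilon>) has_derivative (\<lambda>v. - (sgn (x - q) \<bullet> v) / \<epsilon>)) (at x)"
        using \<open>0 < \<epsilon>\<close> by (auto intro!: derivative_eq_intros)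
      then have "(\<eta> has_derivative (\<lambda>v. - (sgn (x - q) \<bullet> v) / \<epsilon>)) (at x)"
        by (rule has_derivative_transform_within_open[of _ _ _ _ "ball q (R + \<epsilon>) - cball q R"])
          (use 2 \<eta>_mid in \<open>auto simp: dist_commute\<close>)
      moreover have "\<eta>' x = (\<lambda>v. - (sgn (x - q) \<bullet> v) / \<epsilon>)" using 2 by (auto simp: \<eta>'_def)
      ultimately show ?thesis by simp
    next
      case 3
      have "((\<lambda>_. 0) has_derivative (\<lambda>_. 0)) (at x)" by simp
      then have "(\<eta> has_derivative (\<lambda>_. 0)) (at x)"
        by (rule has_derivative_transform_within_open[of _ _ _ _ "- cball q (R + \<epsilon>)"])
          (use 3 \<eta>_out in \<open>auto simp: dist_commute\<close>)
      moreover have "\<eta>' x = (\<lambda>_. 0)" using 3 by (auto simp: \<eta>'_def)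
      ultimately show ?thesis by simp
    qed
  qed
  have ae: "AE x in lborel. dist x q \<noteq> R \<and> dist x q \<noteq> R + \<epsilon>"
  proof (rule AE_I')
    show "sphere q R \<union> sphere q (R + \<epsilon>) \<in> null_sets lborel"
      using negligible_sphere[of q R] negligible_sphere[of q "R + \<epsilon>"]
      by (intro null_sets.Un) (auto simp: null_sets_completion_iff negligible_iff_null_sets)
  qed (auto simp: dist_commute)
  have lip: "\<bar>\<eta> x - \<eta> y\<bar> \<le> (1 / \<epsilon>) * dist x y" for x y
  proof -
    have "\<bar>\<eta> x - \<eta> y\<bar> \<le> \<bar>(R + \<epsilon> - dist x q) / \<epsilon> - (R + \<epsilon> - dist y q) / \<epsilon>\<bar>"
      unfolding \<eta>_def by (auto simp: max_def min_def)
    also have "\<dots> = \<bar>dist x q - dist y q\<bar> / \<epsilon>"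
      using \<open>0 < \<epsilon>\<close> by (simp add: diff_divide_distrib[symmetric] abs_minus_commute)
    also have "\<dots> \<le> dist x y / \<epsilon>"
      using \<open>0 < \<epsilon>\<close> dist_triangle[of x q y] dist_triangle[of y q x]
      by (intro divide_right_mono) (auto simp: dist_commute abs_le_iff)
    finally show ?thesis by simp
  qed
  have cY: "Y \<in> borel_measurable borel" using continuous by (rule borel_measurable_continuous_onI)
  have [measurable]: "g \<in> borel_measurable borel"
    unfolding g_def \<eta>'_def sgn_div_norm using cY by measurable
  have [measurable]: "divergence Y \<in> borel_measurable borel"
    using continuous_divergence by (rule borel_measurable_continuous_onI)
  have [measurable]: "\<eta> \<in> borel_measurable borel" unfolding \<eta>_def by measurable
  have main: "(LINT x|lborel. \<eta> x * divergence Y x) = (LINT x|lborel. g x)"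
  proof (rule integral_cutoff_divergence[OF lip])
    show "\<bar>\<eta> x\<bar> \<le> 1" for x using \<eta>_bd[of x] by simp
    show "AE x in lborel. (\<eta> has_derivative \<eta>' x) (at x)"
      using ae by eventually_elim (rule deriv, auto)
    show "AE x in lborel. g x = - \<eta>' x (Y x)" by (simp add: g_def)
    show "0 \<le> 1 / \<epsilon>" using \<open>0 < \<epsilon>\<close> by simp
  qed measurable
  have fin: "emeasure lborel (M \<inter> ?A) < \<infinity>" "emeasure lborel ?A < \<infinity>"
  proof -
    have "bounded ?A" by (rule bounded_subset[OF bounded_ball[of q "R + \<epsilon>"]]) auto
    then show "emeasure lborel ?A < \<infinity>" by (rule emeasure_bounded_finite)
    from \<open>bounded ?A\<close> have "bounded (M \<inter> ?A)" by (rule bounded_subset) auto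
    then show "emeasure lborel (M \<inter> ?A) < \<infinity>" by (rule emeasure_bounded_finite)
  qed
  have "g x \<le> indicator (M \<inter> ?A) x / \<epsilon>" for x
  proof (cases "x \<in> M \<and> R < dist x q \<and> dist x q < R + \<epsilon>")
    case True
    have "sgn (x - q) \<bullet> Y x \<le> norm (sgn (x - q)) * norm (Y x)" by (rule norm_cauchy_schwarz)
    also have "\<dots> \<le> 1 * 1" using norm_le_1 by (intro mult_mono) (auto simp: norm_sgn)
    finally have "sgn (x - q) \<bullet> Y x / \<epsilon> \<le> 1 / \<epsilon>"
      using \<open>0 < \<epsilon>\<close> by (intro divide_right_mono) auto
    with True show ?thesis by (simp add: g_def \<eta>'_def dist_commute)
  next
    case False
    then have "g x = 0" using M(2)[of x] by (auto simp: g_def \<eta>'_def)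
    then show ?thesis using \<open>0 < \<epsilon>\<close> by simp
  qed
  moreover have "integrable lborel (\<lambda>x. indicator (M \<inter> ?A) x / \<epsilon> :: real)"
    using fin M(1) by (intro integrable_divide integrable_real_indicator) auto
  moreover have "integrable lborel g"
  proof (rule Bochner_Integration.integrable_bound)
    show "integrable lborel (\<lambda>x. indicator (M \<inter> ?A) x / \<epsilon> :: real)" by fact
    show "AE x in lborel. norm (g x) \<le> norm (indicator (M \<inter> ?A) x / \<epsilon> :: real)"
    proof (rule AE_I2)
      fix x
      show "norm (g x) \<le> norm (indicator (M \<inter> ?A) x / \<epsilon> :: real)"
      proof (cases "x \<in> M \<and> R < dist x q \<and> dist x q < R + \<epsilon>")
        case True
        have "\<bar>sgn (x - q) \<bullet> Y x\<bar> \<le> norm (sgn (x - q)) * norm (Y x)" by (rule Cauchy_Schwarz_ineq2)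
        also have "\<dots> \<le> 1 * 1" using norm_le_1 by (intro mult_mono) (auto simp: norm_sgn)
        finally have "\<bar>sgn (x - q) \<bullet> Y x\<bar> / \<epsilon> \<le> 1 / \<epsilon>"
          using \<open>0 < \<epsilon>\<close> by (intro divide_right_mono) auto
        with True \<open>0 < \<epsilon>\<close> show ?thesis by (simp add: g_def \<eta>'_def dist_commute)
      next
        case False
        then have "g x = 0" using M(2)[of x] by (auto simp: g_def \<eta>'_def)
        then show ?thesis by simp
      qed
    qed
  qed auto
  ultimately have "(LINT x|lborel. g x) \<le> (LINT x|lborel. indicator (M \<inter> ?A) x / \<epsilon>)"
    by (intro integral_mono)
  also have "\<dots> = measure lborel (M \<inter> ?A) / \<epsilon>"
    using M(1) by simp
  finally have 1: "(LINT x|lborel. \<eta> x * divergence Y x) \<le> measure lborel (M \<inter> ?A) / \<epsilon>"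
    by (simp only: main)
  have int: "integrable lborel (divergence Y)"
    using continuous_divergence compact_support divergence_outside
    by (rule integrable_continuous_compact_support)
  have i1: "integrable lborel (\<lambda>x. indicator (ball q R) x * divergence Y x)"
    by (rule Bochner_Integration.integrable_bound[OF int]) (auto simp: indicator_def)
  have i2: "integrable lborel (\<lambda>x. \<eta> x * divergence Y x)"
    by (rule Bochner_Integration.integrable_bound[OF int])
      (use \<eta>_bd in \<open>auto simp: abs_mult intro!: mult_left_le_one_le\<close>)
  have i3: "integrable lborel (\<lambda>x. C * indicator ?A x)"
    using fin by (intro integrable_mult_right integrable_real_indicator) auto
  have "(LINT x:ball q R|lborel. divergence Y x)
      \<le> (LINT x|lborel. \<eta> x * divergence Y x + C * indicator ?A x)"
    unfolding set_lebesgue_integral_def real_scaleR_def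
  proof (rule integral_mono[OF i1])
    show "integrable lborel (\<lambda>x. \<eta> x * divergence Y x + C * indicator ?A x)"
      using i2 i3 by simp
    fix x
    consider "dist x q < R" | "R \<le> dist x q" "dist x q < R + \<epsilon>" | "R + \<epsilon> \<le> dist x q"
      by linarith
    then show "indicator (ball q R) x * divergence Y x \<le> \<eta> x * divergence Y x + C * indicator ?A x"
    proof cases
      case 1
      then show ?thesis using \<eta>_in[of x] by (simp add: dist_commute)
    next
      case 2
      have "\<bar>\<eta> x * divergence Y x\<bar> \<le> 1 * C"
        unfolding abs_mult using \<eta>_bd[of x] C[of x] by (intro mult_mono) auto
      with 2 show ?thesis by (simp add: dist_commute)
    next
      case 3
      then show ?thesis using \<eta>_out[of x] \<open>0 < \<epsilon>\<close> by (simp add: dist_commute)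
    qed
  qed
  also have "\<dots> = (LINT x|lborel. \<eta> x * divergence Y x) + C * measure lborel ?A"
    using i2 i3 by (subst Bochner_Integration.integral_add) auto
  finally show ?thesis using 1 by simp
qed

end

section \<open>From test fields to the perimeter\<close>

text \<open>The derivative is continuous on \<open>M\<close> and zero off the support; these two
  open sets cover the space.\<close>

lemma admissible_smooth_compact_field:
  assumes "open M" and Y: "Y \<in> admissible_fields M"
  shows "smooth_compact_field Y (closure {x. Y x \<noteq> 0})"
proof
  let ?K = "closure {x. Y x \<noteq> 0}"
  have smooth: "times_differentiable_on (Suc 0) Y M" and K: "compact ?K" "?K \<subseteq> M"
    using Y by (auto simp: admissible_fields_def smooth_on_def simp del: times_differentiable_on.simps)
  show "norm (Y x) \<le> 1" for x using Y by (auto simp: admissible_fields_def)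
  show "compact ?K" by fact
  show out: "Y x = 0" if "x \<notin> ?K" for x
    using that closure_subset[of "{x. Y x \<noteq> 0}"] by auto
  have zero: "(Y has_derivative (\<lambda>_. 0)) (at x)" if "x \<notin> ?K" for x
  proof (rule has_derivative_transform_within_open[of "\<lambda>_. 0" _ _ _ "- ?K"])
    show "open (- ?K)" using closed_closure by (rule open_Compl)
    show "((\<lambda>_. 0) has_derivative (\<lambda>_. 0)) (at x)" by (rule has_derivative_const)
    show "x \<in> - ?K" using that by (simp only: Compl_iff not_False_eq_True)
    show "0 = Y y" if y: "y \<in> - ?K" for y
    proof -
      from y have "y \<notin> ?K" by (simp only: Compl_iff not_False_eq_True)
      from out[OF this] show ?thesis by (rule sym)
    qed
  qed
  show zero': "frechet_derivative Y (at x) v = 0" if "x \<notin> ?K" for x v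
    by (simp flip: frechet_derivative_at[OF zero[OF that]])
  show "Y differentiable (at x)" for x
  proof (cases "x \<in> M")
    case True
    with smooth show ?thesis by simp
  next
    case False
    then have "x \<notin> ?K" using K(2) by blast
    from zero[OF this] show ?thesis unfolding differentiable_def by blast
  qed
  show "continuous_on UNIV (\<lambda>x. frechet_derivative Y (at x) v)" for v
  proof -
    have "continuous_on (- ?K) (\<lambda>x. frechet_derivative Y (at x) v)"
      by (rule continuous_on_eq[OF continuous_on_const[of _ 0]])
        (simp only: zero' Compl_iff not_False_eq_True)
    moreover have "continuous_on M (\<lambda>x. frechet_derivative Y (at x) v)"
      using smooth by simp
    ultimately have "continuous_on (M \<union> - ?K) (\<lambda>x. frechet_derivative Y (at x) v)"
      using \<open>open M\<close> closed_closure by (intro continuous_on_open_Un) (auto simp: open_Compl)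
    moreover have "M \<union> - ?K = UNIV" using K(2) by auto
    ultimately show ?thesis by simp
  qed
qed

text \<open>The supremum is tested one field at a time, and the cutoff estimate holds for every
  \<open>\<epsilon>\<close>. Hence arbitrarily small increments with a good quotient are enough,
  however the others behave.\<close>

lemma relative_perimeter_ball_le:
  fixes M :: "'a::euclidean_space set"
  assumes "open M" "0 < R"
    and slope: "\<And>\<beta>' \<epsilon>0. \<beta> < \<beta>' \<Longrightarrow> 0 < \<epsilon>0 \<Longrightarrow> \<exists>\<epsilon>. 0 < \<epsilon> \<and> \<epsilon> < \<epsilon>0 \<and>
      measure lborel (M \<inter> ball q (R + \<epsilon>)) - measure lborel (M \<inter> ball q R) \<le> \<beta>' * \<epsilon>"
  shows "relative_perimeter M (M \<inter> ball q R) \<le> ereal \<beta>"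
  unfolding relative_perimeter_def
proof (rule SUP_least)
  fix Y assume Y: "Y \<in> admissible_fields M"
  interpret smooth_compact_field Y "closure {x. Y x \<noteq> 0}"
    by (rule admissible_smooth_compact_field) fact+
  have KM: "closure {x. Y x \<noteq> 0} \<subseteq> M" using Y by (auto simp: admissible_fields_def)
  obtain C where C: "\<And>x. \<bar>divergence Y x\<bar> \<le> C" using bounded_divergence by blast
  have "0 \<le> C" using C abs_ge_zero order_trans by blast
  have [measurable]: "divergence Y \<in> borel_measurable borel"
    using continuous_divergence by (rule borel_measurable_continuous_onI)
  have [measurable]: "M \<in> sets borel" using \<open>open M\<close> by simp
  have "(LINT x:M \<inter> ball q R|vol_measure. divergence Y x) = (LINT x:M \<inter> ball q R|lborel. divergence Y x)"
    by (rule set_integral_vol_measure) auto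
  also have "\<dots> = (LINT x:ball q R|lborel. divergence Y x)"
    unfolding set_lebesgue_integral_def
  proof (intro Bochner_Integration.integral_cong refl)
    fix x
    show "indicator (M \<inter> ball q R) x *\<^sub>R divergence Y x = indicator (ball q R) x *\<^sub>R divergence Y x"
      using KM divergence_outside[of x] by (cases "x \<in> M") (auto simp: indicator_def)
  qed
  finally have eq: "(LINT x:M \<inter> ball q R|vol_measure. divergence Y x) = (LINT x:ball q R|lborel. divergence Y x)" .
  have "(LINT x:ball q R|lborel. divergence Y x) \<le> \<beta> + e" if "0 < e" for e
  proof -
    let ?\<omega> = "unit_ball_vol (real DIM('a))"
    \<comment> \<open>\<open>C\<close> depends on the field but not on \<open>\<epsilon>\<close>, so
      the replacement error is made small before a good increment is selected.\<close>
    have "((\<lambda>\<epsilon>. C * (?\<omega> * (R + \<epsilon>) ^ DIM('a) - ?\<omega> * R ^ DIM('a))) \<longlongrightarrow>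
        C * (?\<omega> * (R + 0) ^ DIM('a) - ?\<omega> * R ^ DIM('a))) (at_right 0)"
      by (intro tendsto_intros)
    then have "\<forall>\<^sub>F \<epsilon> in at_right 0. C * (?\<omega> * (R + \<epsilon>) ^ DIM('a) - ?\<omega> * R ^ DIM('a)) < e / 2"
      using \<open>0 < e\<close> by (intro order_tendstoD(2)) auto
    then obtain \<epsilon>0 where \<epsilon>0: "0 < \<epsilon>0"
      "\<And>\<epsilon>. 0 < \<epsilon> \<Longrightarrow> \<epsilon> < \<epsilon>0 \<Longrightarrow> C * (?\<omega> * (R + \<epsilon>) ^ DIM('a) - ?\<omega> * R ^ DIM('a)) < e / 2"
      unfolding eventually_at_right_field by auto
    obtain \<epsilon> where \<epsilon>: "0 < \<epsilon>" "\<epsilon> < \<epsilon>0"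
      "measure lborel (M \<inter> ball q (R + \<epsilon>)) - measure lborel (M \<inter> ball q R) \<le> (\<beta> + e / 2) * \<epsilon>"
      using slope[of "\<beta> + e / 2" \<epsilon>0] \<open>0 < e\<close> \<epsilon>0(1) by auto
    have fm: "ball q r \<in> fmeasurable lborel" "M \<inter> ball q r \<in> fmeasurable lborel" for r
      using emeasure_bounded_finite[of "ball q r"] emeasure_bounded_finite[of "M \<inter> ball q r"]
      by (auto simp: fmeasurable_def bounded_Int)
    have "measure lborel (M \<inter> (ball q (R + \<epsilon>) - ball q R)) = measure lborel (M \<inter> ball q (R + \<epsilon>) - M \<inter> ball q R)"
      by (intro arg_cong[where f = "measure lborel"]) auto
    also have "\<dots> = measure lborel (M \<inter> ball q (R + \<epsilon>)) - measure lborel (M \<inter> ball q R)"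
      using \<epsilon>(1) fm by (intro measurable_measure_Diff) (auto simp: fmeasurable_def)
    finally have "measure lborel (M \<inter> (ball q (R + \<epsilon>) - ball q R)) / \<epsilon> \<le> \<beta> + e / 2"
      using \<epsilon> by (simp add: field_simps)
    moreover have annulus: "measure lborel (ball q (R + \<epsilon>) - ball q R) = ?\<omega> * (R + \<epsilon>) ^ DIM('a) - ?\<omega> * R ^ DIM('a)"
      using \<epsilon>(1) fm \<open>0 < R\<close>
      by (subst measurable_measure_Diff) (auto simp: fmeasurable_def content_ball)
    moreover have "(LINT x:ball q R|lborel. divergence Y x)
        \<le> measure lborel (M \<inter> (ball q (R + \<epsilon>) - ball q R)) / \<epsilon> + C * measure lborel (ball q (R + \<epsilon>) - ball q R)"
    proof (rule integral_divergence_ball_le)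
      show "Y x = 0" if "x \<notin> M" for x using that KM by (intro outside) blast
    qed (use \<epsilon>(1) \<open>0 < R\<close> C in auto)
    moreover have "C * measure lborel (ball q (R + \<epsilon>) - ball q R) < e / 2"
      unfolding annulus by (rule \<epsilon>0(2)[OF \<epsilon>(1,2)])
    ultimately show ?thesis by linarith
  qed
  then have "(LINT x:ball q R|lborel. divergence Y x) \<le> \<beta>"
    by (rule field_le_epsilon)
  then show "ereal (LINT x:M \<inter> ball q R|vol_measure. divergence Y x) \<le> ereal \<beta>"
    by (simp add: eq)
qed

section \<open>Density of a cone at a boundary point\<close>

lemma mem_cone_over:
  assumes "C \<subseteq> unit_sphere"
  shows "x \<in> cone_over C \<longleftrightarrow> x \<noteq> 0 \<and> x /\<^sub>R norm x \<in> C"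
proof
  assume "x \<in> cone_over C"
  then obtain t p where "x = t *\<^sub>R p" "0 < t" "p \<in> C" by (auto simp: cone_over_def)
  moreover have "norm p = 1" using \<open>p \<in> C\<close> assms by auto
  ultimately show "x \<noteq> 0 \<and> x /\<^sub>R norm x \<in> C" by auto
next
  assume "x \<noteq> 0 \<and> x /\<^sub>R norm x \<in> C"
  then show "x \<in> cone_over C"
    unfolding cone_over_def by (intro CollectI exI[of _ "norm x"] exI[of _ "x /\<^sub>R norm x"]) auto
qed

lemma open_normalize_preimage:
  fixes T :: "'a::euclidean_space set"
  assumes "open T"
  shows "open {x \<in> - {0}. x /\<^sub>R norm x \<in> T}"
proof -
  have "continuous_on (- {0::'a}) (\<lambda>x. x /\<^sub>R norm x)"
    by (intro continuous_intros) auto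
  from continuous_open_preimage[OF this _ assms] show ?thesis
    by (simp add: vimage_def Int_def open_Compl)
qed

lemma open_cone_over:
  fixes C :: "'a::euclidean_space set"
  assumes "openin (top_of_set unit_sphere) C"
  shows "open (cone_over C)"
proof -
  obtain T where T: "open T" "C = unit_sphere \<inter> T" using assms by (auto simp: openin_open)
  have "open {x \<in> - {0::'a}. x /\<^sub>R norm x \<in> T}"
    by (rule open_normalize_preimage) fact
  moreover have "cone_over C = {x \<in> - {0}. x /\<^sub>R norm x \<in> T}"
    by (auto simp: mem_cone_over T(2))
  ultimately show ?thesis by simp
qed

lemma scaleR_mem_cone_over_iff:
  assumes "C \<subseteq> unit_sphere" "0 < t"
  shows "t *\<^sub>R x \<in> cone_over C \<longleftrightarrow> x \<in> cone_over C"
proof -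
  have "(t *\<^sub>R x) /\<^sub>R norm (t *\<^sub>R x) = x /\<^sub>R norm x"
    using assms(2) by (simp add: field_simps)
  then show ?thesis using assms by (simp only: mem_cone_over) simp
qed

lemma has_derivative_normalize:
  fixes p :: "'a::euclidean_space"
  assumes "norm p = 1"
  shows "((\<lambda>x. x /\<^sub>R norm x) has_derivative (\<lambda>v. v - (v \<bullet> p) *\<^sub>R p)) (at p)"
proof -
  have "p \<noteq> 0" using assms by auto
  note has_derivative_norm[OF this, derivative_intros]
  show ?thesis
    using \<open>p \<noteq> 0\<close> assms
    by (auto intro!: derivative_eq_intros simp: sgn_div_norm fun_eq_iff)
qed

section \<open>Blow-up at a boundary point\<close>

text \<open>The map \<open>x \<mapsto> - x\<close> exchanges the two open halves, and the hyperplane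
  between them is null.\<close>

lemma measure_ball_half_space:
  fixes a :: "'a::euclidean_space"
  assumes "a \<noteq> 0"
  shows "measure lborel (ball 0 1 \<inter> {x. a \<bullet> x < 0}) = unit_ball_vol (real DIM('a)) / 2"
proof -
  let ?H = "ball 0 1 \<inter> {x. a \<bullet> x < 0}" and ?H' = "ball 0 1 \<inter> {x. a \<bullet> x > 0}" and ?Z = "{x. a \<bullet> x = 0}"
  have m [measurable]: "?H \<in> sets borel" "?H' \<in> sets borel" by measurable
  have b: "bounded ?H" "bounded ?H'" by (auto intro: bounded_Int)
  have fm: "?H \<in> fmeasurable lborel" "?H' \<in> fmeasurable lborel"
    using emeasure_bounded_finite[OF b(1)] emeasure_bounded_finite[OF b(2)] by (auto simp: fmeasurable_def)
  have "?H' = (\<lambda>x. (-1) *\<^sub>R x + 0) ` ?H"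
    by (auto simp: image_iff intro!: bexI[of _ "- _"]) 
  then have "measure lebesgue ?H' = measure lebesgue ?H"
    by (simp only: measure_lebesgue_affine) simp
  then have eq: "measure lborel ?H' = measure lborel ?H" by simp
  have Z: "?Z \<in> null_sets lborel"
    using negligible_hyperplane[of a 0] assms
    by (auto simp: null_sets_completion_iff negligible_iff_null_sets)
  have "unit_ball_vol (real DIM('a)) = measure lborel (ball (0::'a) 1)"
    by (simp add: content_ball)
  also have "\<dots> = measure lborel (ball (0::'a) 1 - ?Z)"
    using Z by (intro measure_Diff_null_set[symmetric]) auto
  also have "ball (0::'a) 1 - ?Z = ?H \<union> ?H'" by auto
  also have "measure lborel (?H \<union> ?H') = measure lborel ?H + measure lborel ?H'"
    using fm by (intro measure_Un_AE) (auto simp: fmeasurable_def intro!: measure_Union)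
  finally show ?thesis using eq by simp
qed

text \<open>Composing the local defining function of \<open>C\<close> with
  \<open>x /\<^sub>R norm x\<close> gives a function that is constant on rays and whose negative set
  is the cone near \<open>p\<close>.\<close>

lemma boundary_point_derivative:
  fixes C :: "'a::euclidean_space set"
  assumes C: "openin (top_of_set unit_sphere) C" and "smooth_boundary C" and p: "p \<in> sphere_boundary C"
  obtains U and G :: "'a \<Rightarrow> real" and D where "open U" "p \<in> U" "G p = 0" "(G has_derivative D) (at p)"
    "\<And>x. x \<in> U \<Longrightarrow> x \<in> cone_over C \<longleftrightarrow> G x < 0" "\<exists>v. D v \<noteq> 0"
proof -
  have CS: "C \<subseteq> unit_sphere" using openin_imp_subset[OF C] .
  have p': "p \<in> unit_sphere" "p \<notin> C" "\<And>T. p \<in> T \<Longrightarrow> openin (top_of_set unit_sphere) T \<Longrightarrow> \<exists>y\<in>C. y \<in> T"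
    using p interior_of_openin[OF C]
    by (auto simp: sphere_boundary_def frontier_of_def in_closure_of)
  then have np: "norm p = 1" by simp
  then have "p \<noteq> 0" by auto
  obtain U and f :: "'a \<Rightarrow> real" where Uf: "open U \<and> p \<in> U \<and> smooth_on f U \<and>
      C \<inter> U = {x \<in> unit_sphere \<inter> U. f x < 0} \<and>
      (\<forall>x \<in> unit_sphere \<inter> U. f x = 0 \<longrightarrow> (\<exists>v. v \<bullet> x = 0 \<and> frechet_derivative f (at x) v \<noteq> 0))"
    using bspec[OF assms(2)[unfolded smooth_boundary_def] p] by (elim exE) (rule that)
  then have U: "open U" "p \<in> U" and f: "smooth_on f U"
    and CU: "C \<inter> U = {x \<in> unit_sphere \<inter> U. f x < 0}"
    and reg: "\<And>x. x \<in> unit_sphere \<inter> U \<Longrightarrow> f x = 0 \<Longrightarrow>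
      \<exists>v. v \<bullet> x = 0 \<and> frechet_derivative f (at x) v \<noteq> 0"
    by simp_all
  have "times_differentiable_on (Suc 0) f U" using f unfolding smooth_on_def by blast
  then have diff: "\<And>x. x \<in> U \<Longrightarrow> f differentiable (at x)" by simp
  then have cont: "continuous_on U f"
    by (meson continuous_at_imp_continuous_on differentiable_imp_continuous_within)
  \<comment> \<open>\<open>C\<close> is relatively open, so its frontier point \<open>p\<close> is
    not in \<open>C\<close> and \<open>f p\<close> is not negative; points of \<open>C\<close>
    arbitrarily close to \<open>p\<close> exclude a positive value.\<close>
  have f0: "f p = 0"
  proof (rule antisym)
    show "0 \<le> f p"
    proof (rule ccontr)
      assume "\<not> 0 \<le> f p"
      then have "p \<in> C \<inter> U" unfolding CU using U(2) p'(1) by simp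
      with p'(2) show False by simp
    qed
    show "f p \<le> 0"
    proof (rule ccontr)
      assume "\<not> f p \<le> 0"
      define V where "V = {x \<in> U. 0 < f x}"
      have "open V"
        using continuous_open_preimage[OF cont U(1), of "{0<..}"]
        by (simp add: V_def vimage_def Int_def)
      then have "openin (top_of_set unit_sphere) (unit_sphere \<inter> V)" by (rule openin_open_Int)
      moreover have "p \<in> unit_sphere \<inter> V" using \<open>\<not> f p \<le> 0\<close> U(2) p' by (simp add: V_def)
      ultimately obtain y where "y \<in> C" "y \<in> V" using p'(3) by blast
      then have "y \<in> C \<inter> U" "0 < f y" by (auto simp: V_def)
      then show False unfolding CU by simp
    qed
  qed
  let ?\<nu> = "\<lambda>x::'a. x /\<^sub>R norm x"
  have nu_p: "?\<nu> p = p" using np by simp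
  define W where "W = {x \<in> - {0}. ?\<nu> x \<in> U}"
  \<comment> \<open>The tangential projection fixes the tangent vector supplied by the regularity
    condition, so \<open>D\<close> is nonzero on it.\<close>
  define D where "D v = frechet_derivative f (at p) (v - (v \<bullet> p) *\<^sub>R p)" for v
  show thesis
  proof (rule that)
    show "open W" unfolding W_def by (rule open_normalize_preimage) fact
    show "p \<in> W" using U(2) nu_p \<open>p \<noteq> 0\<close> by (simp add: W_def)
    show "f (?\<nu> p) = 0" by (simp only: nu_p f0)
    have "(f has_derivative frechet_derivative f (at p)) (at (?\<nu> p))"
      unfolding nu_p using diff[OF U(2)] by (simp only: frechet_derivative_works)
    from has_derivative_compose[OF has_derivative_normalize[OF np] this]
    show "((\<lambda>x. f (?\<nu> x)) has_derivative D) (at p)" by (simp only: D_def[abs_def])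
    show "x \<in> cone_over C \<longleftrightarrow> f (?\<nu> x) < 0" if "x \<in> W" for x
    proof -
      have "x \<noteq> 0" "?\<nu> x \<in> unit_sphere \<inter> U" using that by (auto simp: W_def)
      then show ?thesis using CU mem_cone_over[OF CS, of x] by blast
    qed
    obtain v where "v \<bullet> p = 0" "frechet_derivative f (at p) v \<noteq> 0"
      using reg[of p] p'(1) U(2) f0 by blast
    then show "\<exists>v. D v \<noteq> 0" by (intro exI[of _ v]) (simp add: D_def)
  qed
qed

text \<open>After rescaling by \<open>t k\<close>, membership in the cone is decided by the sign of
  \<open>G (p + t k *\<^sub>R x) / t k\<close>, which tends to \<open>a \<bullet> x\<close>. Off a
  null hyperplane the sign is eventually constant, and dominated convergence applies to the
  indicators.\<close>

lemma cone_density_at_boundary: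
  fixes C :: "'a::euclidean_space set"
  assumes C: "openin (top_of_set unit_sphere) C" and "smooth_boundary C" and p: "p \<in> sphere_boundary C"
    and t: "\<And>k. 0 < t k" "t \<longlonglongrightarrow> 0"
  shows "(\<lambda>k. measure lborel (cone_over C \<inter> ball p (t k)) / t k ^ DIM('a))
    \<longlonglongrightarrow> unit_ball_vol (real DIM('a)) / 2"
proof -
  let ?M = "cone_over C"
  obtain U and G :: "'a \<Rightarrow> real" and D where U: "open U" "p \<in> U" and G: "G p = 0" "(G has_derivative D) (at p)"
    and MG: "\<And>x. x \<in> U \<Longrightarrow> x \<in> ?M \<longleftrightarrow> G x < 0" and "\<exists>v. D v \<noteq> 0"
    by (rule boundary_point_derivative[OF assms(1-3)]) (rule that)
  have [measurable]: "?M \<in> sets borel" using open_cone_over[OF C] by simp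
  define a where "a = (\<Sum>b\<in>Basis. D b *\<^sub>R b)"
  have Da: "D x = a \<bullet> x" for x
  proof -
    have "linear D" using G(2) by (rule has_derivative_linear)
    then have "D (\<Sum>b\<in>Basis. (x \<bullet> b) *\<^sub>R b) = (\<Sum>b\<in>Basis. (x \<bullet> b) * D b)"
      by (simp add: linear_sum linear_cmul)
    then have "D x = (\<Sum>b\<in>Basis. (x \<bullet> b) * D b)" by (simp only: euclidean_representation)
    also have "\<dots> = a \<bullet> x"
      unfolding a_def inner_sum_left inner_scaleR_left
      by (intro sum.cong refl) (simp only: inner_commute mult.commute)
    finally show ?thesis .
  qed
  with \<open>\<exists>v. D v \<noteq> 0\<close> have "a \<noteq> 0" by auto
  have t_at: "filterlim t (at 0) sequentially"
  proof -
    have "t k \<noteq> 0" for k using t(1)[of k] by simp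
    with t(2) show ?thesis by (simp add: filterlim_at)
  qed
  let ?B = "\<lambda>k. {x \<in> ball 0 1. p + t k *\<^sub>R x \<in> ?M}"
  have scale: "measure lborel (?M \<inter> ball p (t k)) / t k ^ DIM('a) = (LINT x|lborel. indicator (?B k) x)" for k
  proof -
    have "?M \<inter> ball p (t k) = (\<lambda>x. t k *\<^sub>R x + p) ` ?B k"
    proof (intro set_eqI iffI)
      fix y assume y: "y \<in> ?M \<inter> ball p (t k)"
      have "y = t k *\<^sub>R ((y - p) /\<^sub>R t k) + p" using t(1)[of k] by simp
      moreover have "(y - p) /\<^sub>R t k \<in> ?B k"
      proof -
        have "norm ((y - p) /\<^sub>R t k) = norm (y - p) / t k"
          using t(1)[of k] by (simp only: norm_scaleR) (simp add: divide_inverse mult.commute)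
        also have "\<dots> < 1" using y t(1)[of k] by (simp add: dist_norm norm_minus_commute)
        finally have "(y - p) /\<^sub>R t k \<in> ball 0 1" by simp
        moreover have "p + t k *\<^sub>R ((y - p) /\<^sub>R t k) = y" using t(1)[of k] by simp
        ultimately show ?thesis using y by simp
      qed
      ultimately show "y \<in> (\<lambda>x. t k *\<^sub>R x + p) ` ?B k" by (rule image_eqI)
    next
      fix y assume "y \<in> (\<lambda>x. t k *\<^sub>R x + p) ` ?B k"
      then show "y \<in> ?M \<inter> ball p (t k)"
        using t(1)[of k] by (auto simp: dist_norm add.commute)
    qed
    then have "measure lebesgue (?M \<inter> ball p (t k)) = \<bar>t k\<bar> ^ DIM('a) * measure lebesgue (?B k)"
      by (simp only: measure_lebesgue_affine)
    moreover have "?B k \<in> sets borel" by measurable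
    ultimately show ?thesis using t(1)[of k] by simp
  qed
  have "(\<lambda>k. LINT x|lborel. indicator (?B k) x :: real) \<longlonglongrightarrow>
      (LINT x|lborel. indicator (ball 0 1 \<inter> {x. a \<bullet> x < 0}) x)"
  proof (rule integral_dominated_convergence[where w = "indicator (ball 0 1)"])
    have "{x. a \<bullet> x = 0} \<in> null_sets lborel"
      using negligible_hyperplane[of a 0] \<open>a \<noteq> 0\<close>
      by (auto simp: null_sets_completion_iff negligible_iff_null_sets)
    then have "AE x in lborel. a \<bullet> x \<noteq> 0" by (rule AE_I') auto
    then show "AE x in lborel. (\<lambda>k. indicator (?B k) x :: real) \<longlonglongrightarrow> indicator (ball 0 1 \<inter> {x. a \<bullet> x < 0}) x"
    proof eventually_elim
      fix x assume "a \<bullet> x \<noteq> 0"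
      have dq: "(\<lambda>k. G (p + t k *\<^sub>R x) / t k) \<longlonglongrightarrow> a \<bullet> x"
        using has_derivative_difference_quotient[OF G(2) t_at, of x] by (simp add: G(1) Da)
      have "(\<lambda>k. p + t k *\<^sub>R x) \<longlonglongrightarrow> p + 0 *\<^sub>R x" by (intro tendsto_intros t)
      then have inU: "\<forall>\<^sub>F k in sequentially. p + t k *\<^sub>R x \<in> U"
        using U by (intro topological_tendstoD) auto
      have "\<forall>\<^sub>F k in sequentially. (p + t k *\<^sub>R x \<in> ?M \<longleftrightarrow> a \<bullet> x < 0)"
      proof (cases "a \<bullet> x < 0")
        case True
        from order_tendstoD(2)[OF dq True] inU show ?thesis
        proof eventually_elim
          case (elim k)
          then have "G (p + t k *\<^sub>R x) < 0" using t(1)[of k] by (simp add: divide_less_0_iff)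
          with True MG[OF elim(2)] show ?case by simp
        qed
      next
        case False
        then have "0 < a \<bullet> x" using \<open>a \<bullet> x \<noteq> 0\<close> by simp
        from order_tendstoD(1)[OF dq this] inU show ?thesis
        proof eventually_elim
          case (elim k)
          then have "0 < G (p + t k *\<^sub>R x)" using t(1)[of k] by (simp add: zero_less_divide_iff)
          with False MG[OF elim(2)] show ?case by simp
        qed
      qed
      then have "\<forall>\<^sub>F k in sequentially. indicator (ball 0 1 \<inter> {x. a \<bullet> x < 0}) x = (indicator (?B k) x :: real)"
        by eventually_elim (auto simp: indicator_def)
      then show "(\<lambda>k. indicator (?B k) x :: real) \<longlonglongrightarrow> indicator (ball 0 1 \<inter> {x. a \<bullet> x < 0}) x"
        by (rule tendsto_eventually[OF eventually_mono]) simp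
    qed
    show "AE x in lborel. norm (indicator (?B k) x :: real) \<le> indicator (ball 0 1) x" for k
      by (auto simp: indicator_def)
    show "integrable lborel (indicator (ball (0::'a) 1) :: 'a \<Rightarrow> real)"
      by (intro integrable_real_indicator) (auto simp: emeasure_ball)
    have "?B k \<in> sets lborel" for k unfolding sets_lborel by measurable
    then show "(indicator (?B k) :: 'a \<Rightarrow> real) \<in> borel_measurable lborel" for k
      by (rule borel_measurable_indicator)
    have "ball 0 1 \<inter> {x. a \<bullet> x < 0} \<in> sets lborel" unfolding sets_lborel by measurable
    then show "(indicator (ball 0 1 \<inter> {x. a \<bullet> x < 0}) :: 'a \<Rightarrow> real) \<in> borel_measurable lborel"
      by (rule borel_measurable_indicator)
  qed
  also have "(LINT x|lborel. indicator (ball 0 1 \<inter> {x. a \<bullet> x < 0}) x) = unit_ball_vol (real DIM('a)) / 2"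
    using measure_ball_half_space[OF \<open>a \<noteq> 0\<close>] by simp
  finally show ?thesis by (simp only: scale)
qed

section \<open>Proof of the comparison\<close>

text \<open>If all lower right slopes exceeded \<open>m\<close>, the last point at which the graph
  lies on or above the line of slope \<open>m\<close> through its left end could always be moved
  further right, until it reached \<open>s\<close> against the third hypothesis.\<close>

lemma mono_slope_exists:
  fixes z :: "real \<Rightarrow> real"
  assumes mono: "\<And>x y. x \<le> y \<Longrightarrow> z x \<le> z y" and "r < s" and "z s - z r < m * (s - r)"
  shows "\<exists>\<rho>. r \<le> \<rho> \<and> (\<forall>d>0. \<exists>\<epsilon>>0. \<epsilon> < d \<and> z (\<rho> + \<epsilon>) - z \<rho> \<le> m * \<epsilon>)"
proof (rule ccontr)
  assume contra: "\<nexists>\<rho>. r \<le> \<rho> \<and> (\<forall>d>0. \<exists>\<epsilon>>0. \<epsilon> < d \<and> z (\<rho> + \<epsilon>) - z \<rho> \<le> m * \<epsilon>)"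
  have steep: "\<exists>d>0. \<forall>\<epsilon>. 0 < \<epsilon> \<and> \<epsilon> < d \<longrightarrow> m * \<epsilon> < z (\<rho> + \<epsilon>) - z \<rho>" if "r \<le> \<rho>" for \<rho>
    using contra that by (meson not_less)
  define A where "A = {x. r \<le> x \<and> x \<le> s \<and> z r + m * (x - r) \<le> z x}"
  define c where "c = Sup A"
  have "r \<in> A" using \<open>r < s\<close> by (simp add: A_def)
  have bdd: "bdd_above A" by (auto simp: A_def intro!: bdd_aboveI[of _ s])
  have c: "r \<le> c" "c \<le> s"
    using \<open>r \<in> A\<close> bdd unfolding c_def by (auto simp: A_def intro!: cSup_upper cSup_least)
  \<comment> \<open>Monotonicity replaces continuity: for \<open>m \<ge> 0\<close>, points of
    \<open>A\<close> close to \<open>c\<close> on the left have values at most \<open>z c\<close>.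
    For negative \<open>m\<close> the line falls while \<open>z\<close> does not.\<close>
  have zc: "z r + m * (c - r) \<le> z c"
  proof (cases "0 \<le> m")
    case True
    show ?thesis
    proof (rule field_le_epsilon)
      fix e :: real assume "0 < e"
      obtain x where x: "x \<in> A" "c - e / (m + 1) < x"
        using less_cSupD[of A "c - e / (m + 1)"] \<open>r \<in> A\<close> \<open>0 < e\<close> True
        unfolding c_def[symmetric] by (metis add.commute diff_less_eq divide_pos_pos empty_iff le_less_trans less_add_one less_add_same_cancel1)
      have "x \<le> c" using x(1) bdd unfolding c_def by (rule cSup_upper)
      have "m * (c - x) \<le> m * (e / (m + 1))"
        using x(2) True by (intro mult_left_mono) auto
      also have "\<dots> \<le> e" using True \<open>0 < e\<close> by (simp add: field_simps)
      finally have "m * (c - r) \<le> m * (x - r) + e" by (simp add: algebra_simps)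
      moreover have "z r + m * (x - r) \<le> z c"
        using x(1) mono[OF \<open>x \<le> c\<close>] by (simp add: A_def)
      ultimately show "z r + m * (c - r) \<le> z c + e" by simp
    qed
  next
    case False
    then have "m * (c - r) \<le> 0" using c by (simp add: mult_nonpos_nonneg)
    then show ?thesis using mono[OF c(1)] by simp
  qed
  have "c = s"
  proof (rule ccontr)
    assume "c \<noteq> s"
    then have "c < s" using c by simp
    obtain d where d: "0 < d" "\<And>\<epsilon>. 0 < \<epsilon> \<Longrightarrow> \<epsilon> < d \<Longrightarrow> m * \<epsilon> < z (c + \<epsilon>) - z c"
      using steep[OF c(1)] by blast
    define \<epsilon> where "\<epsilon> = min (d / 2) (s - c)"
    have \<epsilon>: "0 < \<epsilon>" "\<epsilon> < d" "c + \<epsilon> \<le> s" using d(1) \<open>c < s\<close> by (auto simp: \<epsilon>_def)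
    have "z r + m * (c + \<epsilon> - r) \<le> z (c + \<epsilon>)"
      using zc d(2)[OF \<epsilon>(1,2)] by (simp add: algebra_simps)
    then have "c + \<epsilon> \<in> A" using c \<epsilon> by (simp add: A_def)
    then have "c + \<epsilon> \<le> c" using bdd unfolding c_def by (rule cSup_upper)
    with \<epsilon>(1) show False by simp
  qed
  with zc assms(3) show False by simp
qed

text \<open>With \<open>N = real n + 1\<close>, the factor \<open>N\<close> splits as
  \<open>N powr (1 / N) * N powr (real n / N)\<close>, so both sides agree for
  \<open>c = N * \<omega>\<close>; the right one increases with \<open>c\<close>.\<close>

lemma half_space_profile_ge:
  fixes n :: nat and \<omega> c V :: real
  assumes "0 < \<omega>" "(real n + 1) * \<omega> \<le> c" "0 < V"
  shows "(real n + 1) * root (n + 1) (\<omega> / 2) * root (n + 1) V ^ n \<le> half_space_profile c n V"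
proof -
  define N where "N = real n + 1"
  have N: "0 < N" "real (n + 1) = N" by (simp_all add: N_def)
  have "N * root (n + 1) (\<omega> / 2) * root (n + 1) V ^ n
      = N * (\<omega> / 2) powr (1 / N) * (V powr (1 / N)) ^ n"
    using assms by (simp add: root_powr_inverse N_def add.commute)
  also have "(V powr (1 / N)) ^ n = V powr (real n / N)"
    using \<open>0 < V\<close> by (simp add: powr_realpow[symmetric] powr_powr)
  also have "N * (\<omega> / 2) powr (1 / N) = (N * (\<omega> / 2)) powr (1 / N) * N powr (real n / N)"
  proof -
    have "1 / N + real n / N = 1" using N by (simp add: N_def field_simps)
    then have 1: "N powr (1 / N) * N powr (real n / N) = N" using N(1) by (simp flip: powr_add)
    have "(N * (\<omega> / 2)) powr (1 / N) = N powr (1 / N) * (\<omega> / 2) powr (1 / N)"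
      by (rule powr_mult)
    then have "(N * (\<omega> / 2)) powr (1 / N) * N powr (real n / N)
        = (N powr (1 / N) * N powr (real n / N)) * (\<omega> / 2) powr (1 / N)"
      by (simp only: ac_simps)
    then show ?thesis by (simp only: 1)
  qed
  also have "(N * (\<omega> / 2)) powr (1 / N) * N powr (real n / N) * V powr (real n / N)
      \<le> (c / 2) powr (1 / N) * N powr (real n / N) * V powr (real n / N)"
    using assms N by (intro mult_right_mono powr_mono2) (auto simp: N_def)
  finally show ?thesis unfolding N_def half_space_profile_def .
qed

lemma measure_cone_over_ball_scale:
  fixes C :: "'a::euclidean_space set"
  assumes C: "openin (top_of_set unit_sphere) C" and "0 < \<mu>"
  shows "measure lborel (cone_over C \<inter> ball (\<mu> *\<^sub>R p) (\<mu> * r))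
    = \<mu> ^ DIM('a) * measure lborel (cone_over C \<inter> ball p r)"
proof -
  let ?M = "cone_over C"
  have CS: "C \<subseteq> unit_sphere" using openin_imp_subset[OF C] .
  have dist: "dist (\<mu> *\<^sub>R p) (\<mu> *\<^sub>R x) = \<mu> * dist p x" for x
    using \<open>0 < \<mu>\<close> by (simp add: dist_norm flip: scaleR_diff_right)
  have "?M \<inter> ball (\<mu> *\<^sub>R p) (\<mu> * r) = (\<lambda>x. \<mu> *\<^sub>R x + 0) ` (?M \<inter> ball p r)"
  proof (intro set_eqI iffI)
    fix y assume y: "y \<in> ?M \<inter> ball (\<mu> *\<^sub>R p) (\<mu> * r)"
    have y': "y = \<mu> *\<^sub>R (y /\<^sub>R \<mu>)" using \<open>0 < \<mu>\<close> by simp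
    then have "y /\<^sub>R \<mu> \<in> ?M"
      using y scaleR_mem_cone_over_iff[OF CS \<open>0 < \<mu>\<close>, of "y /\<^sub>R \<mu>"] by simp
    moreover have "y /\<^sub>R \<mu> \<in> ball p r"
      using y dist[of "y /\<^sub>R \<mu>"] \<open>0 < \<mu>\<close> by simp
    ultimately show "y \<in> (\<lambda>x. \<mu> *\<^sub>R x + 0) ` (?M \<inter> ball p r)"
      using y' by (intro image_eqI[of _ _ "y /\<^sub>R \<mu>"]) auto
  qed (use \<open>0 < \<mu>\<close> in \<open>auto simp: dist scaleR_mem_cone_over_iff[OF CS]\<close>)
  then have "measure lebesgue (?M \<inter> ball (\<mu> *\<^sub>R p) (\<mu> * r)) = \<bar>\<mu>\<bar> ^ DIM('a) * measure lebesgue (?M \<inter> ball p r)"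
    by (simp only: measure_lebesgue_affine)
  then show ?thesis
    using open_cone_over[OF C] \<open>0 < \<mu>\<close> by simp
qed

text \<open>First order expansion of the power, converting a slope of the root of a volume into a
  slope of the volume. The strict inequality leaves room for the remainder.\<close>

lemma power_increment_le:
  fixes z m b :: real
  assumes "real (Suc n) * z ^ n * m < b"
  shows "\<exists>d>0. \<forall>\<epsilon>. 0 < \<epsilon> \<and> \<epsilon> < d \<longrightarrow> (z + m * \<epsilon>) ^ Suc n - z ^ Suc n \<le> b * \<epsilon>"
proof -
  have "DERIV (\<lambda>\<epsilon>. (z + m * \<epsilon>) ^ Suc n) 0 :> real (Suc n) * z ^ n * m"
  proof -
    have "DERIV (\<lambda>\<epsilon>. z + m * \<epsilon>) 0 :> m" by (auto intro!: derivative_eq_intros)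
    from DERIV_power[OF this, of "Suc n"] show ?thesis
      by (simp add: ac_simps del: power_Suc of_nat_Suc)
  qed
  then have "((\<lambda>\<epsilon>. ((z + m * \<epsilon>) ^ Suc n - z ^ Suc n) / \<epsilon>) \<longlongrightarrow> real (Suc n) * z ^ n * m) (at 0)"
    by (simp add: DERIV_def)
  from order_tendstoD(2)[OF this assms]
  obtain d where "0 < d" and d: "\<And>\<epsilon>. \<epsilon> \<noteq> 0 \<Longrightarrow> dist \<epsilon> 0 < d \<Longrightarrow> ((z + m * \<epsilon>) ^ Suc n - z ^ Suc n) / \<epsilon> < b"
    unfolding eventually_at by auto
  have "(z + m * \<epsilon>) ^ Suc n - z ^ Suc n \<le> b * \<epsilon>" if "0 < \<epsilon>" "\<epsilon> < d" for \<epsilon>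
    using d[of \<epsilon>] that by (simp add: divide_less_eq less_imp_le)
  with \<open>0 < d\<close> show ?thesis by blast
qed

section \<open>The competitor in the cone\<close>

lemma isoperimetric_profile_cone_le:
  fixes C :: "'a::euclidean_space set"
  assumes dim: "DIM('a) = Suc n"
    and C: "openin (top_of_set unit_sphere) C" and "smooth_boundary C" and p: "p \<in> sphere_boundary C"
    and "0 < V" and e: "0 < e" "e < root (Suc n) (unit_ball_vol (real (Suc n)) / 2)"
  shows "isoperimetric_profile (cone_over C) V
    \<le> ereal (real (Suc n) * (root (Suc n) (unit_ball_vol (real (Suc n)) / 2) + 4 * e) * root (Suc n) V ^ n)"
proof -
  let ?M = "cone_over C"
  define a where "a = root (Suc n) (unit_ball_vol (real (Suc n)) / 2)"
  define u where "u r = measure lborel (?M \<inter> ball p r)" for r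
  define z where "z r = root (Suc n) (u r)" for r
  have oM: "open ?M" by (rule open_cone_over[OF C])
  have u0: "0 \<le> u r" for r by (simp add: u_def)
  have zu: "z r ^ Suc n = u r" for r
    unfolding z_def using u0 by (intro real_root_pow_pos2) auto
  have z0: "0 \<le> z r" for r using u0 by (simp add: z_def)
  have mono: "z x \<le> z y" if "x \<le> y" for x y
  proof -
    have fm: "?M \<inter> ball p y \<in> fmeasurable lborel"
      using emeasure_bounded_finite[of "?M \<inter> ball p y"] oM by (auto simp: fmeasurable_def bounded_Int)
    have "u x \<le> u y"
      unfolding u_def by (rule measure_mono_fmeasurable[OF _ _ fm]) (use that oM in auto)
    then show ?thesis by (simp add: z_def)
  qed
  \<comment> \<open>Halving radii, so that the estimates at \<open>k\<close> and
    \<open>Suc k\<close> concern the two ends of the interval from \<open>t k / 2\<close> to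
    \<open>t k\<close>.\<close>
  define t where "t k = (1/2 :: real) ^ k" for k
  have t: "0 < t k" "t (Suc k) = t k / 2" for k by (simp_all add: t_def)
  have "t \<longlonglongrightarrow> 0" unfolding t_def by (intro LIMSEQ_realpow_zero) auto
  then have "(\<lambda>k. u (t k) / t k ^ Suc n) \<longlonglongrightarrow> unit_ball_vol (real (Suc n)) / 2"
    using cone_density_at_boundary[OF C assms(3) p, of t] t(1) by (simp add: u_def dim)
  then have "(\<lambda>k. root (Suc n) (u (t k) / t k ^ Suc n)) \<longlonglongrightarrow> a"
    unfolding a_def by (rule tendsto_real_root)
  moreover have "root (Suc n) (u (t k) / t k ^ Suc n) = z (t k) / t k" for k
    using t(1)[of k] by (simp add: z_def real_root_divide real_root_power_cancel del: power_Suc)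
  ultimately have lim: "(\<lambda>k. z (t k) / t k) \<longlonglongrightarrow> a" by simp
  have ev: "\<forall>\<^sub>F k in sequentially. \<bar>z (t k) / t k - a\<bar> < e"
    using tendstoD[OF lim e(1)] by (simp add: dist_real_def)
  then have "\<forall>\<^sub>F k in sequentially. \<bar>z (t k) / t k - a\<bar> < e \<and> \<bar>z (t (Suc k)) / t (Suc k) - a\<bar> < e"
    by (intro eventually_conj) (rule ev, simp only: eventually_sequentially_Suc[of "\<lambda>k. \<bar>z (t k) / t k - a\<bar> < e"])
  then obtain k where "\<bar>z (t k) / t k - a\<bar> < e" "\<bar>z (t (Suc k)) / t (Suc k) - a\<bar> < e"
    by (auto simp: eventually_sequentially)
  then have "z (t k) < (a + e) * t k" and lower: "(a - e) * (t k / 2) < z (t k / 2)"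
    using t(1)[of k] unfolding t(2) by (auto simp: abs_less_iff field_simps)
  \<comment> \<open>The errors \<open>e * t k\<close> and \<open>e * (t k / 2)\<close> add up to
    \<open>3 * e\<close> times the length of the interval.\<close>
  then have "z (t k) - z (t k / 2) < (a + 3 * e) * (t k - t k / 2)"
    by (simp add: algebra_simps)
  also have "\<dots> \<le> (a + 4 * e) * (t k - t k / 2)"
    using e t(1)[of k] by (intro mult_right_mono) auto
  finally have slope: "z (t k) - z (t k / 2) < (a + 4 * e) * (t k - t k / 2)" .
  have "t k / 2 < t k" using t(1)[of k] by simp
  \<comment> \<open>The radius is controlled from below only; the dilation adjusts the volume in any
    case.\<close>
  from mono_slope_exists[OF mono this slope]
  obtain \<rho> where \<rho>: "t k / 2 \<le> \<rho>"
    "\<And>d. 0 < d \<Longrightarrow> \<exists>\<epsilon>>0. \<epsilon> < d \<and> z (\<rho> + \<epsilon>) - z \<rho> \<le> (a + 4 * e) * \<epsilon>"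
    by blast
  have "0 < \<rho>" using \<rho>(1) t(1)[of k] by linarith
  \<comment> \<open>Here \<open>e < a\<close> is used: the volume at radius \<open>\<rho>\<close>
    must be positive to be dilated to \<open>V\<close>.\<close>
  have "0 < (a - e) * (t k / 2)" using e t(1)[of k] by (simp add: a_def)
  also note lower
  also have "z (t k / 2) \<le> z \<rho>" by (rule mono[OF \<rho>(1)])
  finally have "0 < z \<rho>" .
  define \<mu> where "\<mu> = root (Suc n) V / z \<rho>"
  have "0 < \<mu>" using \<open>0 < V\<close> \<open>0 < z \<rho>\<close> by (simp add: \<mu>_def)
  have \<mu>z: "\<mu> * z \<rho> = root (Suc n) V" using \<open>0 < z \<rho>\<close> by (simp add: \<mu>_def)
  have W: "measure lborel (?M \<inter> ball (\<mu> *\<^sub>R p) (\<mu> * r)) = \<mu> ^ Suc n * u r" for r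
    using measure_cone_over_ball_scale[OF C \<open>0 < \<mu>\<close>, of p r] by (simp add: u_def dim)
  let ?\<Omega> = "?M \<inter> ball (\<mu> *\<^sub>R p) (\<mu> * \<rho>)"
  have V: "measure lborel ?\<Omega> = V"
  proof -
    have "\<mu> ^ Suc n * u \<rho> = (\<mu> * z \<rho>) ^ Suc n" by (simp only: power_mult_distrib zu)
    also have "\<dots> = V" unfolding \<mu>z using \<open>0 < V\<close> by (intro real_root_pow_pos2) auto
    finally show ?thesis by (simp only: W)
  qed
  define \<beta> where "\<beta> = real (Suc n) * (a + 4 * e) * root (Suc n) V ^ n"
  have "relative_perimeter ?M ?\<Omega> \<le> ereal \<beta>"
  proof (rule relative_perimeter_ball_le[OF oM])
    show "0 < \<mu> * \<rho>" using \<open>0 < \<mu>\<close> \<open>0 < \<rho>\<close> by simp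
    fix b \<epsilon>0 :: real assume b: "\<beta> < b" and "0 < \<epsilon>0"
    \<comment> \<open>Dilation by \<open>\<mu>\<close> multiplies volumes by
      \<open>\<mu> ^ Suc n\<close> and radius increments by \<open>\<mu>\<close>, hence slopes by
      \<open>\<mu> ^ n\<close>; with \<open>z \<rho> ^ n\<close> this makes
      \<open>root (Suc n) V ^ n\<close>.\<close>
    have \<beta>: "\<beta> = \<mu> ^ n * (real (Suc n) * z \<rho> ^ n * (a + 4 * e))"
      unfolding \<beta>_def \<mu>z[symmetric] power_mult_distrib by (simp only: ac_simps)
    have "real (Suc n) * z \<rho> ^ n * (a + 4 * e) < b / \<mu> ^ n"
      using b \<open>0 < \<mu>\<close> unfolding \<beta> by (simp add: less_divide_eq mult.commute)
    from power_increment_le[OF this] obtain d where d: "0 < d"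
      "\<And>\<epsilon>. 0 < \<epsilon> \<Longrightarrow> \<epsilon> < d \<Longrightarrow> (z \<rho> + (a + 4 * e) * \<epsilon>) ^ Suc n - z \<rho> ^ Suc n \<le> b / \<mu> ^ n * \<epsilon>"
      by blast
    \<comment> \<open>The increment of the dilated ball is \<open>\<mu> * \<epsilon>\<close>, so the
      bound \<open>\<epsilon>0\<close> is divided by \<open>\<mu>\<close>.\<close>
    obtain \<epsilon> where \<epsilon>: "0 < \<epsilon>" "\<epsilon> < min d (\<epsilon>0 / \<mu>)" "z (\<rho> + \<epsilon>) - z \<rho> \<le> (a + 4 * e) * \<epsilon>"
      using \<rho>(2)[of "min d (\<epsilon>0 / \<mu>)"] d(1) \<open>0 < \<epsilon>0\<close> \<open>0 < \<mu>\<close> by auto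
    have "z (\<rho> + \<epsilon>) ^ Suc n \<le> (z \<rho> + (a + 4 * e) * \<epsilon>) ^ Suc n"
      using \<epsilon>(3) z0 by (intro power_mono) auto
    then have "u (\<rho> + \<epsilon>) - u \<rho> \<le> b / \<mu> ^ n * \<epsilon>"
      using d(2)[of \<epsilon>] \<epsilon> unfolding zu by linarith
    then have "\<mu> ^ Suc n * (u (\<rho> + \<epsilon>) - u \<rho>) \<le> \<mu> ^ Suc n * (b / \<mu> ^ n * \<epsilon>)"
      using \<open>0 < \<mu>\<close> by (intro mult_left_mono) auto
    also have "\<dots> = b * (\<mu> * \<epsilon>)" using \<open>0 < \<mu>\<close> by simp
    finally have "measure lborel (?M \<inter> ball (\<mu> *\<^sub>R p) (\<mu> * (\<rho> + \<epsilon>))) - measure lborel ?\<Omega> \<le> b * (\<mu> * \<epsilon>)"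
      by (simp only: W right_diff_distrib)
    then show "\<exists>\<epsilon>. 0 < \<epsilon> \<and> \<epsilon> < \<epsilon>0 \<and>
        measure lborel (?M \<inter> ball (\<mu> *\<^sub>R p) (\<mu> * \<rho> + \<epsilon>)) - measure lborel ?\<Omega> \<le> b * \<epsilon>"
      using \<epsilon> \<open>0 < \<mu>\<close> by (intro exI[of _ "\<mu> * \<epsilon>"]) (simp add: distrib_left less_divide_eq mult.commute)
  qed
  moreover have "isoperimetric_profile ?M V \<le> relative_perimeter ?M ?\<Omega>"
    unfolding isoperimetric_profile_def
  proof (rule INF_lower, intro CollectI conjI)
    have B: "?\<Omega> \<in> sets borel" using oM by simp
    then show "?\<Omega> \<in> sets vol_measure" using sets_borel_subset_hausdorff by blast
    \<comment> \<open>Boundedness makes the volume finite, as needed to recover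
      \<open>emeasure\<close> from the value of \<open>measure\<close>.\<close>
    have "bounded ?\<Omega>" by (simp add: bounded_Int)
    then have "emeasure lborel ?\<Omega> = ennreal V"
      using emeasure_bounded_finite[of ?\<Omega>] V by (metis emeasure_eq_ennreal_measure infinity_ennreal_def less_irrefl)
    then show "emeasure vol_measure ?\<Omega> = ennreal V" by (simp only: emeasure_vol_measure[OF B])
  qed simp
  ultimately show ?thesis unfolding \<beta>_def a_def by (rule order_trans[rotated])
qed

theorem proposition3p3:
  fixes C :: "'a::euclidean_space set" and n :: nat and V :: real
  assumes "DIM('a) = n + 1"
    and "openin (top_of_set unit_sphere) C"
    and "connected C"
    and "sphere_boundary C \<noteq> {}"
    and "smooth_boundary C"
    and "V > 0"
  shows "isoperimetric_profile (cone_over C) V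
           \<le> ereal (half_space_profile
                (measure (hausdorff_measure n) (unit_sphere :: 'a set)) n V)"
proof -
  let ?\<omega> = "unit_ball_vol (real (Suc n))"
  define a where "a = root (Suc n) (?\<omega> / 2)"
  define v where "v = real (Suc n) * root (Suc n) V ^ n"
  have "0 < ?\<omega>" by simp
  have pos: "0 < a" "0 < v" using \<open>V > 0\<close> \<open>0 < ?\<omega>\<close> by (simp_all add: a_def v_def)
  obtain p where p: "p \<in> sphere_boundary C" using assms(4) by auto
  have "isoperimetric_profile (cone_over C) V \<le> ereal (v * a)"
  proof (rule ereal_le_epsilon2)
    fix d :: real assume "0 < d"
    \<comment> \<open>The first entry keeps \<open>e\<close> below \<open>a\<close>; the second
      makes the excess \<open>v * (4 * e)\<close> at most \<open>d\<close>.\<close>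
    define e where "e = min (a / 2) (d / (4 * v))"
    have e: "0 < e" "e < a" using pos \<open>0 < d\<close> by (auto simp: e_def)
    have "e \<le> d / (4 * v)" by (simp add: e_def)
    then have "v * (4 * e) \<le> d" using pos by (simp add: field_simps)
    have "isoperimetric_profile (cone_over C) V \<le> ereal (v * (a + 4 * e))"
      using isoperimetric_profile_cone_le[OF _ assms(2,5) p \<open>V > 0\<close> e(1), of n] e(2) assms(1)
      by (simp add: a_def v_def ac_simps)
    also have "\<dots> \<le> ereal (v * a) + ereal d"
      using \<open>v * (4 * e) \<le> d\<close> by (simp add: distrib_left)
    finally show "isoperimetric_profile (cone_over C) V \<le> ereal (v * a) + ereal d" .
  qed
  also have "ereal (v * a) \<le> ereal (half_space_profile (measure (hausdorff_measure n) (unit_sphere :: 'a set)) n V)"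
  proof -
    have "(real n + 1) * ?\<omega> \<le> measure (hausdorff_measure n) (unit_sphere :: 'a set)"
      using measure_sphere_ge[where 'a='a] assms(1) by (simp add: add.commute)
    from half_space_profile_ge[OF \<open>0 < ?\<omega>\<close> this \<open>V > 0\<close>]
    show ?thesis by (simp add: a_def v_def ac_simps)
  qed
  finally show ?thesis .
qed

end
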